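(* Let $1\leq p,p_1,p_2<\infty$, $-1/p_1\leq\lambda<0$ and $1/p=1/p_1+1/p_2$. (i) If $-Q<\alpha\leq0$, then there is a constant $C>0$, independent of $f$, $b$, $\Phi$ and $A$, such that $$\Vert\mathcal{H}^b_{\Phi,A}f\Vert_{\dot{L}^{p,\lambda}(\mathbb{H}^n;|\cdot|_h^{\alpha})}\leq C\,C_4\,\Vert f\Vert_{\dot{L}^{p_1,\lambda}(\mathbb{H}^n;|\cdot|_h^{\alpha})}\Vert b\Vert_{CMO^{p_2}(\mathbb{H}^n;|\cdot|_h^{\alpha})},$$ where $$C_4=\int_{\mathbb{H}^n}\frac{|\Phi(y)|}{|y|_h^{Q}}\,\frac{\Vert A(y)\Vert^{(Q+\alpha)(\lambda+1/p_1)}}{|\det A(y)|^{1/p_1}}\,\Vert A(y)\Vert^{-\alpha/p_1}\max\left\{\frac{\Vert A(y)\Vert^{Q}}{|\det A(y)|},\ \big|\log_2\Vert A(y)\Vert\big|\right\}dy.$$ (ii) If $0<\alpha<\infty$ and $p_2>(Q+\alpha)/Q$, then there is a constant $C>0$, independent of $f$, $b$, $\Phi$ and $A$, such that $$\Vert\mathcal{H}^b_{\Phi,A}f\Vert_{\dot{L}^{p,\lambda}(\mathbb{H}^n;|\cdot|_h^{\alpha})}\leq C\,C_5\,\Vert f\Vert_{\dot{L}^{p_1,\lambda}(\mathbb{H}^n;|\cdot|_h^{\alpha})}\Vert b\Vert_{CMO^{p_2}(\mathbb{H}^n;|\cdot|_h^{\alpha})},$$ where $$\begin{aligned}C_5=\int_{\mathbb{H}^n}\frac{|\Phi(y)|}{|y|_h^{Q}}\Bigg(&\frac{\Vert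 A(y)\Vert^{(Q+\alpha)(\lambda+1/p)}}{|\det A(y)|^{1/p}}\,\Vert A^{-1}(y)\Vert^{\alpha/p}\\&+\frac{\Vert A(y)\Vert^{(Q+\alpha)(\lambda+1/p_1)}}{|\det A(y)|^{1/p_1}}\,\Vert A^{-1}(y)\Vert^{\alpha/p_1}\max\left\{\frac{\Vert A(y)\Vert^{Q}}{|\det A(y)|},\ \big|\log_2\Vert A(y)\Vert\big|\right\}\Bigg)dy.\end{aligned}$$
   Context: The Heisenberg group $\mathbb{H}^n$ is $\mathbf{R}^{2n}\times\mathbf{R}$ with group law $x\cdot y=\big(x_1+y_1,\dots,x_{2n}+y_{2n},\,x_{2n+1}+y_{2n+1}+2\sum_{j=1}^n(y_jx_{n+j}-x_jy_{n+j})\big)$; the inverse of $x$ is $-x$; Haar measure is Lebesgue measure $dx$, and $|E|$ is the measure of $E$. $Q=2n+2$ is the homogeneous dimension. The norm is $|x|_h=\big[(\sum_{i=1}^{2n}x_i^2)^2+x_{2n+1}^2\big]^{1/4}$, the distance is $d(p,q)=|q^{-1}p|_h$, and $B(x,r)=\{y: d(x,y)<r\}$. For a $(2n+1)\times(2n+1)$ real matrix $M$ (acting on $\mathbf{R}^{2n+1}$), $\Vert M\Vert=\sup_{x\in\mathbb{H}^n,\,x\neq0}|Mx|_h/|x|_h$. $A^{-1}(y)$ denotes the inverse matrix of $A(y)$. $\Phi$ is a locally integrable function on $\mathbb{H}^n$, and $A(y)$ is a function on $\mathbb{H}^n$ with values in $(2n+1)\times(2n+1)$ matrices with $\det A(y)\neq0$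 for almost every $y$ in the support of $\Phi$. The Hausdorff operator is $\mathcal{H}_{\Phi,A}f(x)=\int_{\mathbb{H}^n}\frac{\Phi(y)}{|y|_h^Q}f(A(y)x)\,dy$. For a locally integrable function $b$ on $\mathbb{H}^n$, its commutator is $\mathcal{H}^b_{\Phi,A}f=b\,\mathcal{H}_{\Phi,A}f-\mathcal{H}_{\Phi,A}(bf)$, i.e. $\mathcal{H}^b_{\Phi,A}f(x)=\int_{\mathbb{H}^n}\frac{\Phi(y)}{|y|_h^Q}f(A(y)x)\,[b(x)-b(A(y)x)]\,dy$. For a weight $w$ (a nonnegative locally integrable function on $\mathbb{H}^n$; here $w(x)=|x|_h^\alpha$), put $w(E)=\int_E w(x)\,dx$. For $1\leq p<\infty$ and $-1/p\leq\lambda<0$, the weighted central Morrey space $\dot{L}^{p,\lambda}(\mathbb{H}^n;w)$ consists of $f\in L^p_{loc}(\mathbb{H}^n;w)$ with $\Vert f\Vert_{\dot{L}^{p,\lambda}(\mathbb{H}^n;w)}=\sup_{r>0}\left(\frac{1}{w(B(0,r))^{1+p\lambda}}\int_{B(0,r)}|f(x)|^pw(x)\,dx\right)^{1/p}<\infty$. For $1\leq p<\infty$, the weighted central BMO space $CMO^p(\mathbb{H}^n;w)$ consists of $f\in L^p_{loc}(\mathbb{H}^n;w)$ with $\Vert f\Vert_{CMO^p(\mathbb{H}^n;w)}=\sup_{r>0}\left(\frac1{w(B(0,r))}\int_{B(0,r)}|f(x)-f_{B(0,r)}|^pw(x)\,dx\right)^{1/p}<\infty$, where $f_{B(0,r)}=\frac1{|B(0,r)|}\int_{B(0,r)}f(x)\,dx$.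 *)

theory Defs
  imports "HOL-Analysis.Analysis"
begin

(* Coordinates of R^(2n+1), with n = CARD('n): Inl (Inl j) is x_j, Inl (Inr j) is x_(n+j) and
   Inr () is x_(2n+1). *)
type_synonym 'n heis = "real ^ (('n + 'n) + unit)"

type_synonym 'n heis_mat = "real ^ (('n + 'n) + unit) ^ (('n + 'n) + unit)"

definition hmul :: "'n::finite heis \<Rightarrow> 'n heis \<Rightarrow> 'n heis" where
  "hmul x y = (\<chi> i. case i of
      Inl k \<Rightarrow> x $ Inl k + y $ Inl k
    | Inr u \<Rightarrow> x $ Inr u + y $ Inr u
        + 2 * (\<Sum>j\<in>UNIV. y $ Inl (Inl j) * x $ Inl (Inr j) - x $ Inl (Inl j) * y $ Inl (Inr j)))"

definition hinv :: "'n::finite heis \<Rightarrow> 'n heis" where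
  "hinv x = - x"

definition hnorm :: "'n::finite heis \<Rightarrow> real" where
  "hnorm x = root 4 ((\<Sum>k\<in>UNIV. (x $ Inl k)\<^sup>2)\<^sup>2 + (x $ Inr ())\<^sup>2)"

definition hdist :: "'n::finite heis \<Rightarrow> 'n heis \<Rightarrow> real" where
  "hdist p q = hnorm (hmul (hinv q) p)"

definition hball :: "'n::finite heis \<Rightarrow> real \<Rightarrow> 'n heis set" where
  "hball x r = {y. hdist x y < r}"

(* The homogeneous dimension Q. *)
definition hdim :: "'n::finite itself \<Rightarrow> nat" where
  "hdim _ = 2 * CARD('n) + 2"

(* Powers of extended nonnegative reals, with x^0 = 1 for every x (real powr has 0 powr 0 = 0). *)
definition epowr :: "ennreal \<Rightarrow> real \<Rightarrow> ennreal" where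
  "epowr x a =
    (if a = 0 then 1
     else if x = 0 then (if 0 < a then 0 else \<infinity>)
     else if x = \<infinity> then (if 0 < a then \<infinity> else 0)
     else ennreal (enn2real x powr a))"

definition abs_log2 :: "ennreal \<Rightarrow> ennreal" where
  "abs_log2 x = (if x = 0 \<or> x = \<infinity> then \<infinity> else ennreal \<bar>log 2 (enn2real x)\<bar>)"

(* This supremum is infinite unless M is block diagonal for R^(2n) x R, because hnorm scales
   differently in the two blocks; hence the extended values. *)
definition mat_hnorm :: "'n::finite heis_mat \<Rightarrow> ennreal" where
  "mat_hnorm M = (SUP x\<in>UNIV - {0}. ennreal (hnorm (M *v x) / hnorm x))"

definition abs_det :: "'n::finite heis_mat \<Rightarrow> ennreal" where
  "abs_det M = ennreal \<bar>det M\<bar>"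

definition locally_integrable :: "('n::finite heis \<Rightarrow> complex) \<Rightarrow> bool" where
  "locally_integrable f \<longleftrightarrow> (\<forall>K. compact K \<longrightarrow> set_integrable lebesgue K f)"

definition hausdorff_data :: "('n::finite heis \<Rightarrow> complex) \<Rightarrow> ('n heis \<Rightarrow> 'n heis_mat) \<Rightarrow> bool" where
  "hausdorff_data \<Phi> A \<longleftrightarrow>
     locally_integrable \<Phi> \<and> A \<in> borel_measurable lebesgue \<and>
     (AE y in lebesgue. y \<in> support_on UNIV \<Phi> \<longrightarrow> det (A y) \<noteq> 0)"

definition hausdorff_integrand ::
    "('n::finite heis \<Rightarrow> complex) \<Rightarrow> ('n heis \<Rightarrow> 'n heis_mat) \<Rightarrow> ('n heis \<Rightarrow> complex) \<Rightarrow> 'n heis \<Rightarrow> 'n heis \<Rightarrow> complex"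
  where "hausdorff_integrand \<Phi> A f x y = \<Phi> y / complex_of_real (hnorm y ^ hdim TYPE('n)) * f (A y *v x)"

definition hausdorff ::
    "('n::finite heis \<Rightarrow> complex) \<Rightarrow> ('n heis \<Rightarrow> 'n heis_mat) \<Rightarrow> ('n heis \<Rightarrow> complex) \<Rightarrow> 'n heis \<Rightarrow> complex"
  where "hausdorff \<Phi> A f x = (LINT y|lebesgue. hausdorff_integrand \<Phi> A f x y)"

definition hausdorff_commutator ::
    "('n::finite heis \<Rightarrow> complex) \<Rightarrow> ('n heis \<Rightarrow> 'n heis_mat) \<Rightarrow> ('n heis \<Rightarrow> complex) \<Rightarrow> ('n heis \<Rightarrow> complex)
      \<Rightarrow> 'n heis \<Rightarrow> complex"
  where "hausdorff_commutator \<Phi> A b f x = b x * hausdorff \<Phi> A f x - hausdorff \<Phi> A (\<lambda>z. b z * f z) x"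

(* powr gives the value 0 at x = 0, which is a null set. *)
definition hweight :: "real \<Rightarrow> 'n::finite heis \<Rightarrow> real" where
  "hweight \<alpha> x = hnorm x powr \<alpha>"

definition wmeas :: "('n::finite heis \<Rightarrow> real) \<Rightarrow> 'n heis set \<Rightarrow> ennreal" where
  "wmeas w E = (\<integral>\<^sup>+x\<in>E. ennreal (w x) \<partial>lebesgue)"

definition Lp_loc :: "real \<Rightarrow> ('n::finite heis \<Rightarrow> real) \<Rightarrow> ('n heis \<Rightarrow> complex) set" where
  "Lp_loc p w = {f. f \<in> borel_measurable lebesgue \<and>
     (\<forall>K. compact K \<longrightarrow> (\<integral>\<^sup>+x\<in>K. ennreal (cmod (f x) powr p * w x) \<partial>lebesgue) < \<infinity>)}"

definition morrey_norm :: "real \<Rightarrow> real \<Rightarrow> ('n::finite heis \<Rightarrow> real) \<Rightarrow> ('n heis \<Rightarrow> complex) \<Rightarrow> ennreal" where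
  "morrey_norm p lam w f = (SUP r\<in>{0<..}.
     epowr ((\<integral>\<^sup>+x\<in>hball 0 r. ennreal (cmod (f x) powr p * w x) \<partial>lebesgue)
             / epowr (wmeas w (hball 0 r)) (1 + p * lam)) (1 / p))"

definition central_morrey :: "real \<Rightarrow> real \<Rightarrow> ('n::finite heis \<Rightarrow> real) \<Rightarrow> ('n heis \<Rightarrow> complex) set" where
  "central_morrey p lam w = {f \<in> Lp_loc p w. morrey_norm p lam w f < \<infinity>}"

definition ball_mean :: "('n::finite heis \<Rightarrow> complex) \<Rightarrow> real \<Rightarrow> complex" where
  "ball_mean f r =
     (LINT x:hball 0 r|lebesgue. f x) / complex_of_real (measure lebesgue (hball (0 :: 'n heis) r))"

definition cmo_norm :: "real \<Rightarrow> ('n::finite heis \<Rightarrow> real) \<Rightarrow> ('n heis \<Rightarrow> complex) \<Rightarrow> ennreal" where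
  "cmo_norm p w f = (SUP r\<in>{0<..}.
     epowr ((\<integral>\<^sup>+x\<in>hball 0 r. ennreal (cmod (f x - ball_mean f r) powr p * w x) \<partial>lebesgue)
             / wmeas w (hball 0 r)) (1 / p))"

definition central_cmo :: "real \<Rightarrow> ('n::finite heis \<Rightarrow> real) \<Rightarrow> ('n heis \<Rightarrow> complex) set" where
  "central_cmo p w = {f \<in> Lp_loc p w. cmo_norm p w f < \<infinity>}"

(* The factor |Phi(y)| / |y|^Q comes first in the two constants below: where Phi vanishes the
   integrand is 0 even if A y is singular, since 0 * \<infinity> = 0 in ennreal. *)
definition C4 :: "real \<Rightarrow> real \<Rightarrow> real \<Rightarrow> ('n::finite heis \<Rightarrow> complex) \<Rightarrow> ('n heis \<Rightarrow> 'n heis_mat) \<Rightarrow> ennreal" where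
  "C4 p\<^sub>1 lam \<alpha> \<Phi> A = (let Q = real (hdim TYPE('n)) in
     \<integral>\<^sup>+y. ennreal (cmod (\<Phi> y) / hnorm y ^ hdim TYPE('n))
       * (epowr (mat_hnorm (A y)) ((Q + \<alpha>) * (lam + 1 / p\<^sub>1)) / epowr (abs_det (A y)) (1 / p\<^sub>1)
          * epowr (mat_hnorm (A y)) (- \<alpha> / p\<^sub>1)
          * max (epowr (mat_hnorm (A y)) Q / abs_det (A y)) (abs_log2 (mat_hnorm (A y)))) \<partial>lebesgue)"

definition C5 :: "real \<Rightarrow> real \<Rightarrow> real \<Rightarrow> real \<Rightarrow> ('n::finite heis \<Rightarrow> complex) \<Rightarrow> ('n heis \<Rightarrow> 'n heis_mat) \<Rightarrow> ennreal" where
  "C5 p p\<^sub>1 lam \<alpha> \<Phi> A = (let Q = real (hdim TYPE('n)) in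
     \<integral>\<^sup>+y. ennreal (cmod (\<Phi> y) / hnorm y ^ hdim TYPE('n))
       * (epowr (mat_hnorm (A y)) ((Q + \<alpha>) * (lam + 1 / p)) / epowr (abs_det (A y)) (1 / p)
            * epowr (mat_hnorm (matrix_inv (A y))) (\<alpha> / p)
          + epowr (mat_hnorm (A y)) ((Q + \<alpha>) * (lam + 1 / p\<^sub>1)) / epowr (abs_det (A y)) (1 / p\<^sub>1)
            * epowr (mat_hnorm (matrix_inv (A y))) (\<alpha> / p\<^sub>1)
            * max (epowr (mat_hnorm (A y)) Q / abs_det (A y)) (abs_log2 (mat_hnorm (A y)))) \<partial>lebesgue)"

(* The Bochner integral is 0 where it diverges, so that the commutator is really defined has to
   be said separately. *)
definition commutator_well_defined ::
    "('n::finite heis \<Rightarrow> complex) \<Rightarrow> ('n heis \<Rightarrow> 'n heis_mat) \<Rightarrow> ('n heis \<Rightarrow> complex) \<Rightarrow> ('n heis \<Rightarrow> complex) \<Rightarrow> bool"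
  where "commutator_well_defined \<Phi> A b f \<longleftrightarrow>
     (AE x in lebesgue. integrable lebesgue (hausdorff_integrand \<Phi> A f x)
        \<and> integrable lebesgue (hausdorff_integrand \<Phi> A (\<lambda>z. b z * f z) x))"

end

theory Submission
  imports Defs
begin

text \<open>
  For fixed \<open>y\<close> put \<open>M = A y\<close>, and let \<open>m\<close> be its norm and \<open>D = |det M|\<close>. The commutator is the superposition over \<open>y\<close>,
  with density \<open>|\<Phi> y| / |y|\<^sup>Q\<close>, of the slices \<open>f (M x) (b x - b (M x))\<close>. By Minkowski's integral
  inequality (\<open>Minkowski_integral\<close>, \<open>nn_integral_superposition_le\<close>) its norm over a ball is at most the integral
  of the norms of the slices, so that the theorem reduces to an estimate for a single invertible matrix
  (\<open>commutator_slice_bound\<close>).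

  A matrix acts on norms over balls about the origin in two ways. It maps the ball of radius
  \<open>r\<close> into that of radius \<open>m r\<close>, whose weighted measure is larger by the factor \<open>m\<close> to the power \<open>Q + \<alpha>\<close>
  (\<open>wmeas_hball_scale\<close>). And if the weight satisfies \<open>w x \<le> \<kappa> w (M x)\<close>, then the substitution \<open>M x\<close>
  costs the factor \<open>\<kappa> / D\<close> in a weighted integral (\<open>nn_integral_ball_measure_linear_le\<close>). For \<open>\<alpha> \<le> 0\<close> the norm of \<open>M\<close>
  provides such a \<open>\<kappa>\<close>, for \<open>\<alpha> > 0\<close> the norm of the inverse does; this is why the two constants have different forms.

  In a slice, \<open>b x - b (M x)\<close> is compared with the means of \<open>b\<close> over the balls of radius \<open>r\<close> and \<open>m r\<close>.
  The deviations from these means are controlled by the central BMO norm of \<open>b\<close>, and Hoelder's inequality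
  combines them with the Morrey norm of \<open>f\<close>. The two means differ by at most a multiple of
  \<open>1 + |log 2 m|\<close>, because the mean moves by a bounded amount when the radius is doubled
  (\<open>cmod_ball_mean_diff_le\<close>). The means are unweighted while the BMO norm is weighted. For \<open>\<alpha> \<le> 0\<close> the weight is
  bounded below on a ball by its value at the boundary; for \<open>\<alpha> > 0\<close> it vanishes at the origin, and one needs the power
  \<open>-\<alpha> / (p\<^sub>2 - 1)\<close> of the norm to be integrable there, which is the condition \<open>p\<^sub>2 > (Q + \<alpha>) / Q\<close>.
  Finally \<open>D \<le> m\<^sup>Q\<close> (\<open>abs_det_le\<close>), so that the maximum of \<open>m\<^sup>Q / D\<close> and \<open>|log 2 m|\<close> is at least one
  and absorbs the remaining constants.

  The same bounds show that the integrals converge for almost every \<open>x\<close>. Functions that are only Lebesgue measurable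
  are first replaced by Borel representatives, which is harmless because an invertible matrix pulls
  null sets back to null sets (\<open>AE_AE_matrix_vector\<close>).
\<close>

section \<open>Linear changes of variables\<close>

lemma nn_integral_lborel_split_coordinate:
  fixes g :: "'a::euclidean_space \<Rightarrow> ennreal" and e :: 'a
  assumes [measurable]: "g \<in> borel_measurable borel" and e: "e \<in> Basis"
  shows "(\<integral>\<^sup>+x. g x \<partial>lborel) =
    (\<integral>\<^sup>+\<omega>. (\<integral>\<^sup>+t. g (t *\<^sub>R e + (\<Sum>b\<in>Basis - {e}. \<omega> b *\<^sub>R b)) \<partial>lborel) \<partial>(\<Pi>\<^sub>M b\<in>Basis - {e}. lborel))"
proof -
  interpret product_sigma_finite "\<lambda>_::'a. lborel :: real measure" ..
  have B: "insert e (Basis - {e}) = (Basis :: 'a set)"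
    using e by auto
  have sum: "(\<Sum>b\<in>Basis. (fun_upd \<omega> e t) b *\<^sub>R b) = t *\<^sub>R e + (\<Sum>b\<in>Basis - {e}. \<omega> b *\<^sub>R b)" for \<omega> t
    using e by (simp add: sum.remove)
  have "(\<integral>\<^sup>+x. g x \<partial>lborel) = (\<integral>\<^sup>+\<omega>. g (\<Sum>b\<in>Basis. \<omega> b *\<^sub>R b) \<partial>(\<Pi>\<^sub>M b\<in>Basis. lborel))"
    by (subst lborel_eq) (simp add: nn_integral_distr)
  also have "\<dots> = (\<integral>\<^sup>+\<omega>. g (\<Sum>b\<in>Basis. \<omega> b *\<^sub>R b) \<partial>(\<Pi>\<^sub>M b\<in>insert e (Basis - {e}). lborel))"
    by (simp only: B)
  also have "\<dots> = (\<integral>\<^sup>+\<omega>. (\<integral>\<^sup>+t. g (\<Sum>b\<in>Basis. (fun_upd \<omega> e t) b *\<^sub>R b) \<partial>lborel) \<partial>(\<Pi>\<^sub>M b\<in>Basis - {e}. lborel))"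
    by (rule product_nn_integral_insert) (simp, simp, unfold B, measurable)
  finally show ?thesis
    unfolding sum .
qed

text \<open>
  With all other coordinates frozen, the shear only translates the coordinate along \<open>e\<close>,
  and Lebesgue measure on the line does not see the translation.
\<close>

lemma nn_integral_shear:
  fixes g :: "'a::euclidean_space \<Rightarrow> ennreal"
  assumes [measurable]: "g \<in> borel_measurable borel" and e: "e \<in> Basis" and d: "d \<in> Basis" and ne: "d \<noteq> e"
  shows "(\<integral>\<^sup>+x. g (x + (c * (x \<bullet> d)) *\<^sub>R e) \<partial>lborel) = (\<integral>\<^sup>+x. g x \<partial>lborel)"
proof -
  have 1: "(t *\<^sub>R e + (\<Sum>b\<in>Basis - {e}. \<omega> b *\<^sub>R b)) \<bullet> d = \<omega> d" for t and \<omega> :: "'a \<Rightarrow> real"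
    using e d ne
    by (auto simp: inner_add_left inner_sum_left inner_Basis if_distrib sum.delta' cong: if_cong)
  have "(\<integral>\<^sup>+x. g (x + (c * (x \<bullet> d)) *\<^sub>R e) \<partial>lborel) =
    (\<integral>\<^sup>+\<omega>. (\<integral>\<^sup>+t. g ((c * \<omega> d + 1 * t) *\<^sub>R e + (\<Sum>b\<in>Basis - {e}. \<omega> b *\<^sub>R b)) \<partial>lborel) \<partial>(\<Pi>\<^sub>M b\<in>Basis - {e}. lborel))"
    by (subst nn_integral_lborel_split_coordinate[OF _ e])
       (simp_all only: 1, auto simp: algebra_simps)
  also have "\<dots> = (\<integral>\<^sup>+\<omega>. (\<integral>\<^sup>+t. g (t *\<^sub>R e + (\<Sum>b\<in>Basis - {e}. \<omega> b *\<^sub>R b)) \<partial>lborel) \<partial>(\<Pi>\<^sub>M b\<in>Basis - {e}. lborel))"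
  proof (rule nn_integral_cong)
    fix \<omega> :: "'a \<Rightarrow> real"
    let ?h = "\<lambda>t. g (t *\<^sub>R e + (\<Sum>b\<in>Basis - {e}. \<omega> b *\<^sub>R b))"
    have "(\<integral>\<^sup>+t. ?h t \<partial>lborel) = ennreal \<bar>1\<bar> * (\<integral>\<^sup>+t. ?h (c * \<omega> d + 1 * t) \<partial>lborel)"
      by (rule nn_integral_real_affine) auto
    then show "(\<integral>\<^sup>+t. ?h (c * \<omega> d + 1 * t) \<partial>lborel) = (\<integral>\<^sup>+t. ?h t \<partial>lborel)"
      by simp
  qed
  also have "\<dots> = (\<integral>\<^sup>+x. g x \<partial>lborel)"
    by (rule nn_integral_lborel_split_coordinate[OF _ e, symmetric]) simp
  finally show ?thesis .
qed

lemma nn_integral_permute_coordinates: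
  fixes g :: "real^'n \<Rightarrow> ennreal" and s :: "'n \<Rightarrow> 'n"
  assumes [measurable]: "g \<in> borel_measurable borel" and s: "bij s"
  shows "(\<integral>\<^sup>+x. g (\<chi> i. x $ s i) \<partial>lborel) = (\<integral>\<^sup>+x. g x \<partial>lborel)"
proof -
  let ?T = "\<lambda>x::real^'n. \<chi> i. x $ s i"
  have "linear ?T"
    by (rule linearI) (auto simp: vec_eq_iff)
  then have [measurable]: "?T \<in> borel_measurable borel"
    by (simp add: borel_measurable_continuous_onI linear_continuous_on linear_conv_bounded_linear)
  have prodB: "(\<Prod>b\<in>Basis. h b) = (\<Prod>i\<in>UNIV. h (axis i 1))" for h :: "real^'n \<Rightarrow> real"
  proof -
    have B: "Basis = range (\<lambda>i. axis i (1::real) :: real^'n)"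
      by (auto simp: Basis_vec_def)
    have inj: "inj (\<lambda>i. axis i (1::real) :: real^'n)"
      by (auto simp: inj_on_def axis_eq_axis)
    show ?thesis
      unfolding B prod.reindex[OF inj] by simp
  qed
  have "lborel = distr lborel borel ?T"
  proof (rule lborel_eqI)
    fix l u :: "real^'n" assume le: "\<And>b. b \<in> Basis \<Longrightarrow> l \<bullet> b \<le> u \<bullet> b"
    then have le': "l $ i \<le> u $ i" for i
      using le[of "axis i 1"] by (simp add: inner_axis)
    have "?T -` box l u = box (\<chi> i. l $ inv s i) (\<chi> i. u $ inv s i)"
      using s by (auto simp: mem_box_cart) (metis bij_inv_eq_iff)+
    then have "emeasure (distr lborel borel ?T) (box l u) = emeasure lborel (box (\<chi> i. l $ inv s i) (\<chi> i. u $ inv s i) :: (real^'n) set)"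
      by (simp add: emeasure_distr)
    also have "\<dots> = ennreal (\<Prod>i\<in>UNIV. u $ inv s i - l $ inv s i)"
    proof (subst emeasure_lborel_box)
      fix b :: "real^'n" assume "b \<in> Basis"
      then obtain i where "b = axis i 1"
        by (auto simp: Basis_vec_def)
      then show "(\<chi> i. l $ inv s i) \<bullet> b \<le> (\<chi> i. u $ inv s i) \<bullet> b"
        using le' by (simp add: inner_axis)
    qed (simp add: prodB inner_axis)
    also have "(\<Prod>i\<in>UNIV. u $ inv s i - l $ inv s i) = (\<Prod>i\<in>UNIV. u $ i - l $ i)"
      using prod.reindex_bij_betw[OF bij_imp_bij_inv[OF s], of "\<lambda>i. u $ i - l $ i"] by simp
    also have "\<dots> = (\<Prod>b\<in>Basis. (u - l) \<bullet> b)"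
      by (simp add: prodB inner_axis)
    finally show "emeasure (distr lborel borel ?T) (box l u) = (\<Prod>b\<in>Basis. (u - l) \<bullet> b)" .
  qed simp
  then have "(\<integral>\<^sup>+x. g x \<partial>lborel) = (\<integral>\<^sup>+x. g x \<partial>(distr lborel borel ?T))"
    by simp
  also have "\<dots> = (\<integral>\<^sup>+x. g (?T x) \<partial>lborel)"
    by (rule nn_integral_distr) auto
  finally show ?thesis ..
qed

lemma borel_measurable_matrix_vector_mult [measurable (raw)]:
  fixes A :: "'a \<Rightarrow> real^'n^'m"
  assumes "A \<in> borel_measurable M" "g \<in> borel_measurable M"
  shows "(\<lambda>x. A x *v g x) \<in> borel_measurable M"
proof -
  have "continuous_on UNIV (\<lambda>z::(real^'n^'m) \<times> (real^'n). fst z *v snd z)"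
    unfolding matrix_vector_mult_def by (intro continuous_intros)
  then show ?thesis
    using assms by (rule borel_measurable_continuous_Pair[rotated 2])
qed

lemma nn_integral_diagonal:
  fixes g :: "real^'n \<Rightarrow> ennreal" and A :: "real^'n^'n"
  assumes [measurable]: "g \<in> borel_measurable borel" and A: "\<And>i j. i \<noteq> j \<Longrightarrow> A $ i $ j = 0" and det: "det A \<noteq> 0"
  shows "ennreal \<bar>det A\<bar> * (\<integral>\<^sup>+x. g (A *v x) \<partial>lborel) = (\<integral>\<^sup>+x. g x \<partial>lborel)"
proof -
  have det_eq: "det A = (\<Prod>i\<in>UNIV. A $ i $ i)"
    using A by (rule det_diagonal)
  define c :: "real^'n \<Rightarrow> real" where "c b = b \<bullet> (A *v b)" for b
  have c: "c (axis i 1) = A $ i $ i" for i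
    by (simp add: c_def inner_axis' matrix_vector_mult_basis column_def)
  have B: "Basis = range (\<lambda>i. axis i (1::real) :: real^'n)"
    by (auto simp: Basis_vec_def)
  have inj: "inj (\<lambda>i. axis i (1::real) :: real^'n)"
    by (auto simp: inj_on_def axis_eq_axis)
  have prod: "(\<Prod>j\<in>Basis. \<bar>c j\<bar>) = \<bar>det A\<bar>"
    unfolding B prod.reindex[OF inj] by (simp add: c det_eq abs_prod)
  have T: "0 + (\<Sum>j\<in>Basis. (c j * (x \<bullet> j)) *\<^sub>R j) = A *v x" for x
  proof -
    have "(\<Sum>j\<in>Basis. (c j * (x \<bullet> j)) *\<^sub>R j) = (\<Sum>i\<in>UNIV. (A $ i $ i * x $ i) *\<^sub>R axis i 1)"
      unfolding B sum.reindex[OF inj] by (simp add: c inner_axis)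
    also have "\<dots> = A *v x"
    proof (subst vec_eq_iff, rule allI)
      fix k
      have "(A *v x) $ k = (\<Sum>j\<in>UNIV. if j = k then A $ k $ k * x $ k else 0)"
        unfolding matrix_vector_mult_def vec_lambda_beta by (rule sum.cong) (use A in auto)
      then show "(\<Sum>i\<in>UNIV. (A $ i $ i * x $ i) *\<^sub>R axis i 1) $ k = (A *v x) $ k"
        by (simp add: axis_def if_distrib cong: if_cong)
    qed
    finally show ?thesis by simp
  qed
  have "c j \<noteq> 0" if "j \<in> Basis" for j
    using that det unfolding B by (auto simp: c det_eq)
  from lborel_affine_euclidean[where c=c and t=0, OF this]
  have "lborel = density (distr lborel borel (\<lambda>x. A *v x)) (\<lambda>_. ennreal \<bar>det A\<bar>)"
    unfolding T prod by simp
  then have "(\<integral>\<^sup>+x. g x \<partial>lborel) = (\<integral>\<^sup>+x. g x \<partial>density (distr lborel borel (\<lambda>x. A *v x)) (\<lambda>_. ennreal \<bar>det A\<bar>))"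
    by simp
  also have "\<dots> = ennreal \<bar>det A\<bar> * (\<integral>\<^sup>+x. g (A *v x) \<partial>lborel)"
    by (simp add: nn_integral_density nn_integral_distr nn_integral_cmult)
  finally show ?thesis ..
qed

text \<open>
  The matrices for which the formula holds are closed under products, so it is enough to treat
  diagonal matrices, transpositions of coordinates and shears. A matrix with a zero row is singular,
  which makes the claim vacuous for it.
\<close>

theorem nn_integral_linear_substitution:
  fixes g :: "real^'n \<Rightarrow> ennreal" and A :: "real^'n^'n"
  assumes "g \<in> borel_measurable borel" and "det A \<noteq> 0"
  shows "ennreal \<bar>det A\<bar> * (\<integral>\<^sup>+x. g (A *v x) \<partial>lborel) = (\<integral>\<^sup>+x. g x \<partial>lborel)"
proof -
  define P where "P A \<longleftrightarrow> (det A \<noteq> 0 \<longrightarrow> (\<forall>g::real^'n \<Rightarrow> ennreal. g \<in> borel_measurable borel \<longrightarrow>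
      ennreal \<bar>det A\<bar> * (\<integral>\<^sup>+x. g (A *v x) \<partial>lborel) = (\<integral>\<^sup>+x. g x \<partial>lborel)))" for A :: "real^'n^'n"
  have "P A"
  proof (rule induct_matrix_elementary[of P])
    fix A B assume PA: "P A" and PB: "P B"
    show "P (A ** B)"
      unfolding P_def
    proof (intro impI allI)
      fix g :: "real^'n \<Rightarrow> ennreal"
      assume det: "det (A ** B) \<noteq> 0" and [measurable]: "g \<in> borel_measurable borel"
      have "ennreal \<bar>det (A ** B)\<bar> * (\<integral>\<^sup>+x. g ((A ** B) *v x) \<partial>lborel)
        = ennreal \<bar>det A\<bar> * (ennreal \<bar>det B\<bar> * (\<integral>\<^sup>+x. g (A *v (B *v x)) \<partial>lborel))"
        by (simp add: det_mul abs_mult ennreal_mult' matrix_vector_mul_assoc mult.assoc)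
      also have "ennreal \<bar>det B\<bar> * (\<integral>\<^sup>+x. g (A *v (B *v x)) \<partial>lborel) = (\<integral>\<^sup>+x. g (A *v x) \<partial>lborel)"
        using PB det unfolding P_def
        by (auto simp: det_mul dest!: spec[of _ "\<lambda>x. g (A *v x)"])
      also have "ennreal \<bar>det A\<bar> * (\<integral>\<^sup>+x. g (A *v x) \<partial>lborel) = (\<integral>\<^sup>+x. g x \<partial>lborel)"
        using PA det unfolding P_def by (auto simp: det_mul)
      finally show "ennreal \<bar>det (A ** B)\<bar> * (\<integral>\<^sup>+x. g ((A ** B) *v x) \<partial>lborel) = (\<integral>\<^sup>+x. g x \<partial>lborel)" .
    qed
  next
    fix A :: "real^'n^'n" and i assume "row i A = 0"
    then show "P A"
      by (simp add: P_def det_zero_row)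
  next
    fix A :: "real^'n^'n" assume "\<And>i j. i \<noteq> j \<Longrightarrow> A $ i $ j = 0"
    then show "P A"
      unfolding P_def using nn_integral_diagonal by blast
  next
    fix m n :: 'n assume "m \<noteq> n"
    let ?s = "Transposition.transpose m n"
    let ?A = "(\<chi> i j. mat 1 $ i $ ?s j) :: real^'n^'n"
    have "det ?A = of_int (sign ?s)"
      using det_permute_columns[of ?s "mat 1 :: real^'n^'n"] by (simp add: permutes_swap_id)
    then have det: "\<bar>det ?A\<bar> = 1"
      by (simp add: sign_def)
    have "?A *v x = (\<chi> i. x $ ?s i)" for x :: "real^'n"
    proof (subst vec_eq_iff, rule allI)
      fix i
      have "(?A *v x) $ i = (\<Sum>j\<in>UNIV. if j = ?s i then x $ ?s i else 0)"
        unfolding matrix_vector_mult_def vec_lambda_beta mat_def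
        by (rule sum.cong) auto
      then show "(?A *v x) $ i = (\<chi> i. x $ ?s i) $ i"
        by simp
    qed
    then show "P ?A"
      unfolding P_def using nn_integral_permute_coordinates[of _ ?s] by (simp add: det)
  next
    fix m n :: 'n and c assume ne: "m \<noteq> n"
    let ?A = "(\<chi> i j. if i = m \<and> j = n then c else of_bool (i = j)) :: real^'n^'n"
    have row: "?A = (\<chi> k. if k = m then row m (mat 1) + c *s row n (mat 1) else row k (mat 1))"
      using ne by (auto simp: vec_eq_iff row_def mat_def)
    have "det ?A = 1"
      unfolding row using ne by (subst det_row_operation) auto
    then have det: "\<bar>det ?A\<bar> = 1"
      by simp
    have "?A *v x = x + (c * (x \<bullet> axis n 1)) *\<^sub>R axis m 1" for x :: "real^'n"
    proof (subst vec_eq_iff, rule allI)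
      fix i
      have "(?A *v x) $ i = (\<Sum>j\<in>UNIV. (if j = i then x $ i else 0) + (if j = n then (if i = m then c * x $ n else 0) else 0))"
        unfolding matrix_vector_mult_def using ne
        by (auto intro!: sum.cong)
      then show "(?A *v x) $ i = (x + (c * (x \<bullet> axis n 1)) *\<^sub>R axis m 1) $ i"
        by (simp add: sum.distrib inner_axis) (simp add: axis_def)
    qed
    then show "P ?A"
      unfolding P_def using ne by (auto simp: det axis_eq_axis axis_in_Basis_iff intro!: nn_integral_shear)
  qed
  then show ?thesis
    using assms by (simp add: P_def)
qed

section \<open>Hoelder's and Minkowski's inequalities\<close>

lemma ennreal_linear_combination:
  "0 \<le> a \<Longrightarrow> 0 \<le> b \<Longrightarrow> 0 \<le> x \<Longrightarrow> 0 \<le> y \<Longrightarrow> ennreal a * ennreal x + ennreal b * ennreal y = ennreal (a * x + b * y)"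
  by (simp add: ennreal_mult)

lemma weighted_arith_geo_mean:
  fixes x y \<theta> :: real
  assumes "0 \<le> x" "0 \<le> y" "0 < \<theta>" "\<theta> < 1"
  shows "x powr \<theta> * y powr (1 - \<theta>) \<le> \<theta> * x + (1 - \<theta>) * y"
proof (cases "x = 0 \<or> y = 0")
  case False
  define z where "z = \<theta> * ln x + (1 - \<theta>) * ln y"
  have tangent: "exp z * (1 + ln t - z) \<le> t" if "t > 0" for t :: real
  proof -
    have "exp z * (1 + (ln t - z)) \<le> exp z * exp (ln t - z)"
      by (intro mult_left_mono exp_ge_add_one_self) auto
    also have "\<dots> = t"
      using that by (simp add: exp_diff)
    finally show ?thesis by (simp add: add_diff_eq)
  qed
  have "exp z = exp z * (1 + (\<theta> * ln x + (1 - \<theta>) * ln y - z))"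
    by (simp add: z_def[symmetric])
  also have "\<dots> = \<theta> * (exp z * (1 + ln x - z)) + (1 - \<theta>) * (exp z * (1 + ln y - z))"
    by algebra
  also have "\<dots> \<le> \<theta> * x + (1 - \<theta>) * y"
    using assms False by (intro add_mono mult_left_mono tangent) auto
  finally show ?thesis
    using False unfolding powr_def z_def exp_add by simp
qed (use assms in auto)

lemma Young_powr:
  fixes s t p :: real
  assumes "0 \<le> s" "0 \<le> t" "1 \<le> p"
  shows "p * s * t powr (p - 1) \<le> s powr p + (p - 1) * t powr p"
proof (cases "p = 1")
  case False
  then have p: "p > 1" using assms by simp
  have "(s powr p) powr (1/p) * (t powr p) powr (1 - 1/p) \<le> (1/p) * s powr p + (1 - 1/p) * t powr p"
    using p by (intro weighted_arith_geo_mean) auto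
  moreover have "(s powr p) powr (1/p) = s" "(t powr p) powr (1 - 1/p) = t powr (p - 1)"
    using p assms by (simp_all add: powr_powr right_diff_distrib)
  ultimately have "p * (s * t powr (p - 1)) \<le> p * ((1/p) * s powr p + (1 - 1/p) * t powr p)"
    using p by (intro mult_left_mono) auto
  moreover have "p * ((1/p) * s powr p + (1 - 1/p) * t powr p) = s powr p + (p - 1) * t powr p"
    using p by (simp add: distrib_left right_diff_distrib left_diff_distrib)
  ultimately show ?thesis
    by (simp add: mult.assoc)
qed (use assms in auto)

lemma powr_convex_combination:
  fixes s r p \<theta> :: real
  assumes "0 \<le> s" "0 \<le> r" "1 \<le> p" "0 \<le> \<theta>" "\<theta> \<le> 1"
  shows "(\<theta> * s + (1 - \<theta>) * r) powr p \<le> \<theta> * s powr p + (1 - \<theta>) * r powr p"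
proof -
  define t where "t = \<theta> * s + (1 - \<theta>) * r"
  have t: "t \<ge> 0" using assms by (auto simp: t_def)
  have "\<theta> * (p * s * t powr (p - 1)) + (1 - \<theta>) * (p * r * t powr (p - 1))
     \<le> \<theta> * (s powr p + (p - 1) * t powr p) + (1 - \<theta>) * (r powr p + (p - 1) * t powr p)"
    using assms t by (intro add_mono mult_left_mono Young_powr) auto
  moreover have "\<theta> * (p * s * t powr (p - 1)) + (1 - \<theta>) * (p * r * t powr (p - 1)) = p * (t * t powr (p - 1))"
    by (simp add: t_def algebra_simps)
  moreover have "t * t powr (p - 1) = t powr p"
    using t by (cases "t = 0") (auto simp: powr_diff)
  ultimately have "t powr p \<le> \<theta> * s powr p + (1 - \<theta>) * r powr p"
    by (simp add: algebra_simps)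
  then show ?thesis
    by (simp add: t_def)
qed

text \<open>
  A norm inequality with a positive real right-hand side. Keeping the bound strictly positive allows
  the usual normalisation \<open>F / a\<close> in Hoelder's and Minkowski's inequalities without a case for
  norm zero; functions of norm zero are treated at the end by letting the bound tend to zero.
\<close>

definition Lp_bound :: "'a measure \<Rightarrow> real \<Rightarrow> ('a \<Rightarrow> real) \<Rightarrow> real \<Rightarrow> bool" where
  "Lp_bound M q g a \<longleftrightarrow>
     g \<in> borel_measurable M \<and> 0 < a \<and> (\<integral>\<^sup>+x. ennreal (\<bar>g x\<bar> powr q) \<partial>M) \<le> ennreal (a powr q)"

text \<open>
  The common shape of the proofs of Hoelder's and of the triangle inequality: a pointwise convexity
  bound for the normalised functions \<open>F / a\<close> and \<open>G / b\<close>, which is then integrated.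
\<close>

lemma Lp_bound_combine:
  assumes F: "Lp_bound M q F a" and G: "Lp_bound M r G b"
    and [measurable]: "H \<in> borel_measurable M" and "0 < c" "0 \<le> \<theta>" "\<theta> \<le> 1"
    and le: "\<And>x. x \<in> space M \<Longrightarrow> \<bar>H x\<bar> powr p \<le> c powr p * (\<theta> * (\<bar>F x\<bar> / a) powr q + (1 - \<theta>) * (\<bar>G x\<bar> / b) powr r)"
  shows "Lp_bound M p H c"
proof -
  have [measurable]: "F \<in> borel_measurable M" "G \<in> borel_measurable M" and ab: "a > 0" "b > 0"
    using F G by (auto simp: Lp_bound_def)
  define A where "A = c powr p * \<theta> * a powr (-q)"
  define B where "B = c powr p * (1 - \<theta>) * b powr (-r)"
  have nn: "A \<ge> 0" "B \<ge> 0"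
    using assms by (auto simp: A_def B_def)
  have "(\<integral>\<^sup>+x. ennreal (\<bar>H x\<bar> powr p) \<partial>M) \<le> (\<integral>\<^sup>+x. ennreal A * ennreal (\<bar>F x\<bar> powr q) + ennreal B * ennreal (\<bar>G x\<bar> powr r) \<partial>M)"
  proof (rule nn_integral_mono)
    fix x assume "x \<in> space M"
    note le[OF this]
    also have "c powr p * (\<theta> * (\<bar>F x\<bar> / a) powr q + (1 - \<theta>) * (\<bar>G x\<bar> / b) powr r) = A * \<bar>F x\<bar> powr q + B * \<bar>G x\<bar> powr r"
    proof -
      have "(\<bar>F x\<bar> / a) powr q = \<bar>F x\<bar> powr q * a powr (-q)" "(\<bar>G x\<bar> / b) powr r = \<bar>G x\<bar> powr r * b powr (-r)"
        using ab by (simp_all add: powr_divide powr_minus_divide)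
      then show ?thesis
        by (simp add: A_def B_def distrib_left mult_ac)
    qed
    finally show "ennreal (\<bar>H x\<bar> powr p) \<le> ennreal A * ennreal (\<bar>F x\<bar> powr q) + ennreal B * ennreal (\<bar>G x\<bar> powr r)"
      by (subst ennreal_linear_combination) (use nn in \<open>auto intro: ennreal_leI simp del: ennreal_plus\<close>)
  qed
  also have "\<dots> = ennreal A * (\<integral>\<^sup>+x. ennreal (\<bar>F x\<bar> powr q) \<partial>M) + ennreal B * (\<integral>\<^sup>+x. ennreal (\<bar>G x\<bar> powr r) \<partial>M)"
    by (simp add: nn_integral_add nn_integral_cmult)
  also have "\<dots> \<le> ennreal A * ennreal (a powr q) + ennreal B * ennreal (b powr r)"
    using F G by (intro add_mono mult_left_mono) (auto simp: Lp_bound_def)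
  also have "\<dots> = ennreal (A * a powr q + B * b powr r)"
    using nn by (simp add: ennreal_mult)
  also have "A * a powr q + B * b powr r = c powr p"
  proof -
    have "a powr (-q) * a powr q = 1" "b powr (-r) * b powr r = 1"
      using ab by (simp_all add: powr_minus)
    then show ?thesis
      by (simp add: A_def B_def mult.assoc) (simp add: algebra_simps)
  qed
  finally show ?thesis
    using assms by (simp add: Lp_bound_def)
qed

text \<open>
  Hoelder's inequality with three exponents; the pointwise bound is the weighted mean inequality
  applied to \<open>(F / a)\<^sup>q\<close> and \<open>(G / b)\<^sup>r\<close> with the weights \<open>p / q\<close> and \<open>p / r\<close>.
\<close>

lemma Lp_bound_mult:
  assumes F: "Lp_bound M q F a" and G: "Lp_bound M r G b"
    and pos: "0 < p" "0 < q" "0 < r" and eq: "1 / p = 1 / q + 1 / r"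
  shows "Lp_bound M p (\<lambda>x. F x * G x) (a * b)"
proof (rule Lp_bound_combine[OF F G, where \<theta>="p / q"])
  have ab: "a > 0" "b > 0"
    using F G by (auto simp: Lp_bound_def)
  show "(\<lambda>x. F x * G x) \<in> borel_measurable M"
    using F G by (auto simp: Lp_bound_def)
  show "0 < a * b" using ab by simp
  have \<theta>: "1 - p / q = p / r"
  proof -
    have "p * (1 / p) = p * (1 / q + 1 / r)"
      using eq by simp
    then show ?thesis
      using pos by (simp add: distrib_left)
  qed
  have "0 < p / r"
    using pos by simp
  with \<theta> have lt: "0 < p / q" "p / q < 1"
    using pos by (simp, linarith)
  then show "0 \<le> p / q" "p / q \<le> 1" by auto
  fix x
  have "((\<bar>F x\<bar> / a) powr q) powr (p / q) * ((\<bar>G x\<bar> / b) powr r) powr (1 - p / q)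
    \<le> p / q * (\<bar>F x\<bar> / a) powr q + (1 - p / q) * (\<bar>G x\<bar> / b) powr r"
    using lt by (intro weighted_arith_geo_mean) auto
  moreover have "((\<bar>F x\<bar> / a) powr q) powr (p / q) * ((\<bar>G x\<bar> / b) powr r) powr (1 - p / q)
     = \<bar>F x * G x\<bar> powr p / (a * b) powr p"
    unfolding \<theta> using pos ab by (simp add: powr_powr powr_divide powr_mult abs_mult)
  ultimately show "\<bar>F x * G x\<bar> powr p \<le> (a * b) powr p * (p / q * (\<bar>F x\<bar> / a) powr q + (1 - p / q) * (\<bar>G x\<bar> / b) powr r)"
    using ab by (simp add: divide_le_eq mult.commute)
qed

lemma Lp_bound_add:
  assumes F: "Lp_bound M p F a" and G: "Lp_bound M p G b" and p: "1 \<le> p"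
  shows "Lp_bound M p (\<lambda>x. F x + G x) (a + b)"
proof (rule Lp_bound_combine[OF F G, where \<theta>="a / (a + b)"])
  have ab: "a > 0" "b > 0"
    using F G by (auto simp: Lp_bound_def)
  show "(\<lambda>x. F x + G x) \<in> borel_measurable M"
    using F G by (auto simp: Lp_bound_def)
  show "0 < a + b" using ab by simp
  show \<theta>: "0 \<le> a / (a + b)" "a / (a + b) \<le> 1"
    using ab by (auto simp: field_simps)
  fix x
  have eq: "a / (a + b) * (\<bar>F x\<bar> / a) + (1 - a / (a + b)) * (\<bar>G x\<bar> / b) = (\<bar>F x\<bar> + \<bar>G x\<bar>) / (a + b)"
  proof -
    have "1 - a / (a + b) = b / (a + b)"
      using ab by (simp add: field_simps)
    then show ?thesis
      using ab by (simp add: add_divide_distrib)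
  qed
  have "\<bar>F x + G x\<bar> powr p \<le> (\<bar>F x\<bar> + \<bar>G x\<bar>) powr p"
    using p by (intro powr_mono2) auto
  also have "\<dots> = (a + b) powr p * ((\<bar>F x\<bar> + \<bar>G x\<bar>) / (a + b)) powr p"
    using ab by (simp add: powr_divide)
  also have "\<dots> \<le> (a + b) powr p * (a / (a + b) * (\<bar>F x\<bar> / a) powr p + (1 - a / (a + b)) * (\<bar>G x\<bar> / b) powr p)"
    using ab p \<theta> unfolding eq[symmetric] by (intro mult_left_mono powr_convex_combination) auto
  finally show "\<bar>F x + G x\<bar> powr p \<le> (a + b) powr p * (a / (a + b) * (\<bar>F x\<bar> / a) powr p + (1 - a / (a + b)) * (\<bar>G x\<bar> / b) powr p)" .
qed

lemma Lp_bound_mono: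
  assumes F: "Lp_bound M p F a" and "0 \<le> p" "a \<le> b"
    and [measurable]: "G \<in> borel_measurable M" and le: "\<And>x. x \<in> space M \<Longrightarrow> \<bar>G x\<bar> \<le> \<bar>F x\<bar>"
  shows "Lp_bound M p G b"
proof -
  have "(\<integral>\<^sup>+x. ennreal (\<bar>G x\<bar> powr p) \<partial>M) \<le> (\<integral>\<^sup>+x. ennreal (\<bar>F x\<bar> powr p) \<partial>M)"
    using le assms by (intro nn_integral_mono ennreal_leI powr_mono2) auto
  also have "\<dots> \<le> ennreal (a powr p)"
    using F by (simp add: Lp_bound_def)
  also have "\<dots> \<le> ennreal (b powr p)"
    using F assms by (intro ennreal_leI powr_mono2) (auto simp: Lp_bound_def)
  finally show ?thesis
    using F assms by (auto simp: Lp_bound_def)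
qed

lemma Lp_bound_cmult:
  assumes F: "Lp_bound M p F a" and c: "0 < c"
  shows "Lp_bound M p (\<lambda>x. c * F x) (c * a)"
proof -
  have [measurable]: "F \<in> borel_measurable M" and a: "a > 0"
    using F by (auto simp: Lp_bound_def)
  have "(\<integral>\<^sup>+x. ennreal (\<bar>c * F x\<bar> powr p) \<partial>M) = ennreal (c powr p) * (\<integral>\<^sup>+x. ennreal (\<bar>F x\<bar> powr p) \<partial>M)"
    using c by (simp add: abs_mult powr_mult ennreal_mult nn_integral_cmult)
  also have "\<dots> \<le> ennreal (c powr p) * ennreal (a powr p)"
    using F by (intro mult_left_mono) (auto simp: Lp_bound_def)
  also have "\<dots> = ennreal ((c * a) powr p)"
    using c a by (simp add: powr_mult ennreal_mult)
  finally show ?thesis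
    using c a by (simp add: Lp_bound_def)
qed

lemma Lp_bound_const:
  assumes M: "emeasure M (space M) \<le> ennreal m" and "0 < m" "0 < c" "0 < p"
  shows "Lp_bound M p (\<lambda>_. c) (c * m powr (1 / p))"
proof -
  have "(\<integral>\<^sup>+x. ennreal (\<bar>c\<bar> powr p) \<partial>M) \<le> ennreal (c powr p) * ennreal m"
    using assms by (auto intro!: mult_left_mono)
  also have "\<dots> = ennreal ((c * m powr (1 / p)) powr p)"
    using assms by (simp add: powr_mult powr_powr ennreal_mult)
  finally show ?thesis
    using assms by (simp add: Lp_bound_def)
qed

lemma epowr_ennreal: "0 < x \<Longrightarrow> epowr (ennreal x) a = ennreal (x powr a)"
  by (simp add: epowr_def)

lemma epowr_ennreal_nonneg: "0 \<le> x \<Longrightarrow> 0 < a \<Longrightarrow> epowr (ennreal x) a = ennreal (x powr a)"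
  by (simp add: epowr_def)

lemma epowr_mono:
  assumes "x \<le> y" "0 \<le> a"
  shows "epowr x a \<le> epowr y a"
proof (cases x; cases y)
  fix s t :: real assume "0 \<le> s" "x = ennreal s" "0 \<le> t" "y = ennreal t"
  with assms show ?thesis
    by (cases "a = 0") (auto simp: epowr_ennreal_nonneg intro!: ennreal_leI powr_mono2, simp add: epowr_def)
qed (use assms in \<open>auto simp: epowr_def top_unique\<close>)

lemma borel_measurable_epowr [measurable (raw)]:
  assumes [measurable]: "f \<in> borel_measurable M"
  shows "(\<lambda>x. epowr (f x) a) \<in> borel_measurable M"
  unfolding epowr_def by measurable

text \<open>
  Jensen's inequality for the function \<open>u / K\<close> and the measure with density \<open>K\<close>, of total mass at
  most \<open>S\<close>. Young's inequality bounds \<open>u\<close> linearly in \<open>(u / K)\<^sup>p\<close> with a free parameter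
  \<open>t > 0\<close>, and after integration \<open>t\<close> is chosen optimally.
\<close>

lemma epowr_nn_integral_le:
  assumes [measurable]: "u \<in> borel_measurable M" "K \<in> borel_measurable M"
    and u: "\<And>y. 0 \<le> u y" and K: "\<And>y. 0 < K y" and p: "1 \<le> p" and S: "0 < S"
    and KS: "(\<integral>\<^sup>+y. ennreal (K y) \<partial>M) \<le> ennreal S"
  shows "epowr (\<integral>\<^sup>+y. ennreal (u y) \<partial>M) p
    \<le> ennreal (S powr (p - 1)) * (\<integral>\<^sup>+y. ennreal (u y powr p * K y powr (1 - p)) \<partial>M)"
proof -
  define J where "J = (\<integral>\<^sup>+y. ennreal (u y powr p * K y powr (1 - p)) \<partial>M)"
  show ?thesis
  proof (cases J)
    case top
    then show ?thesis using S by (simp add: J_def[symmetric] ennreal_mult_top)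
  next
    case (real j)
    have le: "(\<integral>\<^sup>+y. ennreal (u y) \<partial>M) \<le> ennreal (t powr (1 - p) / p * j + (p - 1) / p * t * S)" if t: "t > 0" for t
    proof -
      have "(\<integral>\<^sup>+y. ennreal (u y) \<partial>M)
        \<le> (\<integral>\<^sup>+y. ennreal (t powr (1 - p) / p) * ennreal (u y powr p * K y powr (1 - p)) + ennreal ((p - 1) / p * t) * ennreal (K y) \<partial>M)"
      proof (rule nn_integral_mono)
        fix y
        have Kt: "K y * t > 0" using K t by simp
        have "p * u y * (K y * t) powr (p - 1) \<le> u y powr p + (p - 1) * (K y * t) powr p"
          using u p Kt by (intro Young_powr) auto
        then have "(p * u y * (K y * t) powr (p - 1)) * (K y * t) powr (1 - p)
          \<le> (u y powr p + (p - 1) * (K y * t) powr p) * (K y * t) powr (1 - p)"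
          by (intro mult_right_mono) auto
        moreover have "(K y * t) powr (p - 1) * (K y * t) powr (1 - p) = 1"
          using K[of y] t by (simp add: powr_add[symmetric])
        moreover have "(K y * t) powr p * (K y * t) powr (1 - p) = K y * t"
          using Kt by (simp add: powr_add[symmetric])
        ultimately have "p * u y \<le> u y powr p * (K y * t) powr (1 - p) + (p - 1) * (K y * t)"
          by (simp add: algebra_simps)
        also have "(K y * t) powr (1 - p) = K y powr (1 - p) * t powr (1 - p)"
          using K[of y] t by (simp add: powr_mult)
        finally have "u y \<le> (u y powr p * (K y powr (1 - p) * t powr (1 - p)) + (p - 1) * (K y * t)) / p"
          using p by (simp add: le_divide_eq mult.commute)
        also have "\<dots> = t powr (1 - p) / p * (u y powr p * K y powr (1 - p)) + (p - 1) / p * t * K y"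
          by (simp add: add_divide_distrib mult_ac)
        finally have "u y \<le> t powr (1 - p) / p * (u y powr p * K y powr (1 - p)) + (p - 1) / p * t * K y" .
        then show "ennreal (u y) \<le> ennreal (t powr (1 - p) / p) * ennreal (u y powr p * K y powr (1 - p)) + ennreal ((p - 1) / p * t) * ennreal (K y)"
          by (subst ennreal_linear_combination) (use p t K[of y] in \<open>auto intro: ennreal_leI simp del: ennreal_plus\<close>)
      qed
      also have "\<dots> = ennreal (t powr (1 - p) / p) * J + ennreal ((p - 1) / p * t) * (\<integral>\<^sup>+y. ennreal (K y) \<partial>M)"
        unfolding J_def by (simp add: nn_integral_add nn_integral_cmult)
      also have "\<dots> \<le> ennreal (t powr (1 - p) / p) * ennreal j + ennreal ((p - 1) / p * t) * ennreal S"
        using KS real by (intro add_mono mult_left_mono) auto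
      also have "\<dots> = ennreal (t powr (1 - p) / p * j + (p - 1) / p * t * S)"
        using p t real S by (simp add: ennreal_mult[symmetric])
      finally show ?thesis .
    qed
    from le[of 1] obtain i where i: "(\<integral>\<^sup>+y. ennreal (u y) \<partial>M) = ennreal i" "i \<ge> 0"
      by (cases "\<integral>\<^sup>+y. ennreal (u y) \<partial>M") (auto simp: top_unique)
    have le_real: "i \<le> t powr (1 - p) / p * j + (p - 1) / p * t * S" if t: "t > 0" for t
    proof -
      have "0 \<le> t powr (1 - p) / p * j + (p - 1) / p * t * S"
        using t p S real by (intro add_nonneg_nonneg mult_nonneg_nonneg) auto
      then show ?thesis
        using le[OF t] unfolding i(1) by (subst (asm) ennreal_le_iff)
    qed
    have "i powr p \<le> S powr (p - 1) * j"
    proof (cases "j = 0")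
      case True
      have "i = 0"
      proof (rule ccontr)
        assume "i \<noteq> 0"
        with i have "i > 0" by simp
        define X where "X = (p - 1) / p * i"
        have "X \<le> 1 * i"
          unfolding X_def using p \<open>i > 0\<close> by (intro mult_right_mono) (auto simp: field_simps)
        moreover have "i \<le> X / 2"
          using le_real[of "i / (2 * S)"] True S \<open>i > 0\<close> by (simp add: X_def)
        ultimately show False using \<open>i > 0\<close> by linarith
      qed
      then show ?thesis using p True by simp
    next
      case False
      then have j: "j > 0" using real by simp
      \<comment> \<open>the minimiser of the right-hand side of \<open>le_real\<close>\<close>
      define t where "t = (j / S) powr (1 / p)"
      have t: "t > 0" using j S by (simp add: t_def)
      have tp: "t powr p = j / S"
        using j S p by (simp add: t_def powr_powr)
      have "t powr (1 - p) * j = t * S"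
        using t S j by (simp add: powr_diff tp)
      then have "t powr (1 - p) / p * j + (p - 1) / p * t * S = t * S"
        using p by (simp add: field_simps)
      then have "i \<le> t * S" using le_real[OF t] by simp
      then have "i powr p \<le> (t * S) powr p"
        using i p by (intro powr_mono2) auto
      also have "\<dots> = S powr (p - 1) * j"
        using t S j by (simp add: powr_mult tp powr_diff)
      finally show ?thesis .
    qed
    then show ?thesis
      using i p real S unfolding J_def[symmetric]
      by (simp add: epowr_ennreal_nonneg ennreal_leI flip: ennreal_mult)
  qed
qed

text \<open>
  Minkowski's inequality for a strictly positive majorant \<open>K y\<close> of the norm of the slice at \<open>y\<close>: Jensen's
  inequality is applied for each \<open>x\<close>, and Tonelli's theorem then brings in the bound on
  the slices.
\<close>

lemma Minkowski_integral_dominated: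
  assumes "sigma_finite_measure M" "sigma_finite_measure N"
    and G[measurable]: "case_prod G \<in> borel_measurable (M \<Otimes>\<^sub>M N)" and G0: "\<And>x y. 0 \<le> G x y"
    and [measurable]: "K \<in> borel_measurable N" and K: "\<And>y. 0 < K y" and p: "1 \<le> p" and S: "0 < S"
    and KS: "(\<integral>\<^sup>+y. ennreal (K y) \<partial>N) \<le> ennreal S"
    and GK: "AE y in N. (\<integral>\<^sup>+x. ennreal (G x y powr p) \<partial>M) \<le> ennreal (K y powr p)"
  shows "(\<integral>\<^sup>+x. epowr (\<integral>\<^sup>+y. ennreal (G x y) \<partial>N) p \<partial>M) \<le> ennreal (S powr p)"
proof -
  interpret M: sigma_finite_measure M by fact
  interpret N: sigma_finite_measure N by fact
  interpret P: pair_sigma_finite M N ..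
  have "(\<integral>\<^sup>+x. epowr (\<integral>\<^sup>+y. ennreal (G x y) \<partial>N) p \<partial>M)
    \<le> (\<integral>\<^sup>+x. ennreal (S powr (p - 1)) * (\<integral>\<^sup>+y. ennreal (G x y powr p * K y powr (1 - p)) \<partial>N) \<partial>M)"
    using G0 K p S KS by (intro nn_integral_mono epowr_nn_integral_le) auto
  also have "\<dots> = ennreal (S powr (p - 1)) * (\<integral>\<^sup>+x. (\<integral>\<^sup>+y. ennreal (G x y powr p * K y powr (1 - p)) \<partial>N) \<partial>M)"
    by (rule nn_integral_cmult) measurable
  also have "(\<integral>\<^sup>+x. (\<integral>\<^sup>+y. ennreal (G x y powr p * K y powr (1 - p)) \<partial>N) \<partial>M)
     = (\<integral>\<^sup>+y. (\<integral>\<^sup>+x. ennreal (G x y powr p * K y powr (1 - p)) \<partial>M) \<partial>N)"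
    by (rule P.Fubini'[symmetric]) measurable
  also have "\<dots> = (\<integral>\<^sup>+y. (\<integral>\<^sup>+x. ennreal (G x y powr p) \<partial>M) * ennreal (K y powr (1 - p)) \<partial>N)"
    by (intro nn_integral_cong, subst nn_integral_multc[symmetric]) (simp_all add: ennreal_mult)
  also have "\<dots> \<le> (\<integral>\<^sup>+y. ennreal (K y) \<partial>N)"
  proof (rule nn_integral_mono_AE, use GK in eventually_elim)
    fix y assume "(\<integral>\<^sup>+x. ennreal (G x y powr p) \<partial>M) \<le> ennreal (K y powr p)"
    then have "(\<integral>\<^sup>+x. ennreal (G x y powr p) \<partial>M) * ennreal (K y powr (1 - p)) \<le> ennreal (K y powr p) * ennreal (K y powr (1 - p))"
      by (rule mult_right_mono) simp
    also have "\<dots> = ennreal (K y)"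
      using K[of y] by (simp add: powr_add[symmetric] flip: ennreal_mult)
    finally show "(\<integral>\<^sup>+x. ennreal (G x y powr p) \<partial>M) * ennreal (K y powr (1 - p)) \<le> ennreal (K y)" .
  qed
  also have "\<dots> \<le> ennreal S" by fact
  finally have "(\<integral>\<^sup>+x. epowr (\<integral>\<^sup>+y. ennreal (G x y) \<partial>N) p \<partial>M) \<le> ennreal (S powr (p - 1)) * ennreal S"
    by (simp add: mult_left_mono)
  also have "\<dots> = ennreal (S powr p)"
    using S by (simp add: powr_diff flip: ennreal_mult)
  finally show ?thesis .
qed

text \<open>
  The slice norm \<open>n y\<close> may vanish or, on a null set, be infinite. Adding a small multiple of a strictly
  positive integrable function makes it an admissible majorant, and the multiple is then sent to zero.
\<close>

theorem Minkowski_integral: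
  assumes M: "sigma_finite_measure M" and N: "sigma_finite_measure N"
    and G[measurable]: "case_prod G \<in> borel_measurable (M \<Otimes>\<^sub>M N)" and G0: "\<And>x y. 0 \<le> G x y"
    and p: "1 \<le> p" and S: "0 \<le> S"
    and le: "(\<integral>\<^sup>+y. epowr (\<integral>\<^sup>+x. ennreal (G x y powr p) \<partial>M) (1 / p) \<partial>N) \<le> ennreal S"
  shows "(\<integral>\<^sup>+x. epowr (\<integral>\<^sup>+y. ennreal (G x y) \<partial>N) p \<partial>M) \<le> ennreal (S powr p)"
proof -
  interpret M: sigma_finite_measure M by fact
  interpret N: sigma_finite_measure N by fact
  interpret P: pair_sigma_finite M N ..
  obtain e where [measurable]: "e \<in> borel_measurable N" and e: "\<And>y. (0::real) < e y" "integrable N e"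
    using N.obtain_positive_integrable_function by metis
  define E where "E = (LINT y|N. e y)"
  have E: "(\<integral>\<^sup>+y. ennreal (e y) \<partial>N) = ennreal E" "E \<ge> 0"
    unfolding E_def using e by (auto intro!: nn_integral_eq_integral integral_nonneg simp: less_imp_le)
  define n where "n y = epowr (\<integral>\<^sup>+x. ennreal (G x y powr p) \<partial>M) (1 / p)" for y
  have [measurable]: "n \<in> borel_measurable N"
    unfolding n_def by measurable
  have n_fin: "AE y in N. n y \<noteq> \<infinity>"
    using le unfolding n_def[symmetric] by (intro nn_integral_PInf_AE) (auto simp: top_unique)
  have bound: "(\<integral>\<^sup>+x. epowr (\<integral>\<^sup>+y. ennreal (G x y) \<partial>N) p \<partial>M) \<le> ennreal ((S + \<epsilon>) powr p)" if \<epsilon>: "\<epsilon> > 0" for \<epsilon>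
  proof -
    define \<delta> where "\<delta> = \<epsilon> / (E + 1)"
    have \<delta>: "\<delta> > 0" "\<delta> * E \<le> \<epsilon>"
      using \<epsilon> E by (auto simp: \<delta>_def field_simps)
    define K where "K y = enn2real (n y) + \<delta> * e y" for y
    show ?thesis
    proof (rule Minkowski_integral_dominated[OF M N G G0, where K=K])
      show "K \<in> borel_measurable N" unfolding K_def by measurable
      show "0 < K y" for y using e(1)[of y] \<delta> by (auto simp: K_def intro!: add_nonneg_pos)
      have "(\<integral>\<^sup>+y. ennreal (K y) \<partial>N) \<le> (\<integral>\<^sup>+y. n y + ennreal \<delta> * ennreal (e y) \<partial>N)"
      proof (rule nn_integral_mono_AE, use n_fin in eventually_elim)
        fix y assume "n y \<noteq> \<infinity>"
        then have "ennreal (enn2real (n y)) = n y"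
          by (simp add: less_top)
        then show "ennreal (K y) \<le> n y + ennreal \<delta> * ennreal (e y)"
          using \<delta> e(1)[of y] by (simp add: K_def ennreal_mult less_imp_le)
      qed
      also have "\<dots> = (\<integral>\<^sup>+y. n y \<partial>N) + ennreal \<delta> * ennreal E"
        by (simp add: nn_integral_add nn_integral_cmult E)
      also have "\<dots> \<le> ennreal S + ennreal \<epsilon>"
        using le \<delta> E by (intro add_mono) (auto simp: n_def ennreal_mult[symmetric] ennreal_leI)
      finally show "(\<integral>\<^sup>+y. ennreal (K y) \<partial>N) \<le> ennreal (S + \<epsilon>)"
        using S \<epsilon> by simp
      show "AE y in N. (\<integral>\<^sup>+x. ennreal (G x y powr p) \<partial>M) \<le> ennreal (K y powr p)"
      proof (use n_fin in eventually_elim)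
        fix y assume fin: "n y \<noteq> \<infinity>"
        then obtain s where s: "(\<integral>\<^sup>+x. ennreal (G x y powr p) \<partial>M) = ennreal s" "s \<ge> 0"
          using p unfolding n_def epowr_def
          by (cases "\<integral>\<^sup>+x. ennreal (G x y powr p) \<partial>M") auto
        have "s = (s powr (1/p)) powr p"
          using s p by (simp add: powr_powr)
        also have "s powr (1/p) = enn2real (n y)"
          using p s unfolding n_def s by (subst epowr_ennreal_nonneg) auto
        also have "\<dots> powr p \<le> K y powr p"
          using p \<delta> e(1)[of y] by (intro powr_mono2) (auto simp: K_def)
        finally show "(\<integral>\<^sup>+x. ennreal (G x y powr p) \<partial>M) \<le> ennreal (K y powr p)"
          using s by (simp add: ennreal_leI)
      qed
    qed (use p S \<epsilon> in auto)
  qed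
  have "(\<lambda>n. S + inverse (real (Suc n))) \<longlonglongrightarrow> S + 0"
    by (intro tendsto_add tendsto_const LIMSEQ_inverse_real_of_nat)
  then have "(\<lambda>n. (S + inverse (real (Suc n))) powr p) \<longlonglongrightarrow> (S + 0) powr p"
    by (rule tendsto_powr') (use p S in \<open>auto intro!: always_eventually\<close>)
  then have lim: "(\<lambda>n. ennreal ((S + inverse (real (Suc n))) powr p)) \<longlonglongrightarrow> ennreal ((S + 0) powr p)"
    by (rule tendsto_ennrealI)
  have "(\<integral>\<^sup>+x. epowr (\<integral>\<^sup>+y. ennreal (G x y) \<partial>N) p \<partial>M) \<le> ennreal ((S + 0) powr p)"
    by (rule LIMSEQ_le_const[OF lim]) (auto intro!: bound exI[of _ 0])
  then show ?thesis
    by simp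
qed

section \<open>The homogeneous norm, its balls and its power weights\<close>

lemma hnorm_nonneg [simp]: "0 \<le> hnorm x"
  by (simp add: hnorm_def)

lemma hnorm_zero [simp]: "hnorm 0 = 0"
  by (simp add: hnorm_def)

lemma hnorm_minus [simp]: "hnorm (- x) = hnorm x"
  by (simp add: hnorm_def)

lemma hnorm_eq_zero_iff [simp]: "hnorm x = 0 \<longleftrightarrow> x = 0"
proof
  assume "hnorm x = 0"
  then have "(\<Sum>k\<in>UNIV. (x $ Inl k)\<^sup>2) = 0 \<and> x $ Inr () = 0"
    by (simp add: hnorm_def sum_power2_eq_zero_iff)
  then have *: "x $ Inl k = 0" "x $ Inr u = 0" for k u
    by (auto simp: sum_nonneg_eq_0_iff)
  show "x = 0"
  proof (subst vec_eq_iff, rule allI)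
    fix i show "x $ i = 0 $ i"
      using * by (cases i) auto
  qed
qed simp

lemma hnorm_pos_iff [simp]: "0 < hnorm x \<longleftrightarrow> x \<noteq> 0"
  using hnorm_nonneg[of x] hnorm_eq_zero_iff[of x] by linarith

lemma continuous_on_hnorm: "continuous_on UNIV hnorm"
  unfolding hnorm_def by (intro continuous_intros)

lemma borel_measurable_hnorm [measurable]: "hnorm \<in> borel_measurable borel"
  by (intro borel_measurable_continuous_onI continuous_on_hnorm)

lemma borel_measurable_hweight [measurable]: "hweight \<alpha> \<in> borel_measurable borel"
  unfolding hweight_def by measurable

lemma hweight_nonneg [simp]: "0 \<le> hweight \<alpha> x"
  by (simp add: hweight_def)

lemma hweight_pos_iff [simp]: "0 < hweight \<alpha> x \<longleftrightarrow> x \<noteq> 0"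
  by (simp add: hweight_def)

lemma hball_zero: "hball (0 :: 'n::finite heis) r = {x. hnorm x < r}"
proof -
  have "hmul (hinv y) 0 = - y" for y :: "'n heis"
    by (auto simp: hmul_def hinv_def vec_eq_iff split: sum.split)
  then show ?thesis
    by (simp add: hball_def hdist_def)
qed

lemma mem_hball_zero [simp]: "x \<in> hball 0 r \<longleftrightarrow> hnorm x < r"
  by (simp add: hball_zero)

lemma open_hball_zero: "open (hball 0 r)"
  unfolding hball_zero by (intro open_Collect_less continuous_on_hnorm continuous_on_const)

lemma sets_hball_zero [measurable]: "hball 0 r \<in> sets borel"
  by (intro borel_open open_hball_zero)

lemma compact_subset_hball:
  assumes "compact K"
  obtains r where "0 < r" "K \<subseteq> hball 0 r"
proof -
  have "bounded (hnorm ` K)"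
    using assms continuous_on_hnorm by (intro compact_imp_bounded compact_continuous_image) (auto intro: continuous_on_subset)
  then obtain B where "\<And>x. x \<in> K \<Longrightarrow> hnorm x \<le> B"
    unfolding bounded_iff by auto
  then have "K \<subseteq> hball 0 (max B 0 + 1)"
    by (force simp: max_def)
  then show ?thesis
    by (intro that[of "max B 0 + 1"]) auto
qed

lemma bounded_hball_zero: "bounded (hball 0 r :: 'n::finite heis set)"
proof (rule boundedI)
  fix x :: "'n heis" assume "x \<in> hball 0 r"
  then have x: "hnorm x < r" by simp
  then have r: "0 < r" using hnorm_nonneg[of x] by linarith
  let ?s = "\<Sum>k\<in>UNIV. (x $ Inl k)\<^sup>2"
  have "root 4 (?s\<^sup>2 + (x $ Inr ())\<^sup>2) < root 4 (r ^ 4)"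
    using x r by (simp add: hnorm_def real_root_power_cancel)
  then have *: "?s\<^sup>2 + (x $ Inr ())\<^sup>2 < (r\<^sup>2)\<^sup>2"
    by (simp add: power_mult[symmetric])
  have s0: "?s \<ge> 0" by (simp add: sum_nonneg)
  have "?s\<^sup>2 < (r\<^sup>2)\<^sup>2" using * by (smt (verit) zero_le_power2)
  then have s: "?s < r\<^sup>2" by (rule power_less_imp_less_base) simp
  have "\<bar>x $ Inr ()\<bar>\<^sup>2 < (r\<^sup>2)\<^sup>2" using * by (simp, smt (verit) zero_le_power2)
  then have t: "\<bar>x $ Inr ()\<bar> < r\<^sup>2" by (rule power_less_imp_less_base) simp
  have "\<bar>x $ Inl k\<bar> \<le> r" for k
  proof -
    have "(x $ Inl k)\<^sup>2 \<le> ?s" by (rule member_le_sum) auto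
    then have "\<bar>x $ Inl k\<bar>\<^sup>2 \<le> r\<^sup>2" using s by simp
    then show ?thesis by (rule power2_le_imp_le) (use r in simp)
  qed
  with t have "\<bar>x $ i\<bar> \<le> max r (r\<^sup>2)" for i
    by (cases i) (auto intro: le_max_iff_disj[THEN iffD2] less_imp_le)
  then have "(\<Sum>i\<in>UNIV. \<bar>x $ i\<bar>) \<le> (\<Sum>i\<in>(UNIV::(('n + 'n) + unit) set). max r (r\<^sup>2))"
    by (intro sum_mono)
  then show "norm x \<le> (\<Sum>i\<in>(UNIV::(('n + 'n) + unit) set). max r (r\<^sup>2))"
    using norm_le_l1_cart[of x] by linarith
qed

text \<open>
  The automorphic dilations of the Heisenberg group, under which the norm is homogeneous of degree one.
\<close>

definition hdilation :: "real \<Rightarrow> 'n::finite heis_mat" where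
  "hdilation r = (\<chi> i j. if i = j then (case i of Inl _ \<Rightarrow> r | Inr _ \<Rightarrow> r\<^sup>2) else 0)"

lemma hdilation_mult: "hdilation r *v x = (\<chi> i. (case i of Inl _ \<Rightarrow> r | Inr _ \<Rightarrow> r\<^sup>2) * x $ i)"
proof (subst vec_eq_iff, rule allI)
  fix i
  have "(hdilation r *v x) $ i = (\<Sum>j\<in>UNIV. if j = i then (case i of Inl _ \<Rightarrow> r | Inr _ \<Rightarrow> r\<^sup>2) * x $ i else 0)"
    unfolding matrix_vector_mult_def hdilation_def vec_lambda_beta by (rule sum.cong) auto
  then show "(hdilation r *v x) $ i = (\<chi> i. (case i of Inl _ \<Rightarrow> r | Inr _ \<Rightarrow> r\<^sup>2) * x $ i) $ i"
    by simp
qed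

lemma hnorm_hdilation:
  assumes "0 \<le> r"
  shows "hnorm (hdilation r *v x) = r * hnorm x"
proof -
  have "(\<Sum>k\<in>UNIV. (r * x $ Inl k)\<^sup>2)\<^sup>2 + (r\<^sup>2 * x $ Inr ())\<^sup>2 = r ^ 4 * ((\<Sum>k\<in>UNIV. (x $ Inl k)\<^sup>2)\<^sup>2 + (x $ Inr ())\<^sup>2)"
    by (simp add: power_mult_distrib distrib_left flip: sum_distrib_left)
  then show ?thesis
    using assms by (simp add: hnorm_def hdilation_mult real_root_mult real_root_power_cancel)
qed

lemma det_hdilation: "det (hdilation r :: 'n::finite heis_mat) = r ^ hdim TYPE('n)"
proof -
  have "det (hdilation r :: 'n heis_mat) = (\<Prod>i\<in>UNIV. (case i of Inl (_::'n + 'n) \<Rightarrow> r | Inr (_::unit) \<Rightarrow> r\<^sup>2))"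
    by (subst det_diagonal) (simp_all add: hdilation_def)
  also have "\<dots> = r ^ CARD('n + 'n) * r\<^sup>2"
    by (simp add: UNIV_sum prod.union_disjoint prod.reindex image_iff disjoint_iff UNIV_unit)
  also have "\<dots> = r ^ hdim TYPE('n)"
    by (simp add: hdim_def mult_2 flip: power_add)
  finally show ?thesis .
qed

lemma hdim_pos [simp]: "0 < hdim TYPE('n::finite)"
  by (simp add: hdim_def)

lemma wmeas_lborel: "wmeas w E = (\<integral>\<^sup>+x. ennreal (w x) * indicator E x \<partial>lborel)"
  by (simp add: wmeas_def nn_integral_completion)

text \<open>
  Substitute the dilation by \<open>r\<close>: its determinant contributes \<open>r\<^sup>Q\<close> and the weight
  \<open>r\<close> to the power \<open>\<alpha>\<close>.
\<close>

lemma wmeas_hball_scale: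
  fixes r :: real
  assumes r: "0 < r"
  shows "wmeas (hweight \<alpha>) (hball (0 :: 'n::finite heis) r)
    = ennreal (r powr (real (hdim TYPE('n)) + \<alpha>)) * wmeas (hweight \<alpha>) (hball (0 :: 'n heis) 1)"
proof -
  let ?D = "hdilation r :: 'n heis_mat"
  let ?g = "\<lambda>x::'n heis. ennreal (hweight \<alpha> x) * indicator (hball 0 r) x"
  have det: "det ?D = r powr real (hdim TYPE('n))"
    using r by (simp add: det_hdilation powr_realpow)
  have "ennreal \<bar>det ?D\<bar> * (\<integral>\<^sup>+x. ?g (?D *v x) \<partial>lborel) = (\<integral>\<^sup>+x. ?g x \<partial>lborel)"
    using r by (intro nn_integral_linear_substitution) (auto simp: det)
  moreover have "?g (?D *v x) = ennreal (r powr \<alpha>) * (ennreal (hweight \<alpha> x) * indicator (hball 0 1) x)" for x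
    using r by (auto simp: hnorm_hdilation hweight_def powr_mult ennreal_mult indicator_def mult_less_cancel_left_pos
        mult_less_cancel_left2)
  ultimately have "(\<integral>\<^sup>+x. ?g x \<partial>lborel)
    = ennreal (r powr real (hdim TYPE('n))) * (ennreal (r powr \<alpha>) * wmeas (hweight \<alpha>) (hball (0 :: 'n heis) 1))"
    by (simp add: det wmeas_lborel nn_integral_cmult)
  then show ?thesis
    by (simp add: wmeas_lborel powr_add ennreal_mult mult.assoc)
qed

text \<open>
  Lebesgue measure is the case of exponent zero: that weight is one off the origin.
\<close>

lemma emeasure_hball_zero: "emeasure lborel (hball (0 :: 'n::finite heis) r) = wmeas (hweight 0) (hball (0 :: 'n heis) r)"
proof -
  have "wmeas (hweight 0) (hball (0 :: 'n heis) r) = (\<integral>\<^sup>+x. indicator (hball (0 :: 'n heis) r) x \<partial>lborel)"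
    unfolding wmeas_lborel
  proof (rule nn_integral_cong_AE, use AE_lborel_singleton[of 0] in eventually_elim)
  qed (simp add: hweight_def)
  then show ?thesis by simp
qed

lemma emeasure_hball_finite: "emeasure lborel (hball (0 :: 'n::finite heis) r) < \<infinity>"
  using emeasure_bounded_finite[OF bounded_hball_zero] by simp

lemma wmeas_hball_pos: "0 < r \<Longrightarrow> 0 < wmeas (hweight \<alpha>) (hball (0 :: 'n::finite heis) r)"
proof (rule ccontr)
  assume r: "0 < r" and "\<not> 0 < wmeas (hweight \<alpha>) (hball (0 :: 'n heis) r)"
  then have "AE x in lborel. ennreal (hweight \<alpha> x) * indicator (hball (0 :: 'n heis) r) x = 0"
    unfolding wmeas_lborel by (subst (asm) not_gr_zero, subst (asm) nn_integral_0_iff_AE) auto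
  with AE_lborel_singleton[of 0] have "AE x in lborel. x \<notin> hball (0 :: 'n heis) r"
    by eventually_elim (auto simp: indicator_def hweight_def split: if_splits)
  then have "emeasure lborel (hball (0 :: 'n heis) r) = 0"
    by (subst (asm) AE_iff_measurable[OF _ refl]) (auto simp: hball_zero)
  moreover have "0 \<in> hball (0 :: 'n heis) r"
    using r by simp
  then have "\<not> negligible (hball (0 :: 'n heis) r)"
    by (metis empty_iff open_hball_zero open_not_negligible)
  ultimately show False
    by (auto simp: negligible_iff_null_sets null_sets_def)
qed

lemma ennreal_le_suminf: "f k \<le> suminf f" for f :: "nat \<Rightarrow> ennreal"
  using sum_le_suminf[of f "{k}"] by simp

text \<open>
  For a negative exponent the weight on the dyadic shell of radius \<open>2\<close> to the power \<open>-k\<close> is at most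
  \<open>2\<close> to the power \<open>-\<alpha> (k + 1)\<close>, while the ball that contains the shell has volume proportional to \<open>2\<close> to the
  power \<open>-k Q\<close>; the resulting series is geometric with ratio less than one exactly when \<open>\<alpha> > -Q\<close>.
\<close>

lemma wmeas_hball_one_finite:
  assumes \<alpha>: "- real (hdim TYPE('n::finite)) < \<alpha>"
  shows "wmeas (hweight \<alpha>) (hball (0 :: 'n heis) 1) < \<infinity>"
proof (cases "\<alpha> \<ge> 0")
  case True
  have "wmeas (hweight \<alpha>) (hball (0 :: 'n heis) 1) \<le> (\<integral>\<^sup>+x. indicator (hball (0 :: 'n heis) 1) x \<partial>lborel)"
    unfolding wmeas_lborel
    using True by (intro nn_integral_mono) (auto simp: indicator_def hweight_def intro!: powr_le1)
  then show ?thesis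
    using emeasure_hball_finite[of 1] by (auto intro: le_less_trans)
next
  case False
  define Q where "Q = real (hdim TYPE('n))"
  define v where "v = enn2real (emeasure lborel (hball (0 :: 'n heis) 1))"
  have v: "emeasure lborel (hball (0 :: 'n heis) 1) = ennreal v" "v \<ge> 0"
    using emeasure_hball_finite[where 'n='n and r=1] by (simp_all add: v_def)
  let ?q = "2 powr (- (Q + \<alpha>))"
  have q: "0 < ?q" "?q < 1"
    using \<alpha> by (auto simp: Q_def powr_less_one)
  let ?t = "\<lambda>k::nat. \<lambda>x::'n heis. ennreal (2 powr (- \<alpha> * real (k + 1))) * indicator (hball 0 (2 powr (- real k))) x"
  have pt: "ennreal (hweight \<alpha> x) * indicator (hball 0 1) x \<le> (\<Sum>k. ?t k x)" for x :: "'n heis"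
  proof (cases "hnorm x < 1 \<and> x \<noteq> 0")
    case True
    then have pos: "hnorm x > 0" by simp
    define k where "k = nat \<lfloor>- log 2 (hnorm x)\<rfloor>"
    define L where "L = - log 2 (hnorm x)"
    have L: "L > 0" using True pos by (simp add: L_def)
    have hx: "hnorm x = 2 powr (- L)" using pos by (simp add: L_def)
    have k: "real k \<le> L" "L < real k + 1"
      using L unfolding k_def L_def[symmetric] by linarith+
    \<comment> \<open>The balls are open, so a point on the sphere of radius \<open>2\<close> to the power \<open>-k\<close> has to be counted in the next larger ball.\<close>
    show ?thesis
    proof (cases "L = real k")
      case False
      with k have "hnorm x < 2 powr (- real k)"
        by (simp add: hx)
      moreover have "hweight \<alpha> x \<le> 2 powr (- \<alpha> * real (k + 1))"
        using k \<open>\<not> \<alpha> \<ge> 0\<close> by (simp add: hweight_def hx powr_powr)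
      ultimately have "ennreal (hweight \<alpha> x) * indicator (hball 0 1) x \<le> ?t k x"
        using True by (simp add: ennreal_leI)
      also have "?t k x \<le> (\<Sum>k. ?t k x)"
        by (rule ennreal_le_suminf)
      finally show ?thesis .
    next
      case eq: True
      with L obtain j where j: "k = Suc j" by (cases k) auto
      have "hnorm x < 2 powr (- real j)"
        using eq j by (simp add: hx)
      moreover have "hweight \<alpha> x \<le> 2 powr (- \<alpha> * real (j + 1))"
        using eq j by (simp add: hweight_def hx powr_powr algebra_simps)
      ultimately have "ennreal (hweight \<alpha> x) * indicator (hball 0 1) x \<le> ?t j x"
        using True by (simp add: ennreal_leI)
      also have "?t j x \<le> (\<Sum>k. ?t k x)"
        by (rule ennreal_le_suminf)
      finally show ?thesis .
    qed
  qed (auto simp: hweight_def)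
  have scale: "emeasure lborel (hball (0 :: 'n heis) (2 powr (- real k))) = ennreal (2 powr (- real k * Q) * v)" for k
    using wmeas_hball_scale[of "2 powr (- real k)" 0, where 'n='n]
    by (simp add: v(2) Q_def powr_powr ennreal_mult flip: emeasure_hball_zero v(1))
  have "wmeas (hweight \<alpha>) (hball (0 :: 'n heis) 1) \<le> (\<integral>\<^sup>+x. (\<Sum>k. ?t k x) \<partial>lborel)"
    unfolding wmeas_lborel by (intro nn_integral_mono pt)
  also have "\<dots> = (\<Sum>k. (\<integral>\<^sup>+x. ?t k x \<partial>lborel))"
    by (rule nn_integral_suminf) measurable
  also have "\<dots> = (\<Sum>k. ennreal (2 powr (- \<alpha>) * v * ?q ^ k))"
  proof (rule arg_cong[where f=suminf], rule ext)
    fix k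
    have "(\<integral>\<^sup>+x. ?t k x \<partial>lborel) = ennreal (2 powr (- \<alpha> * real (k + 1)) * (2 powr (- real k * Q) * v))"
      by (simp add: nn_integral_cmult scale v(2) flip: ennreal_mult)
    also have "2 powr (- \<alpha> * real (k + 1)) * (2 powr (- real k * Q) * v) = 2 powr (- \<alpha>) * v * (2 powr (- (Q + \<alpha>) * real k))"
    proof -
      have "2 powr (- \<alpha> * real (k + 1)) = 2 powr (- \<alpha>) * 2 powr (- \<alpha> * real k)"
        by (subst powr_add[symmetric]) (simp add: algebra_simps)
      moreover have "2 powr (- (Q + \<alpha>) * real k) = 2 powr (- real k * Q) * 2 powr (- \<alpha> * real k)"
        by (subst powr_add[symmetric]) (simp add: algebra_simps)
      ultimately show ?thesis by simp
    qed
    also have "2 powr (- (Q + \<alpha>) * real k) = ?q ^ k"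
      by (simp add: powr_realpow[symmetric] powr_powr)
    finally show "(\<integral>\<^sup>+x. ?t k x \<partial>lborel) = ennreal (2 powr (- \<alpha>) * v * ?q ^ k)" .
  qed
  also have "\<dots> = ennreal (\<Sum>k. 2 powr (- \<alpha>) * v * ?q ^ k)"
    using q v by (intro suminf_ennreal2) (auto intro: summable_mult summable_geometric)
  finally show ?thesis
    by (auto intro: le_less_trans)
qed

section \<open>Weighted measures on balls and linear maps\<close>

definition ball_measure :: "real \<Rightarrow> real \<Rightarrow> 'n::finite heis measure" where
  "ball_measure \<alpha> r = density lborel (\<lambda>x. ennreal (hweight \<alpha> x) * indicator (hball 0 r) x)"

lemma sets_ball_measure [simp, measurable_cong]: "sets (ball_measure \<alpha> r) = sets borel"
  by (simp add: ball_measure_def)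

lemma space_ball_measure [simp]: "space (ball_measure \<alpha> r) = UNIV"
  by (simp add: ball_measure_def)

lemma measurable_ball_measure [simp]: "measurable (ball_measure \<alpha> r) N = measurable borel N"
  by (rule measurable_cong_sets) auto

lemma nn_integral_ball_measure:
  "g \<in> borel_measurable borel \<Longrightarrow>
    (\<integral>\<^sup>+x. g x \<partial>ball_measure \<alpha> r) = (\<integral>\<^sup>+x. ennreal (hweight \<alpha> x) * indicator (hball 0 r) x * g x \<partial>lborel)"
  unfolding ball_measure_def by (subst nn_integral_density) auto

text \<open>
  The weighted measure of a ball about the origin, made a real number; by homogeneity it is determined
  by the unit ball.
\<close>

definition ball_weight :: "'n::finite itself \<Rightarrow> real \<Rightarrow> real \<Rightarrow> real" where
  "ball_weight _ \<alpha> r = r powr (real (hdim TYPE('n)) + \<alpha>) * enn2real (wmeas (hweight \<alpha>) (hball (0 :: 'n heis) 1))"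

lemma wmeas_hball:
  assumes "- real (hdim TYPE('n::finite)) < \<alpha>" "0 < r"
  shows "wmeas (hweight \<alpha>) (hball (0 :: 'n heis) r) = ennreal (ball_weight TYPE('n) \<alpha> r)"
  using wmeas_hball_one_finite[OF assms(1)] assms(2)
  by (simp add: ball_weight_def ennreal_mult wmeas_hball_scale[of r])

lemma ball_weight_pos:
  assumes "- real (hdim TYPE('n::finite)) < \<alpha>" "0 < r"
  shows "0 < ball_weight TYPE('n) \<alpha> r"
  using wmeas_hball_pos[OF assms(2), where 'n='n and \<alpha>=\<alpha>] wmeas_hball[OF assms] by simp

lemma ball_weight_scale:
  assumes "0 \<le> m" "0 \<le> r"
  shows "ball_weight TYPE('n::finite) \<alpha> (m * r) = m powr (real (hdim TYPE('n)) + \<alpha>) * ball_weight TYPE('n) \<alpha> r"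
  using assms by (simp add: ball_weight_def powr_mult)

lemma emeasure_ball_measure: "emeasure (ball_measure \<alpha> r :: 'n::finite heis measure) UNIV = wmeas (hweight \<alpha>) (hball (0 :: 'n heis) r)"
proof -
  have "(\<integral>\<^sup>+x. 1 \<partial>(ball_measure \<alpha> r :: 'n heis measure)) = wmeas (hweight \<alpha>) (hball (0 :: 'n heis) r)"
    by (subst nn_integral_ball_measure) (simp_all add: wmeas_lborel)
  then show ?thesis
    by simp
qed

lemma sigma_finite_ball_measure:
  assumes "- real (hdim TYPE('n::finite)) < \<alpha>" "0 < r"
  shows "sigma_finite_measure (ball_measure \<alpha> r :: 'n heis measure)"
proof -
  have "finite_measure (ball_measure \<alpha> r :: 'n heis measure)"
    by (rule finite_measureI) (simp add: emeasure_ball_measure wmeas_hball[OF assms])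
  then show ?thesis
    by (simp add: finite_measure_def)
qed

lemma AE_ball_measure:
  "(AE x in ball_measure \<alpha> r. P x) \<longleftrightarrow> (AE x in lborel. hnorm x < r \<longrightarrow> P (x :: 'n::finite heis))"
proof -
  have "(AE x in ball_measure \<alpha> r. P x) \<longleftrightarrow> (AE x in lborel. 0 < ennreal (hweight \<alpha> x) * indicator (hball 0 r) x \<longrightarrow> P x)"
    unfolding ball_measure_def by (rule AE_density) measurable
  also have "\<dots> \<longleftrightarrow> (AE x in lborel. hnorm x < r \<longrightarrow> P x)"
  proof
    assume "AE x in lborel. 0 < ennreal (hweight \<alpha> x) * indicator (hball 0 r) x \<longrightarrow> P x"
    with AE_lborel_singleton[of 0] show "AE x in lborel. hnorm x < r \<longrightarrow> P x"
      by eventually_elim (auto simp: ennreal_zero_less_mult_iff)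
  next
    assume "AE x in lborel. hnorm x < r \<longrightarrow> P x"
    then show "AE x in lborel. 0 < ennreal (hweight \<alpha> x) * indicator (hball 0 r) x \<longrightarrow> P x"
      by eventually_elim (auto simp: indicator_def)
  qed
  finally show ?thesis .
qed

text \<open>
  A matrix enters the estimates only through three numbers: its determinant, a factor \<open>m\<close> with
  \<open>M B(0, r) \<subseteq> B(0, m r)\<close>, and a factor \<open>\<kappa>\<close> by which the weight at \<open>x\<close> may exceed the weight at
  \<open>M x\<close>. The substitution \<open>M x\<close> then costs \<open>\<kappa> / |det M|\<close>.
\<close>

lemma nn_integral_ball_measure_linear_le:
  fixes M :: "'n::finite heis_mat" and g :: "'n heis \<Rightarrow> ennreal"
  assumes [measurable]: "g \<in> borel_measurable borel" and det: "det M \<noteq> 0" and m: "0 < m" and \<kappa>: "0 < \<kappa>"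
    and hM: "\<And>x. hnorm (M *v x) \<le> m * hnorm x" and wM: "\<And>x. hweight \<alpha> x \<le> \<kappa> * hweight \<alpha> (M *v x)"
  shows "(\<integral>\<^sup>+x. g (M *v x) \<partial>ball_measure \<alpha> r) \<le> ennreal (\<kappa> / \<bar>det M\<bar>) * (\<integral>\<^sup>+x. g x \<partial>ball_measure \<alpha> (m * r))"
proof -
  let ?h = "\<lambda>x. ennreal (hweight \<alpha> x) * indicator (hball 0 (m * r)) x * g x"
  have "(\<integral>\<^sup>+x. g (M *v x) \<partial>ball_measure \<alpha> r) = (\<integral>\<^sup>+x. ennreal (hweight \<alpha> x) * indicator (hball 0 r) x * g (M *v x) \<partial>lborel)"
    by (rule nn_integral_ball_measure) measurable
  also have "\<dots> \<le> (\<integral>\<^sup>+x. ennreal \<kappa> * ?h (M *v x) \<partial>lborel)"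
  proof (rule nn_integral_mono)
    fix x
    have "hnorm (M *v x) < m * r" if "hnorm x < r"
    proof -
      have "m * hnorm x < m * r" using m that by simp
      with hM[of x] show ?thesis by simp
    qed
    moreover have "ennreal (hweight \<alpha> x) \<le> ennreal \<kappa> * ennreal (hweight \<alpha> (M *v x))"
      using \<kappa> wM[of x] by (simp add: ennreal_leI flip: ennreal_mult)
    ultimately have "ennreal (hweight \<alpha> x) * indicator (hball 0 r) x
      \<le> (ennreal \<kappa> * ennreal (hweight \<alpha> (M *v x))) * indicator (hball 0 (m * r)) (M *v x)"
      by (intro mult_mono) (auto simp: indicator_def)
    then have "ennreal (hweight \<alpha> x) * indicator (hball 0 r) x * g (M *v x)
      \<le> (ennreal \<kappa> * ennreal (hweight \<alpha> (M *v x))) * indicator (hball 0 (m * r)) (M *v x) * g (M *v x)"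
      by (intro mult_right_mono) auto
    then show "ennreal (hweight \<alpha> x) * indicator (hball 0 r) x * g (M *v x) \<le> ennreal \<kappa> * ?h (M *v x)"
      by (simp add: mult.assoc)
  qed
  also have "\<dots> = ennreal \<kappa> * (\<integral>\<^sup>+x. ?h (M *v x) \<partial>lborel)"
    by (rule nn_integral_cmult) measurable
  also have "(\<integral>\<^sup>+x. ?h (M *v x) \<partial>lborel) = ennreal (1 / \<bar>det M\<bar>) * (\<integral>\<^sup>+x. ?h x \<partial>lborel)"
  proof -
    have "(\<integral>\<^sup>+x. ?h x \<partial>lborel) = ennreal \<bar>det M\<bar> * (\<integral>\<^sup>+x. ?h (M *v x) \<partial>lborel)"
      using det by (intro nn_integral_linear_substitution[symmetric]) auto
    moreover have "ennreal (1 / \<bar>det M\<bar>) * ennreal \<bar>det M\<bar> = 1"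
      using det by (subst ennreal_mult[symmetric]) auto
    ultimately show ?thesis
      by (simp add: mult.assoc[symmetric])
  qed
  also have "(\<integral>\<^sup>+x. ?h x \<partial>lborel) = (\<integral>\<^sup>+x. g x \<partial>ball_measure \<alpha> (m * r))"
    by (rule nn_integral_ball_measure[symmetric]) measurable
  also have "ennreal \<kappa> * (ennreal (1 / \<bar>det M\<bar>) * (\<integral>\<^sup>+x. g x \<partial>ball_measure \<alpha> (m * r)))
     = ennreal (\<kappa> / \<bar>det M\<bar>) * (\<integral>\<^sup>+x. g x \<partial>ball_measure \<alpha> (m * r))"
    using \<kappa> by (simp add: mult.assoc[symmetric] ennreal_mult[symmetric])
  finally show ?thesis .
qed

lemma Lp_bound_linear:
  fixes M :: "'n::finite heis_mat"
  assumes g: "Lp_bound (ball_measure \<alpha> (m * r)) q g a" and det: "det M \<noteq> 0" and m: "0 < m" and \<kappa>: "0 < \<kappa>" and q: "0 < q"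
    and hM: "\<And>x. hnorm (M *v x) \<le> m * hnorm x" and wM: "\<And>x. hweight \<alpha> x \<le> \<kappa> * hweight \<alpha> (M *v x)"
  shows "Lp_bound (ball_measure \<alpha> r) q (\<lambda>x. g (M *v x)) ((\<kappa> / \<bar>det M\<bar>) powr (1 / q) * a)"
proof -
  have [measurable]: "g \<in> borel_measurable borel" and a: "a > 0"
    using g by (auto simp: Lp_bound_def)
  have D: "\<kappa> / \<bar>det M\<bar> > 0" using \<kappa> det by simp
  have "(\<integral>\<^sup>+x. ennreal (\<bar>g (M *v x)\<bar> powr q) \<partial>ball_measure \<alpha> r)
    \<le> ennreal (\<kappa> / \<bar>det M\<bar>) * (\<integral>\<^sup>+x. ennreal (\<bar>g x\<bar> powr q) \<partial>ball_measure \<alpha> (m * r))"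
    by (rule nn_integral_ball_measure_linear_le[OF _ det m \<kappa> hM wM, where g="\<lambda>x. ennreal (\<bar>g x\<bar> powr q)"]) measurable
  also have "\<dots> \<le> ennreal (\<kappa> / \<bar>det M\<bar>) * ennreal (a powr q)"
    using g by (intro mult_left_mono) (auto simp: Lp_bound_def)
  also have "\<dots> = ennreal (((\<kappa> / \<bar>det M\<bar>) powr (1 / q) * a) powr q)"
  proof -
    have "((\<kappa> / \<bar>det M\<bar>) powr (1 / q) * a) powr q = (\<kappa> / \<bar>det M\<bar>) * a powr q"
      using \<kappa> D a q by (subst powr_mult) (simp_all add: powr_powr)
    then show ?thesis
      by (simp only: ennreal_mult[OF less_imp_le[OF D] powr_ge_zero])
  qed
  finally show ?thesis
    using a det \<kappa> by (auto simp: Lp_bound_def)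
qed

text \<open>
  \<open>M\<close> maps the unit ball into a ball of \<open>m\<^sup>Q\<close> times its volume.
\<close>

lemma abs_det_le:
  fixes M :: "'n::finite heis_mat"
  assumes det: "det M \<noteq> 0" and m: "0 < m" and hM: "\<And>x. hnorm (M *v x) \<le> m * hnorm x"
  shows "\<bar>det M\<bar> \<le> m powr real (hdim TYPE('n))"
proof -
  define v where "v = ball_weight TYPE('n) 0 1"
  have v: "v > 0" unfolding v_def by (rule ball_weight_pos) (simp_all add: hdim_def)
  have Mx: "M *v x = 0 \<longleftrightarrow> x = 0" for x
    using det invertible_det_nz[of M] by (metis invertible_eq_bij matrix_vector_mul_assoc invertible_def matrix_vector_mul_lid matrix_vector_mult_0_right)
  have "(\<integral>\<^sup>+x. 1 \<partial>(ball_measure 0 1 :: 'n heis measure)) \<le> ennreal (1 / \<bar>det M\<bar>) * (\<integral>\<^sup>+x. 1 \<partial>(ball_measure 0 (m * 1) :: 'n heis measure))"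
    by (rule nn_integral_ball_measure_linear_le[OF _ det m _ hM, where g="\<lambda>_. 1"]) (auto simp: hweight_def Mx)
  then have "ennreal v \<le> ennreal (1 / \<bar>det M\<bar>) * ennreal (ball_weight TYPE('n) 0 (m * 1))"
    using m hdim_pos[where 'n='n] by (simp add: emeasure_ball_measure wmeas_hball v_def)
  also have "\<dots> = ennreal (1 / \<bar>det M\<bar> * (m powr real (hdim TYPE('n)) * v))"
    using m by (subst ball_weight_scale) (simp_all add: v_def ennreal_mult[symmetric] ball_weight_def)
  finally have "v \<le> 1 / \<bar>det M\<bar> * (m powr real (hdim TYPE('n)) * v)"
    using v by (subst (asm) ennreal_le_iff) auto
  then have "\<bar>det M\<bar> * v \<le> m powr real (hdim TYPE('n)) * v"
    using det by (simp add: le_divide_eq mult.commute)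
  then show ?thesis using v by simp
qed

section \<open>Central Morrey and central BMO bounds on balls\<close>

lemma epowr_root_le_iff:
  assumes p: "0 < p" and F: "0 \<le> F"
  shows "epowr X (1 / p) \<le> ennreal F \<longleftrightarrow> X \<le> ennreal (F powr p)"
proof (cases X)
  case (real x)
  have "x powr (1 / p) \<le> F \<longleftrightarrow> x \<le> F powr p"
  proof
    assume "x powr (1 / p) \<le> F"
    then have "(x powr (1 / p)) powr p \<le> F powr p"
      using p by (intro powr_mono2) auto
    then show "x \<le> F powr p" using p real by (simp add: powr_powr)
  next
    assume "x \<le> F powr p"
    then have "x powr (1 / p) \<le> (F powr p) powr (1 / p)"
      using p real by (intro powr_mono2) auto
    then show "x powr (1 / p) \<le> F" using p F by (simp add: powr_powr)
  qed
  then show ?thesis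
    using p F real by (simp add: epowr_ennreal_nonneg)
qed (use p in \<open>simp add: epowr_def top_unique\<close>)

lemma ennreal_divide_le_iff:
  assumes "0 < w" "0 \<le> c"
  shows "X / ennreal w \<le> ennreal c \<longleftrightarrow> X \<le> ennreal (c * w)"
proof (cases X)
  case (real x)
  then show ?thesis
    using assms by (simp add: divide_ennreal divide_le_eq)
qed (use assms in \<open>simp add: ennreal_top_divide top_unique\<close>)

lemma set_nn_integral_ball_measure:
  assumes [measurable]: "g \<in> borel_measurable borel"
  shows "(\<integral>\<^sup>+x\<in>hball 0 r. ennreal (cmod (g x) powr p * hweight \<alpha> x) \<partial>lebesgue) = (\<integral>\<^sup>+x. ennreal (\<bar>cmod (g x)\<bar> powr p) \<partial>ball_measure \<alpha> r)"
  by (subst nn_integral_ball_measure)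
     (auto simp: nn_integral_completion ennreal_mult mult_ac intro!: nn_integral_cong)

lemma morrey_norm_le_iff:
  fixes f :: "'n::finite heis \<Rightarrow> complex"
  assumes f: "f \<in> borel_measurable borel" and p: "0 < p" and F: "0 < F" and \<alpha>: "- real (hdim TYPE('n)) < \<alpha>"
  shows "morrey_norm p lam (hweight \<alpha>) f \<le> ennreal F \<longleftrightarrow>
    (\<forall>r>0. Lp_bound (ball_measure \<alpha> r) p (\<lambda>x. cmod (f x)) (ball_weight TYPE('n) \<alpha> r powr (1 / p + lam) * F))"
proof -
  have "epowr ((\<integral>\<^sup>+x\<in>hball 0 r. ennreal (cmod (f x) powr p * hweight \<alpha> x) \<partial>lebesgue)
             / epowr (wmeas (hweight \<alpha>) (hball (0 :: 'n heis) r)) (1 + p * lam)) (1 / p) \<le> ennreal F \<longleftrightarrow>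
    Lp_bound (ball_measure \<alpha> r) p (\<lambda>x. cmod (f x)) (ball_weight TYPE('n) \<alpha> r powr (1 / p + lam) * F)"
    (is "?L \<longleftrightarrow> ?R") if r: "r > 0" for r
  proof -
    define W where "W = ball_weight TYPE('n) \<alpha> r"
    have W: "W > 0" using \<alpha> r by (simp add: W_def ball_weight_pos)
    have "F powr p * W powr (1 + p * lam) = (W powr (1 / p + lam) * F) powr p"
    proof -
      have "(1 / p + lam) * p = 1 + p * lam"
        using p by (simp add: distrib_right)
      then show ?thesis
        using W F by (simp add: powr_mult powr_powr)
    qed
    then have "?L \<longleftrightarrow> (\<integral>\<^sup>+x. ennreal (\<bar>cmod (f x)\<bar> powr p) \<partial>ball_measure \<alpha> r) \<le> ennreal ((W powr (1 / p + lam) * F) powr p)"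
      using F p W unfolding set_nn_integral_ball_measure[OF f] wmeas_hball[OF \<alpha> r] W_def[symmetric]
      by (simp add: epowr_root_le_iff epowr_ennreal ennreal_divide_le_iff)
    then show ?thesis
      using f F W by (simp add: Lp_bound_def W_def)
  qed
  then show ?thesis
    unfolding morrey_norm_def SUP_le_iff by auto
qed

lemma cmo_norm_le_iff:
  fixes f :: "'n::finite heis \<Rightarrow> complex"
  assumes f[measurable]: "f \<in> borel_measurable borel" and p: "0 < p" and F: "0 < F" and \<alpha>: "- real (hdim TYPE('n)) < \<alpha>"
  shows "cmo_norm p (hweight \<alpha>) f \<le> ennreal F \<longleftrightarrow>
    (\<forall>r>0. Lp_bound (ball_measure \<alpha> r) p (\<lambda>x. cmod (f x - ball_mean f r)) (ball_weight TYPE('n) \<alpha> r powr (1 / p) * F))"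
proof -
  have "epowr ((\<integral>\<^sup>+x\<in>hball 0 r. ennreal (cmod (f x - ball_mean f r) powr p * hweight \<alpha> x) \<partial>lebesgue)
             / wmeas (hweight \<alpha>) (hball (0 :: 'n heis) r)) (1 / p) \<le> ennreal F \<longleftrightarrow>
    Lp_bound (ball_measure \<alpha> r) p (\<lambda>x. cmod (f x - ball_mean f r)) (ball_weight TYPE('n) \<alpha> r powr (1 / p) * F)"
    (is "?L \<longleftrightarrow> ?R") if r: "r > 0" for r
  proof -
    define W where "W = ball_weight TYPE('n) \<alpha> r"
    have W: "W > 0" using \<alpha> r by (simp add: W_def ball_weight_pos)
    have fm: "(\<lambda>x. f x - ball_mean f r) \<in> borel_measurable borel" by measurable
    have "F powr p * W = (W powr (1 / p) * F) powr p"
      using W F p by (simp add: powr_mult powr_powr)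
    then have "?L \<longleftrightarrow> (\<integral>\<^sup>+x. ennreal (\<bar>cmod (f x - ball_mean f r)\<bar> powr p) \<partial>ball_measure \<alpha> r) \<le> ennreal ((W powr (1 / p) * F) powr p)"
      using F p W unfolding set_nn_integral_ball_measure[OF fm] wmeas_hball[OF \<alpha> r] W_def[symmetric]
      by (simp add: epowr_root_le_iff ennreal_divide_le_iff)
    then show ?thesis
      using F W by (simp add: Lp_bound_def W_def)
  qed
  then show ?thesis
    unfolding cmo_norm_def SUP_le_iff by auto
qed

section \<open>Means over concentric balls\<close>

text \<open>
  This inequality and the next one trade the weighted power \<open>t\<^sup>q h\<^sup>\<alpha>\<close> for \<open>t\<close> itself, at the cost of
  a second term free of \<open>t\<close>. With \<open>h\<close> the relative distance to the origin, they turn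
  weighted oscillations into unweighted ones. For \<open>\<alpha> \<le> 0\<close> the weight is at least one, so only
  values \<open>t \<le> 1\<close> have to be absorbed by the second term.
\<close>

lemma le_powr_mult_add_powr_nonpos:
  fixes t h \<alpha> q :: real
  assumes "0 \<le> t" "0 < h" "h < 1" "1 \<le> q" "\<alpha> \<le> 0"
  shows "t \<le> t powr q * h powr \<alpha> + h powr 0"
proof (cases "t \<le> 1")
  case True
  then show ?thesis using assms by (simp add: add_increasing)
next
  case False
  have "t powr 1 * 1 \<le> t powr q * h powr \<alpha>"
  proof (intro mult_mono)
    show "t powr 1 \<le> t powr q" using False assms by (intro powr_mono) auto
    show "1 \<le> h powr \<alpha>" using assms powr_mono2'[of \<alpha> h 1] by simp
  qed auto
  then show ?thesis using False assms by simp
qed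

text \<open>
  Whenever \<open>t\<close> exceeds the second term, raising this to the power \<open>q - 1\<close> shows that the first term is at
  least \<open>t\<close>. The second term is locally integrable on the Heisenberg group if \<open>\<alpha> / (q - 1) < Q\<close>, which
  is the same as \<open>q > (Q + \<alpha>) / Q\<close>.
\<close>

lemma le_powr_mult_add_powr_pos:
  fixes t h \<alpha> q :: real
  assumes "0 \<le> t" "0 < h" "1 < q"
  shows "t \<le> t powr q * h powr \<alpha> + h powr (- \<alpha> / (q - 1))"
proof (cases "t \<le> h powr (- \<alpha> / (q - 1))")
  case True
  then show ?thesis using assms by (simp add: add_increasing)
next
  case False
  then have t: "t > 0" using assms by (smt (verit) powr_ge_zero)
  have "h powr (- \<alpha>) = (h powr (- \<alpha> / (q - 1))) powr (q - 1)"
    using assms by (simp add: powr_powr)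
  also have "\<dots> \<le> t powr (q - 1)"
    using False assms by (intro powr_mono2) auto
  finally have "t * (h powr (- \<alpha>) * h powr \<alpha>) \<le> t * (t powr (q - 1) * h powr \<alpha>)"
    using t by (intro mult_left_mono mult_right_mono) auto
  moreover have "h powr (- \<alpha>) * h powr \<alpha> = 1"
    using assms by (simp add: powr_minus)
  moreover have "t * (t powr (q - 1) * h powr \<alpha>) = t powr q * h powr \<alpha>"
    using t by (simp add: powr_diff)
  ultimately have "t \<le> t powr q * h powr \<alpha>"
    by simp
  then show ?thesis
    by (simp add: add_increasing2)
qed

text \<open>
  The pointwise inequality is used with \<open>t = |g x| / B\<close> and \<open>h = |x| / S\<close>. Both resulting terms
  integrate to a multiple of \<open>S\<^sup>Q\<close>: the first by the bound on \<open>g\<close>, the second by homogeneity.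
\<close>

lemma nn_integral_oscillation_le:
  fixes g :: "'n::finite heis \<Rightarrow> real"
  defines "Q \<equiv> real (hdim TYPE('n))"
  assumes \<alpha>: "- Q < \<alpha>" and \<gamma>: "- Q < \<gamma>" and q: "1 \<le> q" and S: "0 < S" and B: "0 < B"
    and split: "\<And>t h. 0 \<le> t \<Longrightarrow> 0 < h \<Longrightarrow> h < 1 \<Longrightarrow> t \<le> t powr q * h powr \<alpha> + h powr \<gamma>"
    and g: "Lp_bound (ball_measure \<alpha> S) q g (ball_weight TYPE('n) \<alpha> S powr (1 / q) * B)"
  shows "(\<integral>\<^sup>+x. ennreal \<bar>g x\<bar> * indicator (hball 0 S) x \<partial>lborel)
    \<le> ennreal ((ball_weight TYPE('n) \<alpha> 1 + ball_weight TYPE('n) \<gamma> 1) * S powr Q * B)"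
proof -
  have [measurable]: "g \<in> borel_measurable borel"
    using g by (simp add: Lp_bound_def)
  define c where "c = B * B powr (-q) * S powr (-\<alpha>)"
  define d where "d = B * S powr (-\<gamma>)"
  have cd: "c > 0" "d > 0" using B S by (auto simp: c_def d_def)
  have Wa: "ball_weight TYPE('n) \<alpha> S = S powr (Q + \<alpha>) * ball_weight TYPE('n) \<alpha> 1"
    and Wg: "ball_weight TYPE('n) \<gamma> S = S powr (Q + \<gamma>) * ball_weight TYPE('n) \<gamma> 1"
    using S ball_weight_scale[of S 1] by (simp_all add: Q_def)
  have Wpos: "ball_weight TYPE('n) \<alpha> S > 0" "ball_weight TYPE('n) \<gamma> S > 0" "ball_weight TYPE('n) \<alpha> 1 > 0" "ball_weight TYPE('n) \<gamma> 1 > 0"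
    using \<alpha> \<gamma> S by (auto simp: Q_def intro!: ball_weight_pos)
  have "(\<integral>\<^sup>+x. ennreal \<bar>g x\<bar> * indicator (hball 0 S) x \<partial>lborel)
    \<le> (\<integral>\<^sup>+x. ennreal c * (ennreal (hweight \<alpha> x) * indicator (hball 0 S) x * ennreal (\<bar>g x\<bar> powr q))
         + ennreal d * (ennreal (hweight \<gamma> x) * indicator (hball 0 S) x) \<partial>lborel)"
  proof (rule nn_integral_mono_AE, use AE_lborel_singleton[of 0] in eventually_elim)
    fix x :: "'n heis" assume x: "x \<noteq> 0"
    show "ennreal \<bar>g x\<bar> * indicator (hball 0 S) x \<le>
      ennreal c * (ennreal (hweight \<alpha> x) * indicator (hball 0 S) x * ennreal (\<bar>g x\<bar> powr q))
         + ennreal d * (ennreal (hweight \<gamma> x) * indicator (hball 0 S) x)"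
    proof (cases "hnorm x < S")
      case True
      have "\<bar>g x\<bar> / B \<le> (\<bar>g x\<bar> / B) powr q * (hnorm x / S) powr \<alpha> + (hnorm x / S) powr \<gamma>"
        using x True S B by (intro split) auto
      then have "B * (\<bar>g x\<bar> / B) \<le> B * ((\<bar>g x\<bar> / B) powr q * (hnorm x / S) powr \<alpha> + (hnorm x / S) powr \<gamma>)"
        using B by (intro mult_left_mono) auto
      also have "\<dots> = c * (hweight \<alpha> x * \<bar>g x\<bar> powr q) + d * hweight \<gamma> x"
      proof -
        have "(\<bar>g x\<bar> / B) powr q = \<bar>g x\<bar> powr q * B powr (-q)"
          "(hnorm x / S) powr \<alpha> = hweight \<alpha> x * S powr (-\<alpha>)" "(hnorm x / S) powr \<gamma> = hweight \<gamma> x * S powr (-\<gamma>)"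
          using S B by (simp_all add: powr_divide powr_minus_divide hweight_def)
        then show ?thesis
          by (simp add: c_def d_def distrib_left mult_ac)
      qed
      finally have "\<bar>g x\<bar> \<le> c * (hweight \<alpha> x * \<bar>g x\<bar> powr q) + d * hweight \<gamma> x"
        using B by simp
      then have "ennreal \<bar>g x\<bar> \<le> ennreal (c * (hweight \<alpha> x * \<bar>g x\<bar> powr q) + d * hweight \<gamma> x)"
        by (rule ennreal_leI)
      also have "\<dots> = ennreal c * ennreal (hweight \<alpha> x * \<bar>g x\<bar> powr q) + ennreal d * ennreal (hweight \<gamma> x)"
        using cd by (intro ennreal_linear_combination[symmetric]) auto
      finally show ?thesis
        using True by (simp add: ennreal_mult)
    qed simp
  qed
  also have "\<dots> = ennreal c * (\<integral>\<^sup>+x. ennreal (\<bar>g x\<bar> powr q) \<partial>ball_measure \<alpha> S) + ennreal d * wmeas (hweight \<gamma>) (hball (0 :: 'n heis) S)"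
    by (subst nn_integral_add) (simp_all add: nn_integral_cmult nn_integral_ball_measure wmeas_lborel)
  also have "\<dots> \<le> ennreal c * ennreal ((ball_weight TYPE('n) \<alpha> S powr (1 / q) * B) powr q) + ennreal d * ennreal (ball_weight TYPE('n) \<gamma> S)"
    using g \<gamma> S by (intro add_mono mult_left_mono) (auto simp: Lp_bound_def wmeas_hball Q_def)
  also have "\<dots> = ennreal (c * (ball_weight TYPE('n) \<alpha> S powr (1 / q) * B) powr q + d * ball_weight TYPE('n) \<gamma> S)"
    using cd Wpos by (intro ennreal_linear_combination) auto
  also have "c * (ball_weight TYPE('n) \<alpha> S powr (1 / q) * B) powr q + d * ball_weight TYPE('n) \<gamma> S
     = (ball_weight TYPE('n) \<alpha> 1 + ball_weight TYPE('n) \<gamma> 1) * S powr Q * B"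
  proof -
    have 1: "(ball_weight TYPE('n) \<alpha> S powr (1 / q) * B) powr q = ball_weight TYPE('n) \<alpha> S * B powr q"
      using Wpos B q by (simp add: powr_mult powr_powr)
    have 2: "B powr (-q) * B powr q = 1" "S powr (-\<alpha>) * S powr (Q + \<alpha>) = S powr Q" "S powr (-\<gamma>) * S powr (Q + \<gamma>) = S powr Q"
      using B S by (simp_all add: powr_minus powr_add)
    have "c * (ball_weight TYPE('n) \<alpha> S * B powr q) = B * (B powr (-q) * B powr q) * (S powr (-\<alpha>) * S powr (Q + \<alpha>)) * ball_weight TYPE('n) \<alpha> 1"
      unfolding Wa c_def by (simp only: mult_ac)
    moreover have "d * ball_weight TYPE('n) \<gamma> S = B * (S powr (-\<gamma>) * S powr (Q + \<gamma>)) * ball_weight TYPE('n) \<gamma> 1"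
      unfolding Wg d_def by (simp only: mult_ac)
    ultimately show ?thesis
      unfolding 1 2 by (simp add: algebra_simps)
  qed
  finally show ?thesis .
qed

lemma ball_mean_lborel:
  fixes b :: "'n::finite heis \<Rightarrow> complex"
  assumes [measurable]: "b \<in> borel_measurable borel" and b: "locally_integrable b"
  shows "integrable lborel (\<lambda>x. indicator (hball 0 r) x *\<^sub>R b x)"
    and "ball_mean b r = (LINT x|lborel. indicator (hball 0 r) x *\<^sub>R b x) / complex_of_real (measure lborel (hball (0 :: 'n heis) r))"
proof -
  have "set_integrable lebesgue (closure (hball 0 r)) b"
    using b compact_closure[THEN iffD2, OF bounded_hball_zero] unfolding locally_integrable_def by blast
  then have "set_integrable lebesgue (hball 0 r) b"
    by (rule set_integrable_subset) (auto simp: closure_subset)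
  then show "integrable lborel (\<lambda>x. indicator (hball 0 r) x *\<^sub>R b x)"
    unfolding set_integrable_def by (subst (asm) integrable_completion) auto
  show "ball_mean b r = (LINT x|lborel. indicator (hball 0 r) x *\<^sub>R b x) / complex_of_real (measure lborel (hball (0 :: 'n heis) r))"
    unfolding ball_mean_def set_lebesgue_integral_def
    by (subst integral_completion) auto
qed

lemma cmod_ball_mean_minus_le:
  fixes b :: "'n::finite heis \<Rightarrow> complex"
  assumes b[measurable]: "b \<in> borel_measurable borel" and loc: "locally_integrable b" and r: "0 < r" and "0 \<le> K"
    and K: "(\<integral>\<^sup>+x. ennreal (cmod (b x - \<beta>)) * indicator (hball 0 r) x \<partial>lborel) \<le> ennreal K"
  shows "cmod (ball_mean b r - \<beta>) \<le> K / ball_weight TYPE('n) 0 r"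
proof -
  define v where "v = ball_weight TYPE('n) 0 r"
  let ?I = "\<lambda>x. indicator (hball (0 :: 'n heis) r) x :: real"
  have v: "v > 0" using r by (simp add: v_def ball_weight_pos hdim_pos)
  have em: "emeasure lborel (hball (0 :: 'n heis) r) = ennreal v"
    using r by (simp add: emeasure_hball_zero wmeas_hball hdim_pos v_def)
  then have meas: "measure lborel (hball (0 :: 'n heis) r) = v"
    using v by (simp add: measure_def)
  have int0: "integrable lborel ?I"
    using em by (intro integrable_real_indicator) auto
  then have int1: "integrable lborel (\<lambda>x. ?I x *\<^sub>R \<beta>)"
    by (intro integrable_scaleR_left)
  have I1: "(LINT x|lborel. ?I x *\<^sub>R \<beta>) = v *\<^sub>R \<beta>"
    using integral_scaleR_left[OF int0, of \<beta>] meas by simp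
  have int: "integrable lborel (\<lambda>x. ?I x *\<^sub>R b x)"
    by (rule ball_mean_lborel[OF b loc])
  have eq: "(LINT x|lborel. ?I x *\<^sub>R (b x - \<beta>)) = (LINT x|lborel. ?I x *\<^sub>R b x) - v *\<^sub>R \<beta>"
    using int int1 by (simp add: scaleR_diff_right I1)
  have "ennreal (cmod (LINT x|lborel. ?I x *\<^sub>R (b x - \<beta>))) \<le> (\<integral>\<^sup>+x. ennreal (cmod (?I x *\<^sub>R (b x - \<beta>))) \<partial>lborel)"
    using int int1 by (intro integral_norm_bound_ennreal) (simp add: scaleR_diff_right)
  also have "\<dots> = (\<integral>\<^sup>+x. ennreal (cmod (b x - \<beta>)) * indicator (hball 0 r) x \<partial>lborel)"
    by (intro nn_integral_cong) (auto simp: indicator_def)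
  also note K
  finally have "cmod (LINT x|lborel. ?I x *\<^sub>R (b x - \<beta>)) \<le> K"
    using \<open>0 \<le> K\<close> by simp
  moreover have "ball_mean b r - \<beta> = (LINT x|lborel. ?I x *\<^sub>R (b x - \<beta>)) / complex_of_real v"
    unfolding ball_mean_lborel(2)[OF b loc] meas eq using v by (simp add: diff_divide_distrib scaleR_conv_of_real)
  ultimately show ?thesis
    using v by (simp add: norm_divide divide_right_mono v_def)
qed

text \<open>
  The two radii are joined by a chain of about \<open>|log 2 (S / R)|\<close> doublings. This is the origin of
  the logarithm of the matrix norm in the final constants.
\<close>

lemma doubling_chain:
  fixes \<beta> :: "real \<Rightarrow> 'a::real_normed_vector"
  assumes step: "\<And>R S. 0 < R \<Longrightarrow> R \<le> S \<Longrightarrow> S \<le> 2 * R \<Longrightarrow> norm (\<beta> R - \<beta> S) \<le> L"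
    and "0 < R" "0 < S"
  shows "norm (\<beta> R - \<beta> S) \<le> L * (1 + \<bar>log 2 (S / R)\<bar>)"
proof -
  have "norm (\<beta> 1 - \<beta> 1) \<le> L" by (rule step) auto
  then have L: "L \<ge> 0" by simp
  have chain: "norm (\<beta> R - \<beta> S) \<le> real n * L" if "0 < R" "R \<le> S" "S \<le> 2 ^ n * R" for n R S
    using that
  proof (induction n arbitrary: S)
    case 0
    then have "R = S" by simp
    then show ?case by simp
  next
    case (Suc n)
    \<comment> \<open>The last step may be shorter than a doubling, which must not lead below \<open>R\<close>.\<close>
    define T where "T = max R (S / 2)"
    have "norm (\<beta> R - \<beta> T) \<le> real n * L"
      using Suc.prems by (intro Suc.IH) (auto simp: T_def max_def)
    moreover have "norm (\<beta> T - \<beta> S) \<le> L"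
      using Suc.prems by (intro step) (auto simp: T_def max_def)
    moreover have "\<beta> R - \<beta> S = (\<beta> R - \<beta> T) + (\<beta> T - \<beta> S)" by simp
    ultimately have "norm (\<beta> R - \<beta> S) \<le> real n * L + L"
      by (metis add_mono norm_triangle_le)
    then show ?case by (simp add: distrib_right)
  qed
  have ordered: "norm (\<beta> R - \<beta> S) \<le> L * (1 + \<bar>log 2 (S / R)\<bar>)" if RS: "0 < R" "R \<le> S" for R S
  proof -
    define n where "n = nat \<lceil>log 2 (S / R)\<rceil>"
    have l: "log 2 (S / R) \<ge> 0" using RS by (simp add: zero_le_log_cancel_iff)
    have n: "log 2 (S / R) \<le> real n" "real n \<le> 1 + \<bar>log 2 (S / R)\<bar>"
      using l unfolding n_def by linarith+
    have "S / R = 2 powr (log 2 (S / R))" using RS by simp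
    also have "\<dots> \<le> 2 powr (real n)" using n by (intro powr_mono) auto
    also have "\<dots> = 2 ^ n" by (simp add: powr_realpow)
    finally have "S \<le> 2 ^ n * R" using RS by (simp add: divide_le_eq)
    from chain[OF RS this] have "norm (\<beta> R - \<beta> S) \<le> L * real n" by (simp add: mult.commute)
    also have "\<dots> \<le> L * (1 + \<bar>log 2 (S / R)\<bar>)" using L n by (intro mult_left_mono) auto
    finally show ?thesis .
  qed
  show ?thesis
  proof (cases "R \<le> S")
    case True
    then show ?thesis using ordered \<open>0 < R\<close> by blast
  next
    case False
    then have "norm (\<beta> S - \<beta> R) \<le> L * (1 + \<bar>log 2 (R / S)\<bar>)"
      using ordered \<open>0 < S\<close> by simp
    moreover have "log 2 (R / S) = - log 2 (S / R)"
      using \<open>0 < R\<close> \<open>0 < S\<close> by (simp add: log_divide)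
    ultimately show ?thesis by (simp add: norm_minus_commute)
  qed
qed

text \<open>
  For \<open>R \<le> S \<le> 2 R\<close> the mean over the smaller ball differs from that over the larger one by at most the
  average over the smaller ball of the deviation from the larger mean; enlarging the domain of
  integration costs the ratio of the volumes, at most \<open>2\<^sup>Q\<close>. The chain of doublings does the rest.
\<close>

lemma cmod_ball_mean_diff_le:
  fixes b :: "'n::finite heis \<Rightarrow> complex"
  defines "Q \<equiv> real (hdim TYPE('n))"
  assumes \<alpha>: "- Q < \<alpha>" and \<gamma>: "- Q < \<gamma>" and q: "1 \<le> q" and B: "0 < B"
    and split: "\<And>t h. 0 \<le> t \<Longrightarrow> 0 < h \<Longrightarrow> h < 1 \<Longrightarrow> t \<le> t powr q * h powr \<alpha> + h powr \<gamma>"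
    and b[measurable]: "b \<in> borel_measurable borel" and loc: "locally_integrable b"
    and cmo: "\<And>r. 0 < r \<Longrightarrow> Lp_bound (ball_measure \<alpha> r) q (\<lambda>x. cmod (b x - ball_mean b r)) (ball_weight TYPE('n) \<alpha> r powr (1 / q) * B)"
    and "0 < R" "0 < S"
  defines "L \<equiv> (ball_weight TYPE('n) \<alpha> 1 + ball_weight TYPE('n) \<gamma> 1) * 2 powr Q / ball_weight TYPE('n) 0 1"
  shows "cmod (ball_mean b R - ball_mean b S) \<le> L * (1 + \<bar>log 2 (S / R)\<bar>) * B"
proof -
  define c where "c = ball_weight TYPE('n) \<alpha> 1 + ball_weight TYPE('n) \<gamma> 1"
  define v where "v = ball_weight TYPE('n) 0 1"
  have c: "c > 0" and v: "v > 0"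
    using \<alpha> \<gamma> by (auto simp: c_def v_def Q_def hdim_pos intro!: add_pos_pos ball_weight_pos)
  have "cmod (ball_mean b R - ball_mean b S) \<le> (L * B) * (1 + \<bar>log 2 (S / R)\<bar>)"
  proof (rule doubling_chain)
    fix R S :: real assume RS: "0 < R" "R \<le> S" "S \<le> 2 * R"
    then have S: "0 < S" by simp
    have "(\<integral>\<^sup>+x. ennreal (cmod (b x - ball_mean b S)) * indicator (hball 0 R) x \<partial>lborel)
      \<le> (\<integral>\<^sup>+x. ennreal \<bar>cmod (b x - ball_mean b S)\<bar> * indicator (hball 0 S) x \<partial>lborel)"
      using RS by (intro nn_integral_mono) (auto simp: indicator_def)
    also have "\<dots> \<le> ennreal (c * S powr Q * B)"
      using nn_integral_oscillation_le[OF _ _ q S B split cmo[OF S]] \<alpha> \<gamma> by (simp add: Q_def c_def)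
    finally have "cmod (ball_mean b R - ball_mean b S) \<le> c * S powr Q * B / ball_weight TYPE('n) 0 R"
      using RS c B by (intro cmod_ball_mean_minus_le[OF b loc]) auto
    also have "ball_weight TYPE('n) 0 R = R powr Q * v"
      by (simp add: ball_weight_def Q_def v_def)
    also have "c * S powr Q * B / (R powr Q * v) \<le> c * (2 * R) powr Q * B / (R powr Q * v)"
      using RS c v B by (intro divide_right_mono mult_right_mono mult_left_mono powr_mono2) (auto simp: Q_def)
    also have "\<dots> = L * B"
      using RS by (simp add: powr_mult L_def c_def v_def Q_def)
    finally show "cmod (ball_mean b R - ball_mean b S) \<le> L * B" .
  qed fact+
  then show ?thesis by (simp add: mult_ac)
qed

section \<open>The estimate for a single matrix\<close>

text \<open>
  The factor by which composition with a matrix enlarges a Morrey-type bound: \<open>\<kappa> / D\<close> comes from the change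
  of variables, and the power of \<open>m\<close> from comparing the weighted measures of the balls of radius
  \<open>m r\<close> and \<open>r\<close>.
\<close>

definition dilation_bound :: "'n::finite itself \<Rightarrow> real \<Rightarrow> real \<Rightarrow> real \<Rightarrow> real \<Rightarrow> real \<Rightarrow> real \<Rightarrow> real" where
  "dilation_bound _ q lam \<alpha> \<kappa> D m = (\<kappa> / D) powr (1 / q) * m powr ((real (hdim TYPE('n)) + \<alpha>) * (1 / q + lam))"

lemma dilation_bound_mult:
  assumes eq: "1 / p = 1 / p\<^sub>1 + 1 / p\<^sub>2"
  shows "dilation_bound TYPE('n::finite) p\<^sub>1 lam \<alpha> \<kappa> D m * dilation_bound TYPE('n) p\<^sub>2 0 \<alpha> \<kappa> D m = dilation_bound TYPE('n) p lam \<alpha> \<kappa> D m"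
proof -
  define k where "k = real (hdim TYPE('n)) + \<alpha>"
  have K: "(\<kappa> / D) powr (1 / p\<^sub>1) * (\<kappa> / D) powr (1 / p\<^sub>2) = (\<kappa> / D) powr (1 / p)"
    unfolding eq by (rule powr_add[symmetric])
  have "k * (a + l) + k * (b + 0) = k * ((a + b) + l)" for a b l :: real
    by (simp add: algebra_simps)
  then have P: "m powr (k * (1 / p\<^sub>1 + lam)) * m powr (k * (1 / p\<^sub>2 + 0)) = m powr (k * (1 / p + lam))"
    by (simp only: eq powr_add[symmetric])
  have "(a * b) * (c * d) = (a * c) * (b * d)" for a b c d :: real
    by simp
  then show ?thesis
    unfolding dilation_bound_def k_def[symmetric] K[symmetric] P[symmetric] .
qed

lemma Lp_bound_dilated:
  fixes M :: "'n::finite heis_mat"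
  assumes det: "det M \<noteq> 0" and m: "0 < m" and \<kappa>: "0 < \<kappa>" and q: "0 < q" and r: "0 < r" and \<alpha>: "- real (hdim TYPE('n)) < \<alpha>"
    and hM: "\<And>x. hnorm (M *v x) \<le> m * hnorm x" and wM: "\<And>x. hweight \<alpha> x \<le> \<kappa> * hweight \<alpha> (M *v x)"
    and g: "Lp_bound (ball_measure \<alpha> (m * r)) q g (ball_weight TYPE('n) \<alpha> (m * r) powr (1 / q + lam) * F)"
  shows "Lp_bound (ball_measure \<alpha> r) q (\<lambda>x. g (M *v x))
    (dilation_bound TYPE('n) q lam \<alpha> \<kappa> (\<bar>det M\<bar>) m * (ball_weight TYPE('n) \<alpha> r powr (1 / q + lam) * F))"
proof -
  have W: "ball_weight TYPE('n) \<alpha> r > 0" using \<alpha> r by (rule ball_weight_pos)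
  have "ball_weight TYPE('n) \<alpha> (m * r) powr (1 / q + lam)
    = m powr ((real (hdim TYPE('n)) + \<alpha>) * (1 / q + lam)) * ball_weight TYPE('n) \<alpha> r powr (1 / q + lam)"
    using m r W by (simp add: ball_weight_scale powr_mult powr_powr)
  with Lp_bound_linear[OF g det m \<kappa> q hM wM] show ?thesis
    by (simp add: dilation_bound_def mult_ac)
qed

text \<open>
  Write \<open>b x - b (M x)\<close> as the deviation of \<open>b x\<close> from the mean over \<open>B(0, r)\<close>, plus the difference of
  the means over \<open>B(0, r)\<close> and \<open>B(0, m r)\<close>, minus the deviation of \<open>b (M x)\<close> from the mean over
  \<open>B(0, m r)\<close>. Hoelder's inequality pairs each part with \<open>f (M x)\<close>. The first two parts lead to the
  summand with the maximum; the maximum is at least one because \<open>|det M| \<le> m\<^sup>Q\<close>, so it absorbs both the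
  first part and the additive constant next to the logarithm. In the third part the dilation
  factors for the two exponents multiply to the factor for \<open>p\<close>.
\<close>

lemma commutator_slice_bound:
  fixes M :: "'n::finite heis_mat" and f b :: "'n heis \<Rightarrow> complex"
  defines "Q \<equiv> real (hdim TYPE('n))" and "W \<equiv> ball_weight TYPE('n)"
  assumes p: "1 \<le> p" "1 \<le> p\<^sub>1" "1 \<le> p\<^sub>2" and eq: "1 / p = 1 / p\<^sub>1 + 1 / p\<^sub>2" and \<alpha>: "- Q < \<alpha>"
    and [measurable]: "f \<in> borel_measurable borel" "b \<in> borel_measurable borel"
    and det: "det M \<noteq> 0" and m: "0 < m" and \<kappa>: "0 < \<kappa>"
    and hM: "\<And>x. hnorm (M *v x) \<le> m * hnorm x" and wM: "\<And>x. hweight \<alpha> x \<le> \<kappa> * hweight \<alpha> (M *v x)"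
    and f: "\<And>r. 0 < r \<Longrightarrow> Lp_bound (ball_measure \<alpha> r) p\<^sub>1 (\<lambda>x. cmod (f x)) (W \<alpha> r powr (1 / p\<^sub>1 + lam) * F)"
    and cmo: "\<And>r. 0 < r \<Longrightarrow> Lp_bound (ball_measure \<alpha> r) p\<^sub>2 (\<lambda>x. cmod (b x - ball_mean b r)) (W \<alpha> r powr (1 / p\<^sub>2) * B)"
    and means: "\<And>R S. 0 < R \<Longrightarrow> 0 < S \<Longrightarrow> cmod (ball_mean b R - ball_mean b S) \<le> L * (1 + \<bar>log 2 (S / R)\<bar>) * B"
    and L: "0 < L" and F: "0 < F" and B: "0 < B" and r: "0 < r"
  defines "E \<equiv> dilation_bound TYPE('n) p\<^sub>1 lam \<alpha> \<kappa> (\<bar>det M\<bar>) m * max (m powr Q / \<bar>det M\<bar>) \<bar>log 2 m\<bar>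
     + dilation_bound TYPE('n) p lam \<alpha> \<kappa> (\<bar>det M\<bar>) m"
  shows "Lp_bound (ball_measure \<alpha> r) p (\<lambda>x. cmod (f (M *v x)) * cmod (b x - b (M *v x)))
      ((1 + 2 * L) * E * (W \<alpha> r powr (1 / p + lam) * F * B))"
    and "Lp_bound (ball_measure \<alpha> r) p\<^sub>1 (\<lambda>x. cmod (f (M *v x))) (E * (W \<alpha> r powr (1 / p\<^sub>1 + lam) * F))"
proof -
  let ?\<mu> = "ball_measure \<alpha> r :: 'n heis measure"
  let ?D = "\<bar>det M\<bar>"
  define w where "w = W \<alpha> r"
  have w: "w > 0" unfolding w_def W_def using \<alpha> r unfolding Q_def by (rule ball_weight_pos)
  define e1 where "e1 = dilation_bound TYPE('n) p\<^sub>1 lam \<alpha> \<kappa> ?D m"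
  define e2 where "e2 = dilation_bound TYPE('n) p\<^sub>2 0 \<alpha> \<kappa> ?D m"
  define e where "e = dilation_bound TYPE('n) p lam \<alpha> \<kappa> ?D m"
  have epos: "e1 > 0" "e2 > 0" "e > 0"
    using det m \<kappa> by (auto simp: e1_def e2_def e_def dilation_bound_def)
  have e12: "e1 * e2 = e"
    unfolding e1_def e2_def e_def by (rule dilation_bound_mult[OF eq])
  define X where "X = max (m powr Q / ?D) \<bar>log 2 m\<bar>"
  have "1 \<le> m powr Q / ?D"
    using abs_det_le[OF det m hM] det by (simp add: le_divide_eq Q_def)
  then have X: "1 \<le> X" "\<bar>log 2 m\<bar> \<le> X" by (auto simp: X_def)
  have E: "E = e1 * X + e" by (simp add: E_def e1_def e_def X_def)
  have f1: "Lp_bound ?\<mu> p\<^sub>1 (\<lambda>x. cmod (f (M *v x))) (e1 * (w powr (1 / p\<^sub>1 + lam) * F))"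
    unfolding e1_def w_def W_def
    by (rule Lp_bound_dilated[OF det m \<kappa> _ r _ hM wM, where g="\<lambda>x. cmod (f x)"])
      (use p \<alpha> m r f[of "m * r"] in \<open>auto simp: Q_def W_def\<close>)
  have "e1 * 1 \<le> e1 * X" using X epos by (intro mult_left_mono) auto
  then have e1E: "e1 \<le> E" using epos unfolding E by linarith
  then show "Lp_bound ?\<mu> p\<^sub>1 (\<lambda>x. cmod (f (M *v x))) (E * (W \<alpha> r powr (1 / p\<^sub>1 + lam) * F))"
    using F w p by (intro Lp_bound_mono[OF f1]) (auto simp: w_def[symmetric] intro!: mult_right_mono)
  have g1: "Lp_bound ?\<mu> p\<^sub>2 (\<lambda>x. cmod (b x - ball_mean b r)) (w powr (1 / p\<^sub>2) * B)"
    using cmo[OF r] by (simp add: w_def)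
  define l where "l = L * (1 + \<bar>log 2 m\<bar>) * B"
  have l: "l > 0" using L B by (auto simp: l_def intro!: mult_pos_pos add_pos_nonneg)
  have g2: "Lp_bound ?\<mu> p\<^sub>2 (\<lambda>_. l) (l * w powr (1 / p\<^sub>2))"
    using \<alpha> r w l p by (intro Lp_bound_const) (auto simp: emeasure_ball_measure wmeas_hball Q_def w_def W_def)
  have g3: "Lp_bound ?\<mu> p\<^sub>2 (\<lambda>x. cmod (b (M *v x) - ball_mean b (m * r))) (e2 * (w powr (1 / p\<^sub>2 + 0) * B))"
    unfolding e2_def w_def W_def
    by (rule Lp_bound_dilated[OF det m \<kappa> _ r _ hM wM, where g="\<lambda>x. cmod (b x - ball_mean b (m * r))"])
      (use p \<alpha> m r cmo[of "m * r"] in \<open>auto simp: Q_def W_def\<close>)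
  have sum: "Lp_bound ?\<mu> p\<^sub>2 (\<lambda>x. (cmod (b x - ball_mean b r) + l) + cmod (b (M *v x) - ball_mean b (m * r)))
    ((w powr (1 / p\<^sub>2) * B + l * w powr (1 / p\<^sub>2)) + e2 * (w powr (1 / p\<^sub>2 + 0) * B))"
    using p by (intro Lp_bound_add g1 g2 g3) auto
  have prod: "Lp_bound ?\<mu> p (\<lambda>x. cmod (f (M *v x)) * ((cmod (b x - ball_mean b r) + l) + cmod (b (M *v x) - ball_mean b (m * r))))
    (e1 * (w powr (1 / p\<^sub>1 + lam) * F) * ((w powr (1 / p\<^sub>2) * B + l * w powr (1 / p\<^sub>2)) + e2 * (w powr (1 / p\<^sub>2 + 0) * B)))"
    using p eq by (intro Lp_bound_mult[OF f1 sum]) auto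
  define Y where "Y = w powr (1 / p + lam) * F * B"
  have Y: "Y > 0" using w F B by (simp add: Y_def)
  have W12: "w powr (1 / p\<^sub>1 + lam) * w powr (1 / p\<^sub>2) = w powr (1 / p + lam)"
    unfolding eq by (subst powr_add[symmetric]) (simp add: add_ac)
  have expand: "e1 * (w1 * F) * ((w2 * B + L * g * B * w2) + e2 * (w2 * B)) = (e1 * (1 + L * g) + e1 * e2) * (w1 * w2 * F * B)"
    for w1 w2 g
    by (simp add: algebra_simps)
  have "e1 * (w powr (1 / p\<^sub>1 + lam) * F) * ((w powr (1 / p\<^sub>2) * B + l * w powr (1 / p\<^sub>2)) + e2 * (w powr (1 / p\<^sub>2 + 0) * B))
     = (e1 * (1 + L * (1 + \<bar>log 2 m\<bar>)) + e1 * e2) * Y"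
    by (simp only: Y_def l_def add_0_right expand W12)
  also have "\<dots> \<le> ((1 + 2 * L) * E) * Y"
  proof (rule mult_right_mono)
    have "1 + L * (1 + \<bar>log 2 m\<bar>) \<le> X + L * (X + X)"
      using X L by (intro add_mono mult_left_mono) auto
    then have "e1 * (1 + L * (1 + \<bar>log 2 m\<bar>)) \<le> e1 * (X + L * (X + X))"
      using epos by (intro mult_left_mono) auto
    moreover have "0 \<le> 2 * L * e" using L epos by simp
    moreover have "(1 + 2 * L) * E = e1 * (X + L * (X + X)) + e + 2 * L * e"
      by (simp add: E algebra_simps)
    ultimately show "e1 * (1 + L * (1 + \<bar>log 2 m\<bar>)) + e1 * e2 \<le> (1 + 2 * L) * E"
      using e12 by linarith
  qed (use Y in simp)
  finally have le: "e1 * (w powr (1 / p\<^sub>1 + lam) * F) * ((w powr (1 / p\<^sub>2) * B + l * w powr (1 / p\<^sub>2)) + e2 * (w powr (1 / p\<^sub>2 + 0) * B))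
    \<le> ((1 + 2 * L) * E) * Y" .
  show "Lp_bound ?\<mu> p (\<lambda>x. cmod (f (M *v x)) * cmod (b x - b (M *v x)))
      ((1 + 2 * L) * E * (W \<alpha> r powr (1 / p + lam) * F * B))"
  proof (rule Lp_bound_mono[OF prod])
    fix x
    have "cmod (ball_mean b r - ball_mean b (m * r)) \<le> l"
      using means[of r "m * r"] m r by (simp add: l_def)
    moreover have "b x - b (M *v x) = (b x - ball_mean b r) + (ball_mean b r - ball_mean b (m * r)) - (b (M *v x) - ball_mean b (m * r))"
      by simp
    ultimately have "cmod (b x - b (M *v x)) \<le> (cmod (b x - ball_mean b r) + l) + cmod (b (M *v x) - ball_mean b (m * r))"
      by (smt (verit) norm_triangle_ineq norm_triangle_ineq4)
    then show "\<bar>cmod (f (M *v x)) * cmod (b x - b (M *v x))\<bar>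
      \<le> \<bar>cmod (f (M *v x)) * ((cmod (b x - ball_mean b r) + l) + cmod (b (M *v x) - ball_mean b (m * r)))\<bar>"
      using l by (simp add: abs_mult mult_left_mono)
  qed (use p le in \<open>auto simp: Y_def w_def\<close>)
qed

section \<open>Integration over the matrices\<close>

text \<open>
  The function \<open>v\<close> need not be measurable, so its integral is a lower integral. The lemma is applied to
  the integrand of the final constant, whose measurability thus never comes into question.
\<close>

lemma nn_integral_le_cmult:
  assumes [measurable]: "u \<in> borel_measurable M" and c: "0 < c"
    and le: "AE x in M. u x \<le> ennreal c * v x"
  shows "(\<integral>\<^sup>+x. u x \<partial>M) \<le> ennreal c * (\<integral>\<^sup>+x. v x \<partial>M)"
proof -
  have one: "ennreal c * (ennreal (1 / c) * a) = a" "ennreal (1 / c) * (ennreal c * a) = a" for a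
    using c by (simp_all add: mult.assoc[symmetric] ennreal_mult[symmetric])
  have "(\<integral>\<^sup>+x. u x \<partial>M) = ennreal c * (\<integral>\<^sup>+x. ennreal (1 / c) * u x \<partial>M)"
    by (simp add: nn_integral_cmult one)
  also have "\<dots> \<le> ennreal c * (\<integral>\<^sup>+x. v x \<partial>M)"
  proof (intro mult_left_mono nn_integral_mono_AE)
    show "AE x in M. ennreal (1 / c) * u x \<le> v x"
      using le
    proof eventually_elim
      fix x assume "u x \<le> ennreal c * v x"
      then have "ennreal (1 / c) * u x \<le> ennreal (1 / c) * (ennreal c * v x)"
        by (rule mult_left_mono) simp
      then show "ennreal (1 / c) * u x \<le> v x"
        by (simp only: one)
    qed
  qed simp
  finally show ?thesis .
qed

text \<open>
  Minkowski's inequality for a superposition over the parameter \<open>y\<close> of slices that depend on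
  \<open>y\<close> only through the matrix \<open>A y\<close>. Matrices where \<open>h\<close> is infinite do no harm: either
  \<open>\<phi>\<close> vanishes there, or the bound for the slice is infinite.
\<close>

lemma nn_integral_superposition_le:
  fixes \<phi> :: "'n::finite heis \<Rightarrow> real" and A :: "'n heis \<Rightarrow> 'n heis_mat" and h :: "'n heis_mat \<Rightarrow> ennreal"
    and g :: "'n heis \<Rightarrow> 'n heis_mat \<Rightarrow> real"
  assumes \<alpha>: "- real (hdim TYPE('n)) < \<alpha>" and R: "0 < R" and q: "1 \<le> q" and c: "0 < c" and T: "0 \<le> T"
    and [measurable]: "\<phi> \<in> borel_measurable borel" "A \<in> borel_measurable borel"
    and \<phi>0: "\<And>y. 0 \<le> \<phi> y" and g0: "\<And>x M. 0 \<le> g x M"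
    and g[measurable]: "(\<lambda>(x, y). g x (A y)) \<in> borel_measurable (borel \<Otimes>\<^sub>M borel)"
    and det: "AE y in lborel. \<phi> y \<noteq> 0 \<longrightarrow> det (A y) \<noteq> 0"
    and slice: "\<And>M. det M \<noteq> 0 \<Longrightarrow> h M \<noteq> \<infinity> \<Longrightarrow>
      \<exists>s. Lp_bound (ball_measure \<alpha> R) q (\<lambda>x. g x M) s \<and> ennreal s \<le> ennreal c * h M"
    and hT: "(\<integral>\<^sup>+y. ennreal (\<phi> y) * h (A y) \<partial>lborel) \<le> ennreal T"
  shows "(\<integral>\<^sup>+x. epowr (\<integral>\<^sup>+y. ennreal (\<phi> y * g x (A y)) \<partial>lborel) q \<partial>ball_measure \<alpha> R) \<le> ennreal ((c * T) powr q)"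
proof (rule Minkowski_integral[OF sigma_finite_ball_measure[OF \<alpha> R] lborel.sigma_finite_measure_axioms])
  have [measurable]: "(\<lambda>(x, y). \<phi> y * g x (A y)) \<in> borel_measurable (borel \<Otimes>\<^sub>M borel)"
  proof -
    have "(\<lambda>z. \<phi> (snd z) * (\<lambda>(x, y). g x (A y)) z) \<in> borel_measurable (borel \<Otimes>\<^sub>M borel)"
      by measurable
    then show ?thesis by (simp add: case_prod_beta')
  qed
  have sets_eq: "sets (ball_measure \<alpha> R \<Otimes>\<^sub>M lborel) = sets (borel \<Otimes>\<^sub>M borel)"
    by (rule sets_pair_measure_cong) auto
  show meas[measurable]: "(\<lambda>(x, y). \<phi> y * g x (A y)) \<in> borel_measurable (ball_measure \<alpha> R \<Otimes>\<^sub>M lborel)"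
    by (subst measurable_cong_sets[OF sets_eq refl]) measurable
  interpret sigma_finite_measure "ball_measure \<alpha> R :: 'n heis measure"
    by (rule sigma_finite_ball_measure[OF \<alpha> R])
  let ?N = "\<lambda>y. epowr (\<integral>\<^sup>+x. ennreal ((\<phi> y * g x (A y)) powr q) \<partial>ball_measure \<alpha> R) (1 / q)"
  have "(\<lambda>(y, x). \<phi> y * g x (A y)) \<in> borel_measurable (lborel \<Otimes>\<^sub>M ball_measure \<alpha> R)"
    using measurable_pair_swap[OF meas] by (simp add: case_prod_beta')
  then have "?N \<in> borel_measurable lborel"
    by (intro borel_measurable_epowr borel_measurable_nn_integral) (simp add: case_prod_beta')
  then have "(\<integral>\<^sup>+y. ?N y \<partial>lborel) \<le> ennreal c * (\<integral>\<^sup>+y. ennreal (\<phi> y) * h (A y) \<partial>lborel)"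
  proof (rule nn_integral_le_cmult[OF _ c])
    show "AE y in lborel. ?N y \<le> ennreal c * (ennreal (\<phi> y) * h (A y))"
      using det
    proof eventually_elim
      fix y assume det: "\<phi> y \<noteq> 0 \<longrightarrow> det (A y) \<noteq> 0"
      show "?N y \<le> ennreal c * (ennreal (\<phi> y) * h (A y))"
      proof (cases "\<phi> y = 0 \<or> h (A y) = \<infinity>")
        case True
        then show ?thesis
          using q c \<phi>0[of y] by (cases "\<phi> y = 0") (auto simp: epowr_def ennreal_mult_top)
      next
        case False
        then have \<phi>: "\<phi> y > 0" using \<phi>0[of y] by simp
        obtain s where s: "Lp_bound (ball_measure \<alpha> R) q (\<lambda>x. g x (A y)) s" "ennreal s \<le> ennreal c * h (A y)"
          using slice[of "A y"] det False by blast
        have s0: "s > 0" using s by (simp add: Lp_bound_def)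
        have "(\<integral>\<^sup>+x. ennreal ((\<phi> y * g x (A y)) powr q) \<partial>ball_measure \<alpha> R) \<le> ennreal ((\<phi> y * s) powr q)"
          using Lp_bound_cmult[OF s(1) \<phi>] \<phi> g0 by (simp add: Lp_bound_def)
        then have "?N y \<le> ennreal (\<phi> y * s)"
          using q \<phi> s0 by (subst epowr_root_le_iff) auto
        also have "\<dots> = ennreal (\<phi> y) * ennreal s"
          using \<phi> s0 by (simp add: ennreal_mult)
        also have "\<dots> \<le> ennreal (\<phi> y) * (ennreal c * h (A y))"
          by (intro mult_left_mono s) simp
        finally show ?thesis by (simp add: mult_ac)
      qed
    qed
  qed
  also have "\<dots> \<le> ennreal c * ennreal T"
    by (intro mult_left_mono hT) simp
  also have "\<dots> = ennreal (c * T)"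
    using c T by (simp add: ennreal_mult)
  finally show "(\<integral>\<^sup>+y. ?N y \<partial>lborel) \<le> ennreal (c * T)" .
qed (use q c T \<phi>0 g0 in auto)

lemma AE_lborel_if_AE_balls:
  fixes P :: "'n::finite heis \<Rightarrow> bool"
  assumes "\<And>R. 0 < R \<Longrightarrow> AE x in ball_measure \<alpha> R. P x"
  shows "AE x in lborel. P x"
proof -
  have "AE x in lborel. \<forall>n::nat. hnorm x < real (Suc n) \<longrightarrow> P (x :: 'n heis)"
    unfolding AE_all_countable
  proof
    fix n
    show "AE x in lborel. hnorm x < real (Suc n) \<longrightarrow> P (x :: 'n heis)"
      using assms[of "real (Suc n)"] by (simp only: AE_ball_measure of_nat_0_less_iff zero_less_Suc)
  qed
  then show ?thesis
  proof eventually_elim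
    fix x :: "'n heis" assume *: "\<forall>n::nat. hnorm x < real (Suc n) \<longrightarrow> P x"
    obtain n where "hnorm x < real n" using reals_Archimedean2 by blast
    then have "hnorm x < real (Suc n)" by simp
    with * show "P x" by blast
  qed
qed

lemma AE_finite_if_nn_integral_epowr_finite:
  assumes [measurable]: "I \<in> borel_measurable M" and q: "0 < q" and "(\<integral>\<^sup>+x. epowr (I x) q \<partial>M) \<le> ennreal c"
  shows "AE x in M. I x < \<infinity>"
proof -
  have "AE x in M. epowr (I x) q \<noteq> \<infinity>"
    using assms by (intro nn_integral_PInf_AE) (auto simp: top_unique)
  then show ?thesis
    by eventually_elim (use q in \<open>auto simp: epowr_def less_top[symmetric]\<close>)
qed

definition slice_factor :: "'n::finite itself \<Rightarrow> real \<Rightarrow> real \<Rightarrow> real \<Rightarrow> real \<Rightarrow> real \<Rightarrow> real \<Rightarrow> real \<Rightarrow> real" where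
  "slice_factor _ p p\<^sub>1 lam \<alpha> \<kappa> D m =
     dilation_bound TYPE('n) p\<^sub>1 lam \<alpha> \<kappa> D m * max (m powr real (hdim TYPE('n)) / D) \<bar>log 2 m\<bar>
     + dilation_bound TYPE('n) p lam \<alpha> \<kappa> D m"

text \<open>
  What the integrand \<open>h\<close> of the constant in the main estimate has to satisfy. It leaves the choice
  of \<open>m\<close> and \<open>\<kappa>\<close> open, since \<open>\<kappa>\<close> is found differently for the two signs of \<open>\<alpha>\<close>. The factor two is
  for the case \<open>\<alpha> \<le> 0\<close>, where a single summand has to dominate both summands of the slice factor.
\<close>

definition dominates_slices :: "real \<Rightarrow> real \<Rightarrow> real \<Rightarrow> real \<Rightarrow> ('n::finite heis_mat \<Rightarrow> ennreal) \<Rightarrow> bool" where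
  "dominates_slices p p\<^sub>1 lam \<alpha> h \<longleftrightarrow> (\<forall>M. det M \<noteq> 0 \<longrightarrow> h M \<noteq> \<infinity> \<longrightarrow>
     (\<exists>m \<kappa>. 0 < m \<and> 0 < \<kappa> \<and> (\<forall>x. hnorm (M *v x) \<le> m * hnorm x)
        \<and> (\<forall>x. hweight \<alpha> x \<le> \<kappa> * hweight \<alpha> (M *v x))
        \<and> ennreal (slice_factor TYPE('n) p p\<^sub>1 lam \<alpha> \<kappa> (\<bar>det M\<bar>) m) \<le> 2 * h M))"

definition means_vary_slowly :: "real \<Rightarrow> real \<Rightarrow> real \<Rightarrow> 'n::finite itself \<Rightarrow> bool" where
  "means_vary_slowly p\<^sub>2 \<alpha> L _ \<longleftrightarrow> (\<forall>(b :: 'n heis \<Rightarrow> complex) B R S. b \<in> borel_measurable borel \<longrightarrow> locally_integrable b \<longrightarrow>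
     0 < B \<longrightarrow> cmo_norm p\<^sub>2 (hweight \<alpha>) b \<le> ennreal B \<longrightarrow> 0 < R \<longrightarrow> 0 < S \<longrightarrow>
     cmod (ball_mean b R - ball_mean b S) \<le> L * (1 + \<bar>log 2 (S / R)\<bar>) * B)"

lemma borel_measurable_hausdorff_integrand [measurable (raw)]:
  assumes [measurable]: "\<Phi> \<in> borel_measurable borel" "A \<in> borel_measurable borel" "f \<in> borel_measurable borel"
    "u \<in> borel_measurable M" "v \<in> borel_measurable M"
  shows "(\<lambda>z. hausdorff_integrand \<Phi> A f (u z) (v z)) \<in> borel_measurable M"
  unfolding hausdorff_integrand_def by measurable

lemma hausdorff_lborel:
  assumes [measurable]: "\<Phi> \<in> borel_measurable borel" "A \<in> borel_measurable borel" "f \<in> borel_measurable borel"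
  shows "hausdorff \<Phi> A f x = (LINT y|lborel. hausdorff_integrand \<Phi> A f x y)"
  unfolding hausdorff_def by (rule integral_completion) measurable

lemma borel_measurable_hausdorff [measurable]:
  assumes [measurable]: "\<Phi> \<in> borel_measurable borel" "A \<in> borel_measurable borel" "f \<in> borel_measurable borel"
  shows "hausdorff \<Phi> A f \<in> borel_measurable borel"
proof -
  have "(\<lambda>x. LINT y|lborel. hausdorff_integrand \<Phi> A f x y) \<in> borel_measurable borel"
    by (rule lborel.borel_measurable_lebesgue_integral) measurable
  moreover have "hausdorff \<Phi> A f = (\<lambda>x. LINT y|lborel. hausdorff_integrand \<Phi> A f x y)"
    by (rule ext) (rule hausdorff_lborel; measurable)
  ultimately show ?thesis by simp
qed

lemma borel_measurable_hausdorff_commutator [measurable]: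
  assumes [measurable]: "\<Phi> \<in> borel_measurable borel" "A \<in> borel_measurable borel" "f \<in> borel_measurable borel" "b \<in> borel_measurable borel"
  shows "hausdorff_commutator \<Phi> A b f \<in> borel_measurable borel"
  unfolding hausdorff_commutator_def[abs_def] by measurable

text \<open>
  The commutator is defined as a difference of two integrals. It is a single integral where
  both converge, and convergence of the second follows from
  \<open>b (A y x) f (A y x) = b x f (A y x) - f (A y x) (b x - b (A y x))\<close>.
\<close>

lemma hausdorff_commutator_pointwise:
  fixes \<Phi> f b :: "'n::finite heis \<Rightarrow> complex"
  defines "\<phi> \<equiv> \<lambda>y. cmod (\<Phi> y) / hnorm y ^ hdim TYPE('n)"
  assumes [measurable]: "\<Phi> \<in> borel_measurable borel" "A \<in> borel_measurable borel" "f \<in> borel_measurable borel" "b \<in> borel_measurable borel"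
    and fin1: "(\<integral>\<^sup>+y. ennreal (\<phi> y * cmod (f (A y *v x))) \<partial>lborel) < \<infinity>"
    and fin2: "(\<integral>\<^sup>+y. ennreal (\<phi> y * (cmod (f (A y *v x)) * cmod (b x - b (A y *v x)))) \<partial>lborel) < \<infinity>"
  shows "integrable lebesgue (hausdorff_integrand \<Phi> A f x)"
    and "integrable lebesgue (hausdorff_integrand \<Phi> A (\<lambda>z. b z * f z) x)"
    and "ennreal (cmod (hausdorff_commutator \<Phi> A b f x))
      \<le> (\<integral>\<^sup>+y. ennreal (\<phi> y * (cmod (f (A y *v x)) * cmod (b x - b (A y *v x)))) \<partial>lborel)"
proof -
  let ?k1 = "hausdorff_integrand \<Phi> A f x"
  let ?k3 = "\<lambda>y. ?k1 y * (b x - b (A y *v x))"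
  have n1: "cmod (?k1 y) = \<phi> y * cmod (f (A y *v x))" for y
    by (simp add: hausdorff_integrand_def \<phi>_def norm_mult norm_divide norm_power)
  have n3: "cmod (?k3 y) = \<phi> y * (cmod (f (A y *v x)) * cmod (b x - b (A y *v x)))" for y
    by (simp add: norm_mult n1 mult.assoc)
  have k1: "integrable lborel ?k1"
    using fin1 by (intro integrableI_bounded) (measurable, simp only: n1)
  have k3: "integrable lborel ?k3"
    using fin2 by (intro integrableI_bounded) (measurable, simp only: n3)
  have k2_eq: "hausdorff_integrand \<Phi> A (\<lambda>z. b z * f z) x = (\<lambda>y. b x * ?k1 y - ?k3 y)"
  proof -
    have "c * (b' * f') = \<beta> * (c * f') - c * f' * (\<beta> - b')" for c b' f' \<beta> :: complex
      by (simp add: algebra_simps)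
    then show ?thesis
      unfolding hausdorff_integrand_def by blast
  qed
  have k2: "integrable lborel (hausdorff_integrand \<Phi> A (\<lambda>z. b z * f z) x)"
    unfolding k2_eq using k1 k3 by simp
  show "integrable lebesgue ?k1"
    using k1 by (subst integrable_completion) measurable
  show "integrable lebesgue (hausdorff_integrand \<Phi> A (\<lambda>z. b z * f z) x)"
    using k2 by (subst integrable_completion) measurable
  have "hausdorff_commutator \<Phi> A b f x = b x * (LINT y|lborel. ?k1 y) - (LINT y|lborel. b x * ?k1 y - ?k3 y)"
    unfolding hausdorff_commutator_def by (subst (1 2) hausdorff_lborel) (measurable, simp only: k2_eq)
  also have "\<dots> = (LINT y|lborel. ?k3 y)"
    using k1 k3 by simp
  finally have "ennreal (cmod (hausdorff_commutator \<Phi> A b f x)) \<le> (\<integral>\<^sup>+y. ennreal (cmod (?k3 y)) \<partial>lborel)"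
    using integral_norm_bound_ennreal[OF k3] by simp
  then show "ennreal (cmod (hausdorff_commutator \<Phi> A b f x))
      \<le> (\<integral>\<^sup>+y. ennreal (\<phi> y * (cmod (f (A y *v x)) * cmod (b x - b (A y *v x)))) \<partial>lborel)"
    by (simp only: n3)
qed

text \<open>
  The superposition bound is used twice: with the product slices and exponent \<open>p\<close>, which gives the
  norm estimate, and with the slices of \<open>f\<close> alone and exponent \<open>p\<^sub>1\<close>, which gives convergence of
  \<open>hausdorff \<Phi> A f\<close> almost everywhere. The positive real majorants \<open>F\<close>, \<open>B\<close> and \<open>T\<close> stand for the
  two norms and the constant.
\<close>

lemma hausdorff_commutator_bound_borel:
  fixes \<Phi> f b :: "'n::finite heis \<Rightarrow> complex" and A :: "'n heis \<Rightarrow> 'n heis_mat" and h :: "'n heis_mat \<Rightarrow> ennreal"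
  assumes p: "1 \<le> p" "1 \<le> p\<^sub>1" "1 \<le> p\<^sub>2" and eq: "1 / p = 1 / p\<^sub>1 + 1 / p\<^sub>2" and \<alpha>: "- real (hdim TYPE('n)) < \<alpha>"
    and [measurable]: "\<Phi> \<in> borel_measurable borel" "A \<in> borel_measurable borel" "f \<in> borel_measurable borel" "b \<in> borel_measurable borel"
    and det: "AE y in lborel. \<Phi> y \<noteq> 0 \<longrightarrow> det (A y) \<noteq> 0"
    and loc: "locally_integrable b"
    and h: "dominates_slices p p\<^sub>1 lam \<alpha> h"
    and means: "means_vary_slowly p\<^sub>2 \<alpha> L TYPE('n)" and L: "0 < L"
    and F: "0 < F" "morrey_norm p\<^sub>1 lam (hweight \<alpha>) f \<le> ennreal F"
    and B: "0 < B" "cmo_norm p\<^sub>2 (hweight \<alpha>) b \<le> ennreal B"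
    and T: "0 < T" "(\<integral>\<^sup>+y. ennreal (cmod (\<Phi> y) / hnorm y ^ hdim TYPE('n)) * h (A y) \<partial>lborel) \<le> ennreal T"
  shows "AE x in lborel. integrable lebesgue (hausdorff_integrand \<Phi> A f x)
        \<and> integrable lebesgue (hausdorff_integrand \<Phi> A (\<lambda>z. b z * f z) x)"
    and "morrey_norm p lam (hweight \<alpha>) (hausdorff_commutator \<Phi> A b f) \<le> ennreal (2 * (1 + 2 * L) * T * F * B)"
proof -
  define \<phi> where "\<phi> y = cmod (\<Phi> y) / hnorm y ^ hdim TYPE('n)" for y
  define W where "W = ball_weight TYPE('n) \<alpha>"
  have [measurable]: "\<phi> \<in> borel_measurable borel" and \<phi>0: "\<phi> y \<ge> 0" for y
    unfolding \<phi>_def[abs_def] by measurable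
  have det\<phi>: "AE y in lborel. \<phi> y \<noteq> 0 \<longrightarrow> det (A y) \<noteq> 0"
    using det by eventually_elim (auto simp: \<phi>_def)
  have T': "(\<integral>\<^sup>+y. ennreal (\<phi> y) * h (A y) \<partial>lborel) \<le> ennreal T"
    using T by (simp add: \<phi>_def)
  let ?g1 = "\<lambda>x M. cmod (f (M *v x))"
  let ?g = "\<lambda>x M. cmod (f (M *v x)) * cmod (b x - b (M *v x))"
  have p0: "0 < p" "0 < p\<^sub>1" "0 < p\<^sub>2" using p by auto
  have fR: "Lp_bound (ball_measure \<alpha> r) p\<^sub>1 (\<lambda>x. cmod (f x)) (W r powr (1 / p\<^sub>1 + lam) * F)" if "r > 0" for r
    using F(2) that p0 F(1) \<alpha> by (subst (asm) morrey_norm_le_iff) (auto simp: W_def)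
  have bR: "Lp_bound (ball_measure \<alpha> r) p\<^sub>2 (\<lambda>x. cmod (b x - ball_mean b r)) (W r powr (1 / p\<^sub>2) * B)" if "r > 0" for r
    using B(2) that p0 B(1) \<alpha> by (subst (asm) cmo_norm_le_iff) (auto simp: W_def)
  have bm: "cmod (ball_mean b R - ball_mean b S) \<le> L * (1 + \<bar>log 2 (S / R)\<bar>) * B" if "0 < R" "0 < S" for R S
    using means loc B that unfolding means_vary_slowly_def by simp
  have Wpos: "W R > 0" if "R > 0" for R
    using that \<alpha> by (simp add: W_def ball_weight_pos)
  have slices: "\<exists>s. Lp_bound (ball_measure \<alpha> R) p (\<lambda>x. ?g x M) s \<and> ennreal s \<le> ennreal (2 * (1 + 2 * L) * (W R powr (1 / p + lam) * F * B)) * h M"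
    "\<exists>s. Lp_bound (ball_measure \<alpha> R) p\<^sub>1 (\<lambda>x. ?g1 x M) s \<and> ennreal s \<le> ennreal (2 * (W R powr (1 / p\<^sub>1 + lam) * F)) * h M"
    if R: "R > 0" and M: "det M \<noteq> 0" "h M \<noteq> \<infinity>" for R and M :: "'n heis_mat"
  proof -
    obtain m \<kappa> where m: "0 < m" and \<kappa>: "0 < \<kappa>" and hM: "\<And>x. hnorm (M *v x) \<le> m * hnorm x"
      and wM: "\<And>x. hweight \<alpha> x \<le> \<kappa> * hweight \<alpha> (M *v x)"
      and E: "ennreal (slice_factor TYPE('n) p p\<^sub>1 lam \<alpha> \<kappa> (\<bar>det M\<bar>) m) \<le> 2 * h M"
      using h M unfolding dominates_slices_def by blast
    let ?E = "slice_factor TYPE('n) p p\<^sub>1 lam \<alpha> \<kappa> (\<bar>det M\<bar>) m"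
    have E0: "?E \<ge> 0"
      using \<kappa> m by (auto simp: slice_factor_def dilation_bound_def intro!: add_nonneg_nonneg mult_nonneg_nonneg le_max_iff_disj[THEN iffD2])
    have scale: "ennreal (c * ?E * d) \<le> ennreal (2 * c * d) * h M" if "0 \<le> c" "0 \<le> d" for c d
    proof -
      have "ennreal (c * ?E * d) = ennreal (c * d) * ennreal ?E"
        using that E0 by (subst ennreal_mult[symmetric]) (auto simp: mult_ac)
      also have "\<dots> \<le> ennreal (c * d) * (2 * h M)"
        by (intro mult_left_mono E) simp
      also have "\<dots> = ennreal (2 * c * d) * h M"
        using that by (simp add: ennreal_mult mult_ac)
      finally show ?thesis .
    qed
    note S = commutator_slice_bound[OF p eq \<alpha> _ _ M(1) m \<kappa> hM wM fR[unfolded W_def] bR[unfolded W_def] bm L F(1) B(1) R]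
    have s1: "Lp_bound (ball_measure \<alpha> R) p (\<lambda>x. ?g x M) ((1 + 2 * L) * ?E * (W R powr (1 / p + lam) * F * B))"
      unfolding slice_factor_def W_def by (rule S(1)) measurable
    have s2: "Lp_bound (ball_measure \<alpha> R) p\<^sub>1 (\<lambda>x. ?g1 x M) (?E * (W R powr (1 / p\<^sub>1 + lam) * F))"
      unfolding slice_factor_def W_def by (rule S(2)) measurable
    show "\<exists>s. Lp_bound (ball_measure \<alpha> R) p (\<lambda>x. ?g x M) s \<and> ennreal s \<le> ennreal (2 * (1 + 2 * L) * (W R powr (1 / p + lam) * F * B)) * h M"
      using s1 scale[of "1 + 2 * L" "W R powr (1 / p + lam) * F * B"] L F B by auto
    show "\<exists>s. Lp_bound (ball_measure \<alpha> R) p\<^sub>1 (\<lambda>x. ?g1 x M) s \<and> ennreal s \<le> ennreal (2 * (W R powr (1 / p\<^sub>1 + lam) * F)) * h M"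
      using s2 scale[of 1 "W R powr (1 / p\<^sub>1 + lam) * F"] F by auto
  qed
  let ?I1 = "\<lambda>x. \<integral>\<^sup>+y. ennreal (\<phi> y * ?g1 x (A y)) \<partial>lborel"
  let ?I = "\<lambda>x. \<integral>\<^sup>+y. ennreal (\<phi> y * ?g x (A y)) \<partial>lborel"
  have I1: "(\<integral>\<^sup>+x. epowr (?I1 x) p\<^sub>1 \<partial>ball_measure \<alpha> R) \<le> ennreal ((2 * (W R powr (1 / p\<^sub>1 + lam) * F) * T) powr p\<^sub>1)"
    if R: "R > 0" for R
    by (rule nn_integral_superposition_le[OF \<alpha> R p(2) _ _ _ _ \<phi>0 _ _ det\<phi> slices(2)[OF R] T'])
       (use F T Wpos[OF R] in \<open>simp_all, measurable\<close>)
  have I: "(\<integral>\<^sup>+x. epowr (?I x) p \<partial>ball_measure \<alpha> R) \<le> ennreal ((2 * (1 + 2 * L) * (W R powr (1 / p + lam) * F * B) * T) powr p)"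
    if R: "R > 0" for R
    by (rule nn_integral_superposition_le[OF \<alpha> R p(1) _ _ _ _ \<phi>0 _ _ det\<phi> slices(1)[OF R] T'])
       (use F B L T Wpos[OF R] in \<open>simp_all, measurable\<close>)
  have [measurable]: "?I1 \<in> borel_measurable borel" "?I \<in> borel_measurable borel"
    by measurable
  have "AE x in ball_measure \<alpha> R. ?I1 x < \<infinity>" if "R > 0" for R
    using p0 by (intro AE_finite_if_nn_integral_epowr_finite[OF _ _ I1[OF that]]) simp_all
  then have fin1: "AE x in lborel. ?I1 x < \<infinity>"
    by (rule AE_lborel_if_AE_balls)
  have "AE x in ball_measure \<alpha> R. ?I x < \<infinity>" if "R > 0" for R
    using p0 by (intro AE_finite_if_nn_integral_epowr_finite[OF _ _ I[OF that]]) simp_all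
  then have fin: "AE x in lborel. ?I x < \<infinity>"
    by (rule AE_lborel_if_AE_balls)
  have pointwise: "(integrable lebesgue (hausdorff_integrand \<Phi> A f x)
        \<and> integrable lebesgue (hausdorff_integrand \<Phi> A (\<lambda>z. b z * f z) x)) \<and> ennreal (cmod (hausdorff_commutator \<Phi> A b f x)) \<le> ?I x"
    if "?I1 x < \<infinity>" "?I x < \<infinity>" for x
    using hausdorff_commutator_pointwise[of \<Phi> A f b x] that by (simp add: \<phi>_def)
  show "AE x in lborel. integrable lebesgue (hausdorff_integrand \<Phi> A f x)
        \<and> integrable lebesgue (hausdorff_integrand \<Phi> A (\<lambda>z. b z * f z) x)"
    using fin1 fin by eventually_elim (use pointwise in blast)
  have comm: "AE x in lborel. ennreal (cmod (hausdorff_commutator \<Phi> A b f x)) \<le> ?I x"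
    using fin1 fin by eventually_elim (use pointwise in blast)
  have X: "0 < 2 * (1 + 2 * L) * T * F * B"
    using L T F B by (intro mult_pos_pos) auto
  have "Lp_bound (ball_measure \<alpha> R) p (\<lambda>x. cmod (hausdorff_commutator \<Phi> A b f x)) (W R powr (1 / p + lam) * (2 * (1 + 2 * L) * T * F * B))"
    if R: "R > 0" for R
  proof -
    have "(\<integral>\<^sup>+x. ennreal (\<bar>cmod (hausdorff_commutator \<Phi> A b f x)\<bar> powr p) \<partial>ball_measure \<alpha> R) \<le> (\<integral>\<^sup>+x. epowr (?I x) p \<partial>ball_measure \<alpha> R)"
    proof (rule nn_integral_mono_AE)
      have "AE x in ball_measure \<alpha> R. ennreal (cmod (hausdorff_commutator \<Phi> A b f x)) \<le> ?I x"
        unfolding AE_ball_measure using comm by eventually_elim blast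
      then show "AE x in ball_measure \<alpha> R. ennreal (\<bar>cmod (hausdorff_commutator \<Phi> A b f x)\<bar> powr p) \<le> epowr (?I x) p"
      proof eventually_elim
        fix x assume "ennreal (cmod (hausdorff_commutator \<Phi> A b f x)) \<le> ?I x"
        from epowr_mono[OF this, of p] show "ennreal (\<bar>cmod (hausdorff_commutator \<Phi> A b f x)\<bar> powr p) \<le> epowr (?I x) p"
          using p0 by (simp add: epowr_ennreal_nonneg)
      qed
    qed
    also note I[OF R]
    also have "2 * (1 + 2 * L) * (W R powr (1 / p + lam) * F * B) * T = W R powr (1 / p + lam) * (2 * (1 + 2 * L) * T * F * B)"
      by (simp only: mult_ac)
    finally show ?thesis
      using X Wpos[OF R] by (simp add: Lp_bound_def)
  qed
  then show "morrey_norm p lam (hweight \<alpha>) (hausdorff_commutator \<Phi> A b f) \<le> ennreal (2 * (1 + 2 * L) * T * F * B)"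
    using p0 X \<alpha> by (subst morrey_norm_le_iff) (auto simp: W_def)
qed

section \<open>Passing to Borel representatives\<close>

lemma borel_measurable_completion_AE:
  assumes g: "g \<in> borel_measurable M" and ae: "AE x in M. f x = g x"
  shows "f \<in> borel_measurable (completion M)"
proof (rule measurableI)
  fix S :: "'b set" assume "S \<in> sets borel"
  with g have "g -` S \<inter> space M \<in> sets (completion M)"
    by (intro sets_completionI_sets measurable_sets)
  then have "f -` S \<inter> space M \<in> sets (completion M)"
  proof (rule completion.in_sets_AE[rotated])
    have "AE x in completion M. f x = g x"
      using ae by (rule AE_completion)
    then show "AE x in completion M. x \<in> g -` S \<inter> space M \<longleftrightarrow> x \<in> f -` S \<inter> space M"
      by eventually_elim auto
  qed simp
  then show "f -` S \<inter> space (completion M) \<in> sets (completion M)"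
    by simp
qed simp

lemma integral_completion_cong_AE:
  fixes f g :: "'a \<Rightarrow> 'b::{banach, second_countable_topology}"
  assumes g: "g \<in> borel_measurable M" and ae: "AE x in M. f x = g x"
  shows "integrable (completion M) f \<longleftrightarrow> integrable (completion M) g"
    and "integral\<^sup>L (completion M) f = integral\<^sup>L (completion M) g"
proof -
  note ae' = borel_measurable_completion_AE[OF assms] measurable_completion[OF g] AE_completion[OF ae]
  show "integrable (completion M) f \<longleftrightarrow> integrable (completion M) g"
    by (rule integrable_cong_AE[OF ae'])
  show "integral\<^sup>L (completion M) f = integral\<^sup>L (completion M) g"
    by (rule integral_cong_AE[OF ae'])
qed

lemma completion_ex_borel_measurable_euclidean:
  fixes f :: "'a \<Rightarrow> 'b::euclidean_space"
  assumes f: "f \<in> borel_measurable (completion M)"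
  obtains g where "g \<in> borel_measurable M" "AE x in M. f x = g x"
proof -
  have "\<forall>b\<in>Basis. \<exists>g. g \<in> borel_measurable M \<and> (AE x in M. f x \<bullet> b = g x)"
  proof
    fix b :: 'b assume "b \<in> Basis"
    have "(\<lambda>x. f x \<bullet> b) \<in> borel_measurable (completion M)"
      using f by measurable
    from completion_ex_borel_measurable_real[OF this]
    show "\<exists>g. g \<in> borel_measurable M \<and> (AE x in M. f x \<bullet> b = g x)" by blast
  qed
  then obtain g where g: "\<And>b. b \<in> Basis \<Longrightarrow> g b \<in> borel_measurable M" "\<And>b. b \<in> Basis \<Longrightarrow> AE x in M. f x \<bullet> b = g b x"
    by metis
  show thesis
  proof
    show "(\<lambda>x. \<Sum>b\<in>Basis. g b x *\<^sub>R b) \<in> borel_measurable M"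
      using g by (intro borel_measurable_sum borel_measurable_scaleR) auto
    have "AE x in M. \<forall>b\<in>Basis. f x \<bullet> b = g b x"
      using g by (intro AE_finite_allI) auto
    then show "AE x in M. f x = (\<Sum>b\<in>Basis. g b x *\<^sub>R b)"
    proof eventually_elim
      fix x assume *: "\<forall>b\<in>Basis. f x \<bullet> b = g b x"
      have "f x = (\<Sum>b\<in>Basis. (f x \<bullet> b) *\<^sub>R b)"
        by (simp add: euclidean_representation)
      then show "f x = (\<Sum>b\<in>Basis. g b x *\<^sub>R b)"
        using * by simp
    qed
  qed
qed

text \<open>
  An invertible matrix pulls null sets back to null sets; Tonelli's theorem then exchanges
  for every \<open>y\<close> and almost every \<open>x\<close> with for almost every \<open>x\<close> and almost every \<open>y\<close>. This is what makes
  \<open>f (A y x)\<close> meaningful for a function \<open>f\<close> that is only given almost everywhere.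
\<close>

lemma AE_AE_matrix_vector:
  fixes A :: "'b::euclidean_space \<Rightarrow> real^'n^'n"
  assumes [measurable]: "A \<in> borel_measurable borel" and P: "AE z in lborel. P z"
  shows "AE x in lborel. AE y in lborel. det (A y) \<noteq> 0 \<longrightarrow> P (A y *v x)"
proof -
  obtain N where N: "{z \<in> space lborel. \<not> P z} \<subseteq> N" "emeasure lborel N = 0" "N \<in> sets lborel"
    using P by (rule AE_E)
  have [measurable]: "N \<in> sets borel" using N by simp
  have [measurable]: "(\<lambda>M::real^'n^'n. det M) \<in> borel_measurable borel"
    unfolding det_def by (intro borel_measurable_continuous_onI continuous_intros)
  have slice: "AE x in lborel. M *v x \<notin> N" if det: "det M \<noteq> 0" for M :: "real^'n^'n"
  proof -
    have "ennreal \<bar>det M\<bar> * (\<integral>\<^sup>+x. indicator N (M *v x) \<partial>lborel) = (\<integral>\<^sup>+x. indicator N x \<partial>lborel)"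
      using det by (intro nn_integral_linear_substitution) auto
    then have "(\<integral>\<^sup>+x. indicator N (M *v x) \<partial>lborel) = 0"
      using N det by simp
    then have "AE x in lborel. indicator N (M *v x) = (0 :: ennreal)"
      by (subst (asm) nn_integral_0_iff_AE) auto
    then show ?thesis
      by eventually_elim (auto simp: indicator_def split: if_splits)
  qed
  have "AE y in lborel. AE x in lborel. det (A y) \<noteq> 0 \<longrightarrow> A y *v x \<notin> N"
    by (rule AE_I2) (use slice in auto)
  moreover have "{p \<in> space (lborel \<Otimes>\<^sub>M lborel). det (A (snd p)) \<noteq> 0 \<longrightarrow> A (snd p) *v fst p \<notin> N} \<in> sets (lborel \<Otimes>\<^sub>M lborel)"
    by measurable
  ultimately have "AE x in lborel. AE y in lborel. det (A y) \<noteq> 0 \<longrightarrow> A y *v x \<notin> N"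
    by (subst lborel_pair.AE_commute) auto
  then show ?thesis
  proof eventually_elim
    fix x assume "AE y in lborel. det (A y) \<noteq> 0 \<longrightarrow> A y *v x \<notin> N"
    then show "AE y in lborel. det (A y) \<noteq> 0 \<longrightarrow> P (A y *v x)"
      by eventually_elim (use N in auto)
  qed
qed

lemma AE_hausdorff_integrand_eq:
  fixes \<Phi> \<Phi>' f f' :: "'n::finite heis \<Rightarrow> complex"
  assumes "A' \<in> borel_measurable borel"
    and \<Phi>: "AE y in lborel. \<Phi> y = \<Phi>' y" and A: "AE y in lborel. A y = A' y" and f: "AE z in lborel. f z = f' z"
    and det: "AE y in lborel. \<Phi>' y \<noteq> 0 \<longrightarrow> det (A' y) \<noteq> 0"
  shows "AE x in lborel. AE y in lborel. hausdorff_integrand \<Phi> A f x y = hausdorff_integrand \<Phi>' A' f' x y"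
  using AE_AE_matrix_vector[OF assms(1) f]
proof eventually_elim
  fix x assume "AE y in lborel. det (A' y) \<noteq> 0 \<longrightarrow> f (A' y *v x) = f' (A' y *v x)"
  with \<Phi> A det show "AE y in lborel. hausdorff_integrand \<Phi> A f x y = hausdorff_integrand \<Phi>' A' f' x y"
    by eventually_elim (auto simp: hausdorff_integrand_def)
qed

lemma AE_hausdorff_eq:
  fixes \<Phi> \<Phi>' f f' :: "'n::finite heis \<Rightarrow> complex"
  assumes [measurable]: "\<Phi>' \<in> borel_measurable borel" "A' \<in> borel_measurable borel" "f' \<in> borel_measurable borel"
    and "AE y in lborel. \<Phi> y = \<Phi>' y" "AE y in lborel. A y = A' y" "AE z in lborel. f z = f' z"
    and "AE y in lborel. \<Phi>' y \<noteq> 0 \<longrightarrow> det (A' y) \<noteq> 0"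
  shows "AE x in lborel. hausdorff \<Phi> A f x = hausdorff \<Phi>' A' f' x
    \<and> (integrable lebesgue (hausdorff_integrand \<Phi> A f x) \<longleftrightarrow> integrable lebesgue (hausdorff_integrand \<Phi>' A' f' x))"
  using AE_hausdorff_integrand_eq[OF assms(2,4-7)]
proof eventually_elim
  fix x assume ae: "AE y in lborel. hausdorff_integrand \<Phi> A f x y = hausdorff_integrand \<Phi>' A' f' x y"
  have "hausdorff_integrand \<Phi>' A' f' x \<in> borel_measurable lborel"
    by measurable
  from integral_completion_cong_AE[OF this ae]
  show "hausdorff \<Phi> A f x = hausdorff \<Phi>' A' f' x
    \<and> (integrable lebesgue (hausdorff_integrand \<Phi> A f x) \<longleftrightarrow> integrable lebesgue (hausdorff_integrand \<Phi>' A' f' x))"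
    by (simp add: hausdorff_def)
qed

lemma morrey_norm_cong_AE:
  assumes "AE x in lborel. f x = g x"
  shows "morrey_norm p lam w f = morrey_norm p lam w g"
proof -
  have "(\<integral>\<^sup>+x\<in>hball 0 r. ennreal (cmod (f x) powr p * w x) \<partial>lebesgue) = (\<integral>\<^sup>+x\<in>hball 0 r. ennreal (cmod (g x) powr p * w x) \<partial>lebesgue)" for r
    unfolding nn_integral_completion by (rule nn_integral_cong_AE) (use assms in \<open>eventually_elim, simp\<close>)
  then show ?thesis
    unfolding morrey_norm_def by simp
qed

lemma morrey_norm_zero: "0 < p \<Longrightarrow> morrey_norm p lam w (\<lambda>_. 0) = 0"
  by (simp add: morrey_norm_def epowr_def)

lemma cmo_norm_cong_AE:
  fixes f g :: "'n::finite heis \<Rightarrow> complex"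
  assumes [measurable]: "g \<in> borel_measurable borel" and ae: "AE x in lborel. f x = g x"
  shows "cmo_norm p w f = cmo_norm p w g"
proof -
  have mean: "ball_mean f r = ball_mean g r" for r
  proof -
    have "(LINT x|lebesgue. indicator (hball 0 r) x *\<^sub>R f x) = (LINT x|lebesgue. indicator (hball 0 r) x *\<^sub>R g x)"
      by (rule integral_completion_cong_AE(2)) (measurable, use ae in \<open>eventually_elim, simp\<close>)
    then show ?thesis
      by (simp add: ball_mean_def set_lebesgue_integral_def)
  qed
  have "(\<integral>\<^sup>+x\<in>hball 0 r. ennreal (cmod (f x - ball_mean f r) powr p * w x) \<partial>lebesgue)
    = (\<integral>\<^sup>+x\<in>hball 0 r. ennreal (cmod (g x - ball_mean g r) powr p * w x) \<partial>lebesgue)" for r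
    unfolding nn_integral_completion mean by (rule nn_integral_cong_AE) (use ae in \<open>eventually_elim, simp\<close>)
  then show ?thesis
    unfolding cmo_norm_def by simp
qed

lemma locally_integrable_cong_AE:
  fixes f g :: "'n::finite heis \<Rightarrow> complex"
  assumes [measurable]: "g \<in> borel_measurable borel" and ae: "AE x in lborel. f x = g x" and f: "locally_integrable f"
  shows "locally_integrable g"
  unfolding locally_integrable_def
proof (intro allI impI)
  fix K :: "'n heis set" assume K: "compact K"
  then have [measurable]: "K \<in> sets borel" by (simp add: borel_compact)
  have "integrable lebesgue (\<lambda>x. indicator K x *\<^sub>R f x) \<longleftrightarrow> integrable lebesgue (\<lambda>x. indicator K x *\<^sub>R g x)"
    by (rule integral_completion_cong_AE(1)) (measurable, use ae in \<open>eventually_elim, simp\<close>)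
  with f K show "set_integrable lebesgue K g"
    by (auto simp: locally_integrable_def set_integrable_def)
qed

section \<open>Functions of norm zero\<close>

lemma AE_zero_if_Lp_bound_arbitrarily_small:
  assumes c: "0 < c" and q: "0 < q" and small: "\<And>F. 0 < F \<Longrightarrow> Lp_bound M q g (c * F)"
  shows "AE x in M. g x = 0"
proof -
  have [measurable]: "g \<in> borel_measurable M"
    using small[of 1] by (simp add: Lp_bound_def)
  have "(\<integral>\<^sup>+x. ennreal (\<bar>g x\<bar> powr q) \<partial>M) \<le> 0"
  proof (rule ennreal_le_epsilon)
    fix e :: real assume e: "0 < e"
    have "c * (e powr (1 / q) / c) = e powr (1 / q)" using c by simp
    with small[of "e powr (1 / q) / c"] have "Lp_bound M q g (e powr (1 / q))"
      using c e by simp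
    then show "(\<integral>\<^sup>+x. ennreal (\<bar>g x\<bar> powr q) \<partial>M) \<le> 0 + ennreal e"
      using e q by (simp add: Lp_bound_def powr_powr)
  qed
  then have "AE x in M. ennreal (\<bar>g x\<bar> powr q) = 0"
    by (subst (asm) le_zero_eq, subst (asm) nn_integral_0_iff_AE) auto
  then show ?thesis
    by eventually_elim (simp add: ennreal_eq_0_iff)
qed

lemma morrey_norm_eq_zero_imp:
  fixes f :: "'n::finite heis \<Rightarrow> complex"
  assumes f: "f \<in> borel_measurable borel" and p: "0 < p" and \<alpha>: "- real (hdim TYPE('n)) < \<alpha>"
    and zero: "morrey_norm p lam (hweight \<alpha>) f = 0"
  shows "AE x in lborel. f x = 0"
proof (rule AE_lborel_if_AE_balls)
  fix R :: real assume R: "0 < R"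
  have "AE x in ball_measure \<alpha> R. cmod (f x) = 0"
  proof (rule AE_zero_if_Lp_bound_arbitrarily_small[OF _ p])
    show "0 < ball_weight TYPE('n) \<alpha> R powr (1 / p + lam)"
      using ball_weight_pos[OF \<alpha> R] by simp
    fix F :: real assume F: "0 < F"
    show "Lp_bound (ball_measure \<alpha> R) p (\<lambda>x. cmod (f x)) (ball_weight TYPE('n) \<alpha> R powr (1 / p + lam) * F)"
      using morrey_norm_le_iff[OF f p F \<alpha>, of lam] zero R by simp
  qed
  then show "AE x in ball_measure \<alpha> R. f x = 0"
    by simp
qed

text \<open>
  On every ball \<open>b\<close> coincides almost everywhere with its mean over that ball.
\<close>

lemma cmo_norm_eq_zero_imp:
  fixes b :: "'n::finite heis \<Rightarrow> complex"
  assumes b: "b \<in> borel_measurable borel" and p: "0 < p" and \<alpha>: "- real (hdim TYPE('n)) < \<alpha>"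
    and zero: "cmo_norm p (hweight \<alpha>) b = 0"
  obtains c where "AE x in lborel. b x = c"
proof
  have eq: "AE x in lborel. hnorm x < R \<longrightarrow> b x = ball_mean b R" if R: "0 < R" for R
  proof -
    have "AE x in ball_measure \<alpha> R. cmod (b x - ball_mean b R) = 0"
    proof (rule AE_zero_if_Lp_bound_arbitrarily_small[OF _ p])
      show "0 < ball_weight TYPE('n) \<alpha> R powr (1 / p)"
        using ball_weight_pos[OF \<alpha> R] by simp
      fix F :: real assume F: "0 < F"
      show "Lp_bound (ball_measure \<alpha> R) p (\<lambda>x. cmod (b x - ball_mean b R)) (ball_weight TYPE('n) \<alpha> R powr (1 / p) * F)"
        using cmo_norm_le_iff[OF b p F \<alpha>] zero R by simp
    qed
    then show ?thesis
      by (simp add: AE_ball_measure)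
  qed
  \<comment> \<open>Two balls about the origin meet in a set of positive measure, so all the means agree.\<close>
  have const: "ball_mean b R = ball_mean b 1" if R: "0 < R" for R
  proof (rule ccontr)
    assume ne: "ball_mean b R \<noteq> ball_mean b 1"
    have "AE x in lborel. x \<notin> hball (0 :: 'n heis) (min R 1)"
      using eq[OF R] eq[OF zero_less_one] by eventually_elim (use ne in auto)
    then have "emeasure lborel (hball (0 :: 'n heis) (min R 1)) = 0"
      by (subst (asm) AE_iff_measurable[OF _ refl]) (auto simp: hball_zero)
    then show False
      using wmeas_hball_pos[of "min R 1" 0, where 'n='n] R by (simp add: emeasure_hball_zero)
  qed
  show "AE x in lborel. b x = ball_mean b 1"
  proof (rule AE_lborel_if_AE_balls)
    fix R :: real assume R: "0 < R"
    show "AE x in ball_measure \<alpha> R. b x = ball_mean b 1"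
      unfolding AE_ball_measure using eq[OF R] const[OF R] by simp
  qed
qed

text \<open>
  Multiplication by a constant commutes with the Hausdorff operator, also where its integral diverges,
  because the Bochner integral is then zero on both sides.
\<close>

lemma hausdorff_commutator_AE_zero:
  fixes \<Phi> f b :: "'n::finite heis \<Rightarrow> complex"
  assumes [measurable]: "\<Phi> \<in> borel_measurable borel" "A \<in> borel_measurable borel" "f \<in> borel_measurable borel" "b \<in> borel_measurable borel"
    and det: "AE y in lborel. \<Phi> y \<noteq> 0 \<longrightarrow> det (A y) \<noteq> 0"
    and zero: "(AE x in lborel. f x = 0) \<or> (AE x in lborel. b x = c)"
  shows "AE x in lborel. hausdorff_commutator \<Phi> A b f x = 0"
  using zero
proof
  assume f: "AE x in lborel. f x = 0"
  then have bf: "AE x in lborel. b x * f x = 0"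
    by eventually_elim simp
  have z: "hausdorff \<Phi> A (\<lambda>_. 0) x = 0" for x
    by (simp add: hausdorff_def hausdorff_integrand_def)
  have "AE x in lborel. hausdorff \<Phi> A f x = hausdorff \<Phi> A (\<lambda>_. 0) x \<and>
      (integrable lebesgue (hausdorff_integrand \<Phi> A f x) \<longleftrightarrow> integrable lebesgue (hausdorff_integrand \<Phi> A (\<lambda>_. 0) x))"
    by (rule AE_hausdorff_eq) (use f det in auto)
  moreover have "AE x in lborel. hausdorff \<Phi> A (\<lambda>x. b x * f x) x = hausdorff \<Phi> A (\<lambda>_. 0) x \<and>
      (integrable lebesgue (hausdorff_integrand \<Phi> A (\<lambda>x. b x * f x) x) \<longleftrightarrow> integrable lebesgue (hausdorff_integrand \<Phi> A (\<lambda>_. 0) x))"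
    by (rule AE_hausdorff_eq) (use bf det in auto)
  ultimately show ?thesis
    by eventually_elim (simp add: hausdorff_commutator_def z)
next
  assume b: "AE x in lborel. b x = c"
  then have bf: "AE x in lborel. b x * f x = c * f x"
    by eventually_elim simp
  have z: "hausdorff \<Phi> A (\<lambda>x. c * f x) x = c * hausdorff \<Phi> A f x" for x
  proof -
    have "hausdorff_integrand \<Phi> A (\<lambda>x. c * f x) x = (\<lambda>y. c * hausdorff_integrand \<Phi> A f x y)"
      by (auto simp: hausdorff_integrand_def)
    then show ?thesis
      by (simp add: hausdorff_def)
  qed
  have "AE x in lborel. hausdorff \<Phi> A (\<lambda>x. b x * f x) x = hausdorff \<Phi> A (\<lambda>x. c * f x) x \<and>
      (integrable lebesgue (hausdorff_integrand \<Phi> A (\<lambda>x. b x * f x) x) \<longleftrightarrow> integrable lebesgue (hausdorff_integrand \<Phi> A (\<lambda>x. c * f x) x))"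
    by (rule AE_hausdorff_eq) (use bf det in auto)
  with b show ?thesis
    by eventually_elim (simp add: hausdorff_commutator_def z)
qed

section \<open>The bound for general data\<close>

text \<open>
  All data are replaced by Borel functions that agree with them almost everywhere; neither the norms nor, almost
  everywhere, the commutator notices the change. If one of the two norms is zero, then the commutator
  vanishes almost everywhere, so the bound also holds when \<open>K\<close> is infinite. Otherwise an infinite
  \<open>K\<close> makes it trivial, and a finite \<open>K\<close> is approximated from above by positive numbers.
\<close>

lemma hausdorff_commutator_morrey_bound:
  fixes p p\<^sub>1 p\<^sub>2 lam \<alpha> L :: real and h :: "'n::finite heis_mat \<Rightarrow> ennreal"
    and \<Phi> f b :: "'n heis \<Rightarrow> complex" and A :: "'n heis \<Rightarrow> 'n heis_mat"
  assumes p: "1 \<le> p" "1 \<le> p\<^sub>1" "1 \<le> p\<^sub>2" and eq: "1 / p = 1 / p\<^sub>1 + 1 / p\<^sub>2" and \<alpha>: "- real (hdim TYPE('n)) < \<alpha>"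
    and h: "dominates_slices p p\<^sub>1 lam \<alpha> h"
    and means: "means_vary_slowly p\<^sub>2 \<alpha> L TYPE('n)" and L: "0 < L"
    and data: "hausdorff_data \<Phi> A" and f: "f \<in> central_morrey p\<^sub>1 lam (hweight \<alpha>)"
    and loc: "locally_integrable b" and b: "b \<in> central_cmo p\<^sub>2 (hweight \<alpha>)"
  defines "K \<equiv> (\<integral>\<^sup>+y. ennreal (cmod (\<Phi> y) / hnorm y ^ hdim TYPE('n)) * h (A y) \<partial>lebesgue)"
  shows "morrey_norm p lam (hweight \<alpha>) (hausdorff_commutator \<Phi> A b f)
      \<le> ennreal (2 * (1 + 2 * L)) * K * morrey_norm p\<^sub>1 lam (hweight \<alpha>) f * cmo_norm p\<^sub>2 (hweight \<alpha>) b"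
    and "K < \<infinity> \<Longrightarrow> commutator_well_defined \<Phi> A b f \<and> hausdorff_commutator \<Phi> A b f \<in> central_morrey p lam (hweight \<alpha>)"
proof -
  have p0: "0 < p" "0 < p\<^sub>1" "0 < p\<^sub>2" using p by auto
  have meas: "f \<in> borel_measurable lebesgue" "b \<in> borel_measurable lebesgue" "A \<in> borel_measurable lebesgue"
    using f b data by (auto simp: central_morrey_def central_cmo_def Lp_loc_def hausdorff_data_def)
  have "\<Phi> \<in> borel_measurable lebesgue"
  proof -
    \<comment> \<open>Local integrability gives measurability on balls only, so \<open>\<Phi>\<close> is the limit of its truncations.\<close>
    have "set_borel_measurable lebesgue (cball 0 (real n)) \<Phi>" for n
      using data unfolding hausdorff_data_def locally_integrable_def set_integrable_def set_borel_measurable_def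
      by (blast intro: compact_cball borel_measurable_integrable)
    moreover have "(\<lambda>n. indicator (cball 0 (real n)) y *\<^sub>R \<Phi> y) \<longlonglongrightarrow> \<Phi> y" for y
    proof (rule tendsto_eventually)
      obtain N where "norm y \<le> real N" using real_arch_simple by blast
      then show "\<forall>\<^sub>F n in sequentially. indicator (cball 0 (real n)) y *\<^sub>R \<Phi> y = \<Phi> y"
        by (intro eventually_sequentiallyI[of N]) (simp add: indicator_def)
    qed
    ultimately show ?thesis
      unfolding set_borel_measurable_def by (rule borel_measurable_LIMSEQ_metric)
  qed
  then obtain \<Phi>' where \<Phi>'[measurable]: "\<Phi>' \<in> borel_measurable borel" and \<Phi>ae: "AE y in lborel. \<Phi> y = \<Phi>' y"
    by (rule completion_ex_borel_measurable_euclidean) simp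
  obtain A' where A'[measurable]: "A' \<in> borel_measurable borel" and Aae: "AE y in lborel. A y = A' y"
    using meas(3) by (rule completion_ex_borel_measurable_euclidean) simp
  obtain f' where f'[measurable]: "f' \<in> borel_measurable borel" and fae: "AE y in lborel. f y = f' y"
    using meas(1) by (rule completion_ex_borel_measurable_euclidean) simp
  obtain b' where b'[measurable]: "b' \<in> borel_measurable borel" and bae: "AE y in lborel. b y = b' y"
    using meas(2) by (rule completion_ex_borel_measurable_euclidean) simp
  have "AE y in lborel. \<Phi> y \<noteq> 0 \<longrightarrow> det (A y) \<noteq> 0"
    using data unfolding hausdorff_data_def by (simp add: support_on_def AE_completion_iff)
  with \<Phi>ae Aae have det: "AE y in lborel. \<Phi>' y \<noteq> 0 \<longrightarrow> det (A' y) \<noteq> 0"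
    by eventually_elim simp
  have bfae: "AE z in lborel. b z * f z = b' z * f' z"
    using bae fae by eventually_elim simp
  note ae1 = AE_hausdorff_eq[OF \<Phi>' A' f' \<Phi>ae Aae fae det]
  note ae2 = AE_hausdorff_eq[OF \<Phi>' A' borel_measurable_times[OF b' f'] \<Phi>ae Aae bfae det]
  let ?H = "hausdorff_commutator \<Phi> A b f" and ?H' = "hausdorff_commutator \<Phi>' A' b' f'"
  have Hae: "AE x in lborel. ?H x = ?H' x"
    using ae1 ae2 bae by eventually_elim (simp add: hausdorff_commutator_def)
  have H'[measurable]: "?H' \<in> borel_measurable borel"
    by measurable
  have K_eq: "K = (\<integral>\<^sup>+y. ennreal (cmod (\<Phi>' y) / hnorm y ^ hdim TYPE('n)) * h (A' y) \<partial>lborel)"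
    unfolding K_def nn_integral_completion
    by (rule nn_integral_cong_AE) (use \<Phi>ae Aae in \<open>eventually_elim, simp\<close>)
  have H_eq: "morrey_norm p lam (hweight \<alpha>) ?H = morrey_norm p lam (hweight \<alpha>) ?H'"
    by (rule morrey_norm_cong_AE[OF Hae])
  define nf where "nf = morrey_norm p\<^sub>1 lam (hweight \<alpha>) f"
  define nb where "nb = cmo_norm p\<^sub>2 (hweight \<alpha>) b"
  have nf': "morrey_norm p\<^sub>1 lam (hweight \<alpha>) f' = nf"
    unfolding nf_def by (rule morrey_norm_cong_AE[OF fae, symmetric])
  have nb': "cmo_norm p\<^sub>2 (hweight \<alpha>) b' = nb"
    unfolding nb_def by (rule cmo_norm_cong_AE[OF b' bae, symmetric])
  have fin: "nf < \<infinity>" "nb < \<infinity>"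
    using f b by (auto simp: nf_def nb_def central_morrey_def central_cmo_def)
  then obtain F B where F: "nf = ennreal F" "0 \<le> F" and B: "nb = ennreal B" "0 \<le> B"
    by (cases nf; cases nb) auto
  have loc': "locally_integrable b'"
    by (rule locally_integrable_cong_AE[OF b' bae loc])
  define C where "C = 2 * (1 + 2 * L)"
  have C: "C > 0" using L by (simp add: C_def)
  note bound = hausdorff_commutator_bound_borel[OF p eq \<alpha> \<Phi>' A' f' b' det loc' h means L, unfolded nf' nb' F(1) B(1), folded K_eq C_def]
  show "morrey_norm p lam (hweight \<alpha>) ?H \<le> ennreal (2 * (1 + 2 * L)) * K * morrey_norm p\<^sub>1 lam (hweight \<alpha>) f * cmo_norm p\<^sub>2 (hweight \<alpha>) b"
    unfolding nf_def[symmetric] nb_def[symmetric] H_eq C_def[symmetric]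
  proof (cases "nf = 0 \<or> nb = 0")
    case True
    obtain c where "(AE x in lborel. f' x = 0) \<or> (AE x in lborel. b' x = c)"
    proof (cases "nf = 0")
      case True
      then show ?thesis using morrey_norm_eq_zero_imp[OF f' p0(2) \<alpha>] nf' that by blast
    next
      case False
      with \<open>nf = 0 \<or> nb = 0\<close> have "cmo_norm p\<^sub>2 (hweight \<alpha>) b' = 0" using nb' by simp
      from cmo_norm_eq_zero_imp[OF b' p0(3) \<alpha> this] show ?thesis using that by blast
    qed
    then have "AE x in lborel. ?H' x = 0"
      by (rule hausdorff_commutator_AE_zero[OF \<Phi>' A' f' b' det])
    then have "morrey_norm p lam (hweight \<alpha>) ?H' = 0"
      using morrey_norm_cong_AE[of ?H' "\<lambda>_. 0"] morrey_norm_zero[OF p0(1)] by simp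
    then show "morrey_norm p lam (hweight \<alpha>) ?H' \<le> ennreal C * K * nf * nb"
      by simp
  next
    case False
    then have pos: "0 < F" "0 < B" using F B by auto
    show "morrey_norm p lam (hweight \<alpha>) ?H' \<le> ennreal C * K * nf * nb"
    proof (cases K)
      case top
      then show ?thesis using C pos F B by (simp add: ennreal_mult_top ennreal_top_mult)
    next
      case (real k)
      have "morrey_norm p lam (hweight \<alpha>) ?H' \<le> ennreal (C * k * F * B)"
      proof (rule ennreal_le_epsilon)
        fix e :: real assume e: "0 < e"
        let ?\<epsilon> = "e / (C * F * B)"
        have \<epsilon>: "?\<epsilon> > 0" using e C pos by simp
        have "morrey_norm p lam (hweight \<alpha>) ?H' \<le> ennreal (C * (k + ?\<epsilon>) * F * B)"
          using \<epsilon> real pos by (intro bound(2)) (auto intro!: ennreal_leI)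
        also have "C * (k + ?\<epsilon>) * F * B = C * k * F * B + e"
          using C pos by (simp add: distrib_left distrib_right)
        finally show "morrey_norm p lam (hweight \<alpha>) ?H' \<le> ennreal (C * k * F * B) + ennreal e"
          using C real pos e by simp
      qed
      then show ?thesis
        using C real pos F B by (simp add: ennreal_mult)
    qed
  qed
  assume "K < \<infinity>"
  then obtain k where k: "K = ennreal k" "0 \<le> k" by (cases K) auto
  have wd: "AE x in lborel. integrable lebesgue (hausdorff_integrand \<Phi>' A' f' x)
        \<and> integrable lebesgue (hausdorff_integrand \<Phi>' A' (\<lambda>z. b' z * f' z) x)"
    using k F B by (intro bound(1)[of "F + 1" "B + 1" "k + 1"]) (auto intro!: ennreal_leI simp del: ennreal_plus)
  define X where "X = C * (k + 1) * (F + 1) * (B + 1)"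
  have X: "X > 0" unfolding X_def using C k F B by (intro mult_pos_pos) auto
  have HX: "morrey_norm p lam (hweight \<alpha>) ?H' \<le> ennreal X"
    unfolding X_def using k F B by (intro bound(2)) (auto intro!: ennreal_leI simp del: ennreal_plus)
  have "commutator_well_defined \<Phi> A b f"
    unfolding commutator_well_defined_def AE_completion_iff using wd ae1 ae2 by eventually_elim simp
  moreover have "?H \<in> central_morrey p lam (hweight \<alpha>)"
    unfolding central_morrey_def Lp_loc_def mem_Collect_eq
  proof (intro conjI allI impI)
    show "?H \<in> borel_measurable lebesgue"
      by (rule borel_measurable_completion_AE[OF _ Hae]) simp
    show "morrey_norm p lam (hweight \<alpha>) ?H < \<infinity>"
      unfolding H_eq using HX by (auto intro: le_less_trans)
    fix S :: "'n heis set" assume "compact S"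
    then obtain r where r: "0 < r" "S \<subseteq> hball 0 r" by (rule compact_subset_hball)
    have "(\<integral>\<^sup>+x\<in>S. ennreal (cmod (?H x) powr p * hweight \<alpha> x) \<partial>lebesgue) = (\<integral>\<^sup>+x\<in>S. ennreal (cmod (?H' x) powr p * hweight \<alpha> x) \<partial>lebesgue)"
      unfolding nn_integral_completion by (rule nn_integral_cong_AE) (use Hae in \<open>eventually_elim, simp\<close>)
    also have "\<dots> \<le> (\<integral>\<^sup>+x\<in>hball 0 r. ennreal (cmod (?H' x) powr p * hweight \<alpha> x) \<partial>lebesgue)"
      using r by (intro nn_integral_mono) (auto simp: indicator_def)
    also have "\<dots> = (\<integral>\<^sup>+x. ennreal (\<bar>cmod (?H' x)\<bar> powr p) \<partial>ball_measure \<alpha> r)"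
      by (rule set_nn_integral_ball_measure[OF H'])
    also have "\<dots> < \<infinity>"
      using morrey_norm_le_iff[OF H' p0(1) X \<alpha>, of lam] HX r by (auto simp: Lp_bound_def intro: le_less_trans)
    finally show "(\<integral>\<^sup>+x\<in>S. ennreal (cmod (?H x) powr p * hweight \<alpha> x) \<partial>lebesgue) < \<infinity>" .
  qed
  ultimately show "commutator_well_defined \<Phi> A b f \<and> ?H \<in> central_morrey p lam (hweight \<alpha>)" ..
qed

section \<open>The two integrands dominate the slices\<close>

lemma mat_hnorm_finite:
  fixes M :: "'n::finite heis_mat"
  assumes det: "det M \<noteq> 0" and fin: "mat_hnorm M \<noteq> \<infinity>"
  obtains m where "mat_hnorm M = ennreal m" "0 < m" "\<And>x. hnorm (M *v x) \<le> m * hnorm x"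
proof -
  obtain m where m: "mat_hnorm M = ennreal m" "0 \<le> m"
    using fin by (cases "mat_hnorm M") auto
  have le: "hnorm (M *v x) \<le> m * hnorm x" for x
  proof (cases "x = 0")
    case False
    then have "ennreal (hnorm (M *v x) / hnorm x) \<le> ennreal m"
      unfolding m(1)[symmetric] mat_hnorm_def by (intro SUP_upper) auto
    then show ?thesis
      using False m by (simp add: divide_le_eq)
  qed simp
  have "m \<noteq> 0"
  proof
    assume "m = 0"
    have "M *v x = 0" for x
    proof -
      have "hnorm (M *v x) \<le> 0" using le[of x] \<open>m = 0\<close> by simp
      then have "hnorm (M *v x) = 0" using hnorm_nonneg[of "M *v x"] by linarith
      then show ?thesis by simp
    qed
    then have "M = 0"
      by (simp add: matrix_eq)
    then have "row undefined M = 0"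
      by (simp add: row_def vec_eq_iff)
    then have "det M = 0"
      by (rule det_zero_row(1))
    with det show False ..
  qed
  with m le that show thesis by simp
qed

lemma hweight_mult_le_nonpos:
  fixes M :: "'n::finite heis_mat"
  assumes det: "det M \<noteq> 0" and m: "0 < m" and hM: "\<And>x. hnorm (M *v x) \<le> m * hnorm x" and \<alpha>: "\<alpha> \<le> 0"
  shows "hweight \<alpha> x \<le> m powr (- \<alpha>) * hweight \<alpha> (M *v x)"
proof (cases "x = 0")
  case False
  have "M *v x \<noteq> 0"
    using det False invertible_det_nz[of M] by (metis invertible_def matrix_left_invertible_ker)
  then have "(m * hnorm x) powr \<alpha> \<le> hnorm (M *v x) powr \<alpha>"
    using hM \<alpha> by (intro powr_mono2') auto
  then have "m powr (- \<alpha>) * (m powr \<alpha> * hnorm x powr \<alpha>) \<le> m powr (- \<alpha>) * hnorm (M *v x) powr \<alpha>"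
    using m by (intro mult_left_mono) (auto simp: powr_mult)
  moreover have "m powr (- \<alpha>) * (m powr \<alpha> * hnorm x powr \<alpha>) = hnorm x powr \<alpha>"
    using m by (simp add: powr_minus)
  ultimately show ?thesis by (simp add: hweight_def)
qed (simp add: hweight_def)

lemma epowr_top_nonneg: "0 \<le> a \<Longrightarrow> epowr \<infinity> a \<noteq> 0"
  by (simp add: epowr_def)

lemma epowr_top_pos: "0 < a \<Longrightarrow> epowr \<infinity> a = \<infinity>"
  by (simp add: epowr_def)

lemma epowr_nonzero: "x \<noteq> 0 \<Longrightarrow> x \<noteq> \<infinity> \<or> 0 \<le> a \<Longrightarrow> epowr x a \<noteq> 0"
  by (cases x) (auto simp: epowr_def)

text \<open>
  For \<open>\<alpha> \<le> 0\<close> the bound \<open>|M x| \<le> m |x|\<close> itself controls the weights, with \<open>\<kappa>\<close> equal to \<open>m\<close> to the power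
  \<open>-\<alpha>\<close>. The second summand of the slice factor is then the first dilation factor times
  \<open>m\<^sup>Q / D\<close> to the power \<open>1 / p\<^sub>2\<close>, and \<open>m\<^sup>Q / D\<close> is at least one and at most the maximum.
\<close>

lemma dominates_slices_nonpos:
  assumes p: "1 \<le> p" "1 \<le> p\<^sub>1" "1 \<le> p\<^sub>2" and eq: "1 / p = 1 / p\<^sub>1 + 1 / p\<^sub>2" and lam: "- 1 / p\<^sub>1 \<le> lam"
    and \<alpha>: "- real (hdim TYPE('n::finite)) < \<alpha>" "\<alpha> \<le> 0"
  defines "Q \<equiv> real (hdim TYPE('n))"
  shows "dominates_slices p p\<^sub>1 lam \<alpha> (\<lambda>M::'n heis_mat.
     epowr (mat_hnorm M) ((Q + \<alpha>) * (lam + 1 / p\<^sub>1)) / epowr (abs_det M) (1 / p\<^sub>1)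
          * epowr (mat_hnorm M) (- \<alpha> / p\<^sub>1)
          * max (epowr (mat_hnorm M) Q / abs_det M) (abs_log2 (mat_hnorm M)))"
    (is "dominates_slices _ _ _ _ ?h")
  unfolding dominates_slices_def
proof (intro allI impI)
  fix M :: "'n heis_mat" assume det: "det M \<noteq> 0" and fin: "?h M \<noteq> \<infinity>"
  have p0: "0 < p" "0 < p\<^sub>1" "0 < p\<^sub>2" using p by auto
  have exps: "0 \<le> (Q + \<alpha>) * (lam + 1 / p\<^sub>1)" "0 \<le> - \<alpha> / p\<^sub>1"
    using lam \<alpha> p0 by (auto simp: Q_def intro: divide_nonpos_pos)
  define D where "D = \<bar>det M\<bar>"
  have D: "0 < D" "abs_det M = ennreal D" "\<And>a. epowr (abs_det M) a = ennreal (D powr a)"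
    using det by (simp_all add: D_def abs_det_def epowr_ennreal)
  have "mat_hnorm M \<noteq> \<infinity>"
  proof
    assume top: "mat_hnorm M = \<infinity>"
    have "abs_log2 \<infinity> = \<infinity>" by (simp add: abs_log2_def)
    then have "?h M = \<infinity>"
      unfolding top D(3) using epowr_top_nonneg[OF exps(1)] epowr_top_nonneg[OF exps(2)]
      by (simp add: ennreal_mult_eq_top_iff ennreal_divide_eq_0_iff max_def)
    with fin show False ..
  qed
  with det obtain m where m: "mat_hnorm M = ennreal m" "0 < m" and hM: "\<And>x. hnorm (M *v x) \<le> m * hnorm x"
    by (rule mat_hnorm_finite) auto
  define X where "X = max (m powr Q / D) \<bar>log 2 m\<bar>"
  have X0: "0 \<le> X" unfolding X_def by (simp add: le_max_iff_disj)
  have x: "max (epowr (mat_hnorm M) Q / abs_det M) (abs_log2 (mat_hnorm M)) = ennreal X"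
    unfolding m(1) D(2) X_def using m(2) D(1)
    by (simp add: epowr_ennreal divide_ennreal abs_log2_def max_def ennreal_le_iff)
  have s: "epowr (mat_hnorm M) ((Q + \<alpha>) * (lam + 1 / p\<^sub>1)) / epowr (abs_det M) (1 / p\<^sub>1) * epowr (mat_hnorm M) (- \<alpha> / p\<^sub>1)
    = ennreal (m powr ((Q + \<alpha>) * (lam + 1 / p\<^sub>1)) / D powr (1 / p\<^sub>1) * m powr (- \<alpha> / p\<^sub>1))"
    unfolding m(1) D(3) using m(2) D(1) by (simp add: epowr_ennreal divide_ennreal ennreal_mult[symmetric])
  have h: "?h M = ennreal (m powr ((Q + \<alpha>) * (lam + 1 / p\<^sub>1)) / D powr (1 / p\<^sub>1) * m powr (- \<alpha> / p\<^sub>1) * X)"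
    unfolding s x using X0 by (intro ennreal_mult[symmetric]) auto
  define \<kappa> where "\<kappa> = m powr (- \<alpha>)"
  have \<kappa>: "0 < \<kappa>" using m by (simp add: \<kappa>_def)
  have X1: "1 \<le> m powr Q / D"
    using abs_det_le[OF det m(2) hM] D(1) by (simp add: le_divide_eq D_def Q_def)
  let ?e = "dilation_bound TYPE('n) p\<^sub>1 lam \<alpha> \<kappa> D m"
  have e0: "0 < ?e" using \<kappa> D m by (simp add: dilation_bound_def)
  have e1: "?e = m powr ((Q + \<alpha>) * (lam + 1 / p\<^sub>1)) / D powr (1 / p\<^sub>1) * m powr (- \<alpha> / p\<^sub>1)"
    using m D by (simp add: dilation_bound_def \<kappa>_def powr_divide powr_powr Q_def add.commute)
  have "dilation_bound TYPE('n) p\<^sub>2 0 \<alpha> \<kappa> D m = (m powr Q / D) powr (1 / p\<^sub>2)"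
  proof -
    have "dilation_bound TYPE('n) p\<^sub>2 0 \<alpha> \<kappa> D m = (m powr (- \<alpha>) / D) powr (1 / p\<^sub>2) * (m powr (Q + \<alpha>)) powr (1 / p\<^sub>2)"
      by (simp add: dilation_bound_def \<kappa>_def powr_powr Q_def)
    also have "\<dots> = (m powr (- \<alpha>) / D * m powr (Q + \<alpha>)) powr (1 / p\<^sub>2)"
      using D by (subst powr_mult) auto
    also have "m powr (- \<alpha>) / D * m powr (Q + \<alpha>) = m powr Q / D"
      by (simp add: powr_add[symmetric])
    finally show ?thesis .
  qed
  also have "\<dots> \<le> (m powr Q / D) powr 1"
    using X1 p by (intro powr_mono) auto
  also have "\<dots> \<le> X"
    using X1 by (simp add: X_def)
  finally have "?e * dilation_bound TYPE('n) p\<^sub>2 0 \<alpha> \<kappa> D m \<le> ?e * X"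
    using e0 by (intro mult_left_mono) auto
  then have "slice_factor TYPE('n) p p\<^sub>1 lam \<alpha> \<kappa> D m \<le> 2 * (?e * X)"
    by (simp add: slice_factor_def X_def Q_def dilation_bound_mult[OF eq])
  then have "ennreal (slice_factor TYPE('n) p p\<^sub>1 lam \<alpha> \<kappa> D m) \<le> ennreal (2 * (?e * X))"
    by (rule ennreal_leI)
  also have "\<dots> = 2 * ?h M"
    unfolding h e1[symmetric] using e0 X1 by (simp add: ennreal_mult X_def)
  finally have "ennreal (slice_factor TYPE('n) p p\<^sub>1 lam \<alpha> \<kappa> (\<bar>det M\<bar>) m) \<le> 2 * ?h M"
    by (simp only: D_def)
  moreover have "hweight \<alpha> x \<le> \<kappa> * hweight \<alpha> (M *v x)" for x
    unfolding \<kappa>_def by (rule hweight_mult_le_nonpos[OF det m(2) hM \<alpha>(2)])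
  ultimately show "\<exists>m \<kappa>. 0 < m \<and> 0 < \<kappa> \<and> (\<forall>x. hnorm (M *v x) \<le> m * hnorm x)
        \<and> (\<forall>x. hweight \<alpha> x \<le> \<kappa> * hweight \<alpha> (M *v x))
        \<and> ennreal (slice_factor TYPE('n) p p\<^sub>1 lam \<alpha> \<kappa> (\<bar>det M\<bar>) m) \<le> 2 * ?h M"
    using m(2) \<kappa> hM by blast
qed

text \<open>
  For \<open>\<alpha> > 0\<close> the weights are controlled by \<open>|x| \<le> k |M x|\<close>, where \<open>k\<close> is the norm of the inverse matrix,
  with \<open>\<kappa>\<close> equal to \<open>k\<close> to the power \<open>\<alpha>\<close>; the integrand is then exactly the slice factor. If one
  of the two norms were infinite, so would be the integrand: already its first summand would be, since
  \<open>lam + 1 / p\<close> and \<open>\<alpha> / p\<close> are positive.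
\<close>

lemma dominates_slices_pos:
  assumes p: "1 \<le> p" "1 \<le> p\<^sub>1" "1 \<le> p\<^sub>2" and eq: "1 / p = 1 / p\<^sub>1 + 1 / p\<^sub>2" and lam: "- 1 / p\<^sub>1 \<le> lam"
    and \<alpha>: "0 < \<alpha>"
  defines "Q \<equiv> real (hdim TYPE('n::finite))"
  shows "dominates_slices p p\<^sub>1 lam \<alpha> (\<lambda>M::'n heis_mat.
     epowr (mat_hnorm M) ((Q + \<alpha>) * (lam + 1 / p)) / epowr (abs_det M) (1 / p)
            * epowr (mat_hnorm (matrix_inv M)) (\<alpha> / p)
          + epowr (mat_hnorm M) ((Q + \<alpha>) * (lam + 1 / p\<^sub>1)) / epowr (abs_det M) (1 / p\<^sub>1)
            * epowr (mat_hnorm (matrix_inv M)) (\<alpha> / p\<^sub>1)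
            * max (epowr (mat_hnorm M) Q / abs_det M) (abs_log2 (mat_hnorm M)))"
    (is "dominates_slices _ _ _ _ ?h")
  unfolding dominates_slices_def
proof (intro allI impI)
  fix M :: "'n heis_mat" assume det: "det M \<noteq> 0" and fin: "?h M \<noteq> \<infinity>"
  have p0: "0 < p" "0 < p\<^sub>1" "0 < p\<^sub>2" using p by auto
  have Q: "0 < Q" by (simp add: Q_def)
  have "0 < lam + 1 / p"
  proof -
    have "0 < 1 / p\<^sub>2" using p0 by simp
    moreover have "- (1 / p\<^sub>1) \<le> lam" using lam by simp
    ultimately show ?thesis unfolding eq by linarith
  qed
  then have exps: "0 < (Q + \<alpha>) * (lam + 1 / p)"
    using Q \<alpha> by simp
  define D where "D = \<bar>det M\<bar>"
  have D: "0 < D" "abs_det M = ennreal D" "\<And>a. epowr (abs_det M) a = ennreal (D powr a)"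
    using det by (simp_all add: D_def abs_det_def epowr_ennreal)
  have "\<exists>N. M ** N = mat 1 \<and> N ** M = mat 1"
    using det invertible_det_nz[of M] by (simp add: invertible_def)
  from someI_ex[OF this] have inv: "matrix_inv M ** M = mat 1"
    by (simp add: matrix_inv_def)
  have "det (matrix_inv M) * det M = 1"
    by (simp add: inv flip: det_mul)
  then have det': "det (matrix_inv M) \<noteq> 0" by auto
  have inv0: "mat_hnorm (matrix_inv M) \<noteq> 0"
  proof (cases "mat_hnorm (matrix_inv M) = \<infinity>")
    case False
    with det' show ?thesis by (rule mat_hnorm_finite) auto
  qed simp
  have summand: "epowr (mat_hnorm M) ((Q + \<alpha>) * (lam + 1 / p)) / epowr (abs_det M) (1 / p) * epowr (mat_hnorm (matrix_inv M)) (\<alpha> / p) \<noteq> \<infinity>"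
    using fin by (auto simp: ennreal_add_eq_top)
  have "mat_hnorm M \<noteq> \<infinity>"
  proof
    assume top: "mat_hnorm M = \<infinity>"
    have "epowr (mat_hnorm (matrix_inv M)) (\<alpha> / p) \<noteq> 0"
      using inv0 \<alpha> p0 by (intro epowr_nonzero) auto
    with summand show False
      unfolding top D(3) epowr_top_pos[OF exps] by (simp add: ennreal_top_divide ennreal_top_mult)
  qed
  with det obtain m where m: "mat_hnorm M = ennreal m" "0 < m" and hM: "\<And>x. hnorm (M *v x) \<le> m * hnorm x"
    by (rule mat_hnorm_finite) auto
  have "mat_hnorm (matrix_inv M) \<noteq> \<infinity>"
  proof
    assume top: "mat_hnorm (matrix_inv M) = \<infinity>"
    have "epowr (mat_hnorm (matrix_inv M)) (\<alpha> / p) = \<infinity>"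
      unfolding top using \<alpha> p0 by (intro epowr_top_pos) simp
    with summand show False
      unfolding m(1) D(3) using m(2) D(1) by (simp add: epowr_ennreal divide_ennreal ennreal_mult_top)
  qed
  with det' obtain k where k: "mat_hnorm (matrix_inv M) = ennreal k" "0 < k" and hk: "\<And>x. hnorm (matrix_inv M *v x) \<le> k * hnorm x"
    by (rule mat_hnorm_finite) auto
  define X where "X = max (m powr Q / D) \<bar>log 2 m\<bar>"
  have X0: "0 \<le> X" unfolding X_def by (simp add: le_max_iff_disj)
  define \<kappa> where "\<kappa> = k powr \<alpha>"
  have \<kappa>: "0 < \<kappa>" using k by (simp add: \<kappa>_def)
  have e: "dilation_bound TYPE('n) q lam \<alpha> \<kappa> D m = m powr ((Q + \<alpha>) * (lam + 1 / q)) / D powr (1 / q) * k powr (\<alpha> / q)" for q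
    using k D by (simp add: dilation_bound_def \<kappa>_def powr_divide powr_powr Q_def add.commute)
  have e0: "0 \<le> dilation_bound TYPE('n) q lam \<alpha> \<kappa> D m" for q
    by (simp add: dilation_bound_def)
  have s: "epowr (mat_hnorm M) ((Q + \<alpha>) * (lam + 1 / q)) / epowr (abs_det M) (1 / q) * epowr (mat_hnorm (matrix_inv M)) (\<alpha> / q)
    = ennreal (dilation_bound TYPE('n) q lam \<alpha> \<kappa> D m)" for q
    unfolding m(1) k(1) D(3) e using m(2) k(2) D(1) by (simp add: epowr_ennreal divide_ennreal ennreal_mult[symmetric])
  have x: "max (epowr (mat_hnorm M) Q / abs_det M) (abs_log2 (mat_hnorm M)) = ennreal X"
    unfolding m(1) D(2) X_def using m(2) D(1)
    by (simp add: epowr_ennreal divide_ennreal abs_log2_def max_def ennreal_le_iff)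
  have "?h M = ennreal (slice_factor TYPE('n) p p\<^sub>1 lam \<alpha> \<kappa> D m)"
    unfolding s x using e0 X0
    by (simp add: slice_factor_def X_def[symmetric, unfolded Q_def] ennreal_mult[symmetric] add.commute)
  also have "\<dots> \<le> 2 * ennreal (slice_factor TYPE('n) p p\<^sub>1 lam \<alpha> \<kappa> D m)"
    using mult_right_mono[of 1 "2::ennreal" "ennreal (slice_factor TYPE('n) p p\<^sub>1 lam \<alpha> \<kappa> D m)"] by simp
  finally have "ennreal (slice_factor TYPE('n) p p\<^sub>1 lam \<alpha> \<kappa> (\<bar>det M\<bar>) m) \<le> 2 * ?h M"
    using \<open>?h M = ennreal (slice_factor TYPE('n) p p\<^sub>1 lam \<alpha> \<kappa> D m)\<close> by (simp only: D_def)
  moreover have "hweight \<alpha> x \<le> \<kappa> * hweight \<alpha> (M *v x)" for x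
  proof -
    have "matrix_inv M *v (M *v x) = x"
      by (simp add: matrix_vector_mul_assoc inv)
    with hk[of "M *v x"] have "hnorm x powr \<alpha> \<le> (k * hnorm (M *v x)) powr \<alpha>"
      using \<alpha> by (intro powr_mono2) auto
    then show ?thesis
      using k by (simp add: hweight_def \<kappa>_def powr_mult)
  qed
  ultimately show "\<exists>m \<kappa>. 0 < m \<and> 0 < \<kappa> \<and> (\<forall>x. hnorm (M *v x) \<le> m * hnorm x)
        \<and> (\<forall>x. hweight \<alpha> x \<le> \<kappa> * hweight \<alpha> (M *v x))
        \<and> ennreal (slice_factor TYPE('n) p p\<^sub>1 lam \<alpha> \<kappa> (\<bar>det M\<bar>) m) \<le> 2 * ?h M"
    using m(2) \<kappa> hM by blast
qed

text \<open>
  The exponent \<open>\<gamma>\<close> of the auxiliary weight is \<open>0\<close> for \<open>\<alpha> \<le> 0\<close> and \<open>-\<alpha> / (p\<^sub>2 - 1)\<close> for \<open>\<alpha> > 0\<close>.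
\<close>

lemma ex_means_vary_slowly:
  assumes \<alpha>: "- real (hdim TYPE('n::finite)) < \<alpha>" and p\<^sub>2: "1 \<le> p\<^sub>2"
    and \<gamma>: "- real (hdim TYPE('n)) < \<gamma>"
    and split: "\<And>t h. 0 \<le> t \<Longrightarrow> 0 < h \<Longrightarrow> h < 1 \<Longrightarrow> t \<le> t powr p\<^sub>2 * h powr \<alpha> + h powr \<gamma>"
  obtains L where "0 < L" "means_vary_slowly p\<^sub>2 \<alpha> L TYPE('n)"
proof
  define L where "L = (ball_weight TYPE('n) \<alpha> 1 + ball_weight TYPE('n) \<gamma> 1) * 2 powr real (hdim TYPE('n)) / ball_weight TYPE('n) 0 1"
  show "0 < L"
    unfolding L_def using \<alpha> \<gamma> by (intro divide_pos_pos mult_pos_pos add_pos_pos ball_weight_pos) auto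
  show "means_vary_slowly p\<^sub>2 \<alpha> L TYPE('n)"
    unfolding means_vary_slowly_def
  proof (intro allI impI)
    fix b :: "'n heis \<Rightarrow> complex" and B R S :: real
    assume b: "b \<in> borel_measurable borel" "locally_integrable b" and B: "0 < B" "cmo_norm p\<^sub>2 (hweight \<alpha>) b \<le> ennreal B"
      and R: "0 < R" "0 < S"
    have p0: "0 < p\<^sub>2" using p\<^sub>2 by simp
    have cmo: "Lp_bound (ball_measure \<alpha> r) p\<^sub>2 (\<lambda>x. cmod (b x - ball_mean b r)) (ball_weight TYPE('n) \<alpha> r powr (1 / p\<^sub>2) * B)"
      if "0 < r" for r
      using cmo_norm_le_iff[OF b(1) p0 B(1) \<alpha>] B(2) that by blast
    show "cmod (ball_mean b R - ball_mean b S) \<le> L * (1 + \<bar>log 2 (S / R)\<bar>) * B"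
      unfolding L_def by (rule cmod_ball_mean_diff_le[OF \<alpha> \<gamma> p\<^sub>2 B(1) split b cmo R])
  qed
qed

section \<open>The commutator estimate\<close>

theorem theorem1p4:
  fixes p p\<^sub>1 p\<^sub>2 lam \<alpha> :: real
  assumes "1 \<le> p" and "1 \<le> p\<^sub>1" and "1 \<le> p\<^sub>2"
    and "- 1 / p\<^sub>1 \<le> lam" and "lam < 0"
    and "1 / p = 1 / p\<^sub>1 + 1 / p\<^sub>2"
  shows
    "(- real (hdim TYPE('n::finite)) < \<alpha> \<and> \<alpha> \<le> 0 \<longrightarrow>
       (\<exists>C::real. C > 0 \<and>
         (\<forall>(\<Phi> :: 'n heis \<Rightarrow> complex) A f b.
            hausdorff_data \<Phi> A \<longrightarrow> f \<in> central_morrey p\<^sub>1 lam (hweight \<alpha>) \<longrightarrow>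
            locally_integrable b \<longrightarrow> b \<in> central_cmo p\<^sub>2 (hweight \<alpha>) \<longrightarrow>
              morrey_norm p lam (hweight \<alpha>) (hausdorff_commutator \<Phi> A b f)
                \<le> ennreal C * C4 p\<^sub>1 lam \<alpha> \<Phi> A
                    * morrey_norm p\<^sub>1 lam (hweight \<alpha>) f * cmo_norm p\<^sub>2 (hweight \<alpha>) b
              \<and> (C4 p\<^sub>1 lam \<alpha> \<Phi> A < \<infinity> \<longrightarrow>
                   commutator_well_defined \<Phi> A b f
                   \<and> hausdorff_commutator \<Phi> A b f \<in> central_morrey p lam (hweight \<alpha>)))))
     \<and>
     (0 < \<alpha> \<and> p\<^sub>2 > (real (hdim TYPE('n)) + \<alpha>) / real (hdim TYPE('n)) \<longrightarrow>
       (\<exists>C::real. C > 0 \<and>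
         (\<forall>(\<Phi> :: 'n heis \<Rightarrow> complex) A f b.
            hausdorff_data \<Phi> A \<longrightarrow> f \<in> central_morrey p\<^sub>1 lam (hweight \<alpha>) \<longrightarrow>
            locally_integrable b \<longrightarrow> b \<in> central_cmo p\<^sub>2 (hweight \<alpha>) \<longrightarrow>
              morrey_norm p lam (hweight \<alpha>) (hausdorff_commutator \<Phi> A b f)
                \<le> ennreal C * C5 p p\<^sub>1 lam \<alpha> \<Phi> A
                    * morrey_norm p\<^sub>1 lam (hweight \<alpha>) f * cmo_norm p\<^sub>2 (hweight \<alpha>) b
              \<and> (C5 p p\<^sub>1 lam \<alpha> \<Phi> A < \<infinity> \<longrightarrow>
                   commutator_well_defined \<Phi> A b f
                   \<and> hausdorff_commutator \<Phi> A b f \<in> central_morrey p lam (hweight \<alpha>)))))"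
proof (intro conjI impI)
  let ?Q = "real (hdim TYPE('n))"
  note params = assms(1-3) assms(6)
  assume "- ?Q < \<alpha> \<and> \<alpha> \<le> 0"
  then have \<alpha>: "- ?Q < \<alpha>" "\<alpha> \<le> 0" by auto
  have split: "t \<le> t powr p\<^sub>2 * h powr \<alpha> + h powr 0" if "0 \<le> t" "0 < h" "h < 1" for t h
    using that assms(3) \<alpha>(2) by (rule le_powr_mult_add_powr_nonpos)
  obtain L where L: "0 < L" "means_vary_slowly p\<^sub>2 \<alpha> L TYPE('n)"
    by (rule ex_means_vary_slowly[OF \<alpha>(1) assms(3) _ split]) simp_all
  note bound = hausdorff_commutator_morrey_bound[OF params \<alpha>(1)
      dominates_slices_nonpos[OF params assms(4) \<alpha>] L(2,1)]
  show "\<exists>C::real. C > 0 \<and>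
         (\<forall>(\<Phi> :: 'n heis \<Rightarrow> complex) A f b.
            hausdorff_data \<Phi> A \<longrightarrow> f \<in> central_morrey p\<^sub>1 lam (hweight \<alpha>) \<longrightarrow>
            locally_integrable b \<longrightarrow> b \<in> central_cmo p\<^sub>2 (hweight \<alpha>) \<longrightarrow>
              morrey_norm p lam (hweight \<alpha>) (hausdorff_commutator \<Phi> A b f)
                \<le> ennreal C * C4 p\<^sub>1 lam \<alpha> \<Phi> A
                    * morrey_norm p\<^sub>1 lam (hweight \<alpha>) f * cmo_norm p\<^sub>2 (hweight \<alpha>) b
              \<and> (C4 p\<^sub>1 lam \<alpha> \<Phi> A < \<infinity> \<longrightarrow>
                   commutator_well_defined \<Phi> A b f
                   \<and> hausdorff_commutator \<Phi> A b f \<in> central_morrey p lam (hweight \<alpha>)))"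
    unfolding C4_def Let_def
    by (rule exI[of _ "2 * (1 + 2 * L)"], intro conjI allI impI) (use L(1) bound in \<open>simp, blast+\<close>)
next
  let ?Q = "real (hdim TYPE('n))"
  note params = assms(1-3) assms(6)
  assume "0 < \<alpha> \<and> (?Q + \<alpha>) / ?Q < p\<^sub>2"
  then have \<alpha>: "0 < \<alpha>" and p\<^sub>2: "(?Q + \<alpha>) / ?Q < p\<^sub>2" by auto
  have Q: "0 < ?Q" by simp
  have \<alpha>Q: "- ?Q < \<alpha>" using \<alpha> Q by linarith
  have "?Q + \<alpha> < p\<^sub>2 * ?Q"
    using p\<^sub>2 Q by (simp add: divide_less_eq)
  then have \<alpha>_less: "\<alpha> < (p\<^sub>2 - 1) * ?Q"
    by (simp add: left_diff_distrib)
  then have p\<^sub>2_gt: "1 < p\<^sub>2"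
    using \<alpha> Q by (smt (verit) mult_nonpos_nonneg)
  have \<gamma>: "- ?Q < - \<alpha> / (p\<^sub>2 - 1)"
    using \<alpha>_less p\<^sub>2_gt by (simp add: divide_less_eq mult.commute)
  have split: "t \<le> t powr p\<^sub>2 * h powr \<alpha> + h powr (- \<alpha> / (p\<^sub>2 - 1))" if "0 \<le> t" "0 < h" "h < 1" for t h
    using that(1,2) p\<^sub>2_gt by (rule le_powr_mult_add_powr_pos)
  obtain L where L: "0 < L" "means_vary_slowly p\<^sub>2 \<alpha> L TYPE('n)"
    by (rule ex_means_vary_slowly[OF \<alpha>Q assms(3) \<gamma> split])
  note bound = hausdorff_commutator_morrey_bound[OF params \<alpha>Q
      dominates_slices_pos[OF params assms(4) \<alpha>] L(2,1)]
  show "\<exists>C::real. C > 0 \<and>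
         (\<forall>(\<Phi> :: 'n heis \<Rightarrow> complex) A f b.
            hausdorff_data \<Phi> A \<longrightarrow> f \<in> central_morrey p\<^sub>1 lam (hweight \<alpha>) \<longrightarrow>
            locally_integrable b \<longrightarrow> b \<in> central_cmo p\<^sub>2 (hweight \<alpha>) \<longrightarrow>
              morrey_norm p lam (hweight \<alpha>) (hausdorff_commutator \<Phi> A b f)
                \<le> ennreal C * C5 p p\<^sub>1 lam \<alpha> \<Phi> A
                    * morrey_norm p\<^sub>1 lam (hweight \<alpha>) f * cmo_norm p\<^sub>2 (hweight \<alpha>) b
              \<and> (C5 p p\<^sub>1 lam \<alpha> \<Phi> A < \<infinity> \<longrightarrow>
                   commutator_well_defined \<Phi> A b f
                   \<and> hausdorff_commutator \<Phi> A b f \<in> central_morrey p lam (hweight \<alpha>)))"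
    unfolding C5_def Let_def
    by (rule exI[of _ "2 * (1 + 2 * L)"], intro conjI allI impI) (use L(1) bound in \<open>simp, blast+\<close>)
qed

end
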